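(* Let $\mathcal{A}$ be the Fourier multiplier on $\mathbb{T}$ with $\widehat{\mathcal{A}u}(k)=2\pi\bigl(\sqrt{k^2+1}-1\bigr)\widehat u(k)$, $k\in\mathbb{Z}$, so that $\partial_tu-\partial_x\mathcal{A}u=0$ is the linearized Smith equation. Then for every $s\in\mathbb{R}$: (i) (Exact controllability in any positive time) For every $T>0$ and all $u_0,u_1\in H^s_p(\mathbb{T})$ with $\widehat{u_0}(0)=\widehat{u_1}(0)$, there exists $h\in L^2([0,T];H^s_p(\mathbb{T}))$ such that the unique solution $u\in C([0,T];H^s_p(\mathbb{T}))$ of $\partial_tu=\partial_x\mathcal{A}u+Gh$, $u(0)=u_0$, satisfies $u(T)=u_1$; moreover $\|h\|_{L^2([0,T];H^s_p(\mathbb{T}))}\le\nu(\|u_0\|_{H^s_p(\mathbb{T})}+\|u_1\|_{H^s_p(\mathbb{T})})$ for some positive constant $\nu=\nu(s,g,T)$. (ii) There exist positive constants $M=M(g,s)$ and $\alpha=\alpha(g)$ such that for any $u_0\in H^s_p(\mathbb{T})$ the unique solution $u\in C([0,\infty);H^s_p(\mathbb{T}))$ of $\partial_tu=\partial_x\mathcal{A}u-GG^*u$, $u(0)=u_0$, satisfies $\|u(\cdot,t)-\widehat{u_0}(0)\|_{H^s_p(\mathbb{T})}\le Me^{-\alpha t}\|u_0-\widehat{u_0}(0)\|_{H^s_p(\mathbb{T})}$ for all $t\ge0$. (iii) (Exponential stabilizability with any given decay rate) For every $\lambda>0$ and $u_0\in H^s_p(\mathbb{T})$ there exists a bounded linear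 operator $K_\lambda:H^s_p(\mathbb{T})\to H^s_p(\mathbb{T})$ such that the unique solution $u\in C([0,\infty);H^s_p(\mathbb{T}))$ of $\partial_tu=\partial_x\mathcal{A}u+K_\lambda u$, $u(0)=u_0$, satisfies $\|u(\cdot,t)-\widehat{u_0}(0)\|_{H^s_p(\mathbb{T})}\le Me^{-\lambda t}\|u_0-\widehat{u_0}(0)\|_{H^s_p(\mathbb{T})}$ for all $t\ge0$ and some positive constant $M=M(g,\lambda,s)$.
   Context: $\mathbb{T}=\mathbb{R}/(2\pi\mathbb{Z})$; $\mathscr{P}'$ is the space of periodic distributions (dual of $\mathscr{P}=C_p^\infty(\mathbb{T})$, the $2\pi$-periodic $C^\infty$ functions), with (bilinear) pairing $\langle\cdot,\cdot\rangle$; $\widehat v(k)=\frac1{2\pi}\langle v,e^{-ikx}\rangle$; $H^s_p(\mathbb{T})=\{v\in\mathscr{P}':\|v\|^2_{H^s_p(\mathbb{T})}=2\pi\sum_{k\in\mathbb{Z}}(1+|k|)^{2s}|\widehat v(k)|^2<\infty\}$. The number $\widehat{u_0}(0)$ is also regarded as a constant function. $g\in C_p^\infty(\mathbb{T})$ is a fixed real non-negative function with $\int_0^{2\pi}g\,dx=1$, supported in $\omega$, where $\omega=\{x\in\mathbb{T}:g(x)>0\}$ is an open interval. $G(\phi)=g\phi-g\langle\phi,g\rangle$, a bounded linear operator on every $H^s_p(\mathbb{T})$; $G^*$ is its adjoint operator, with respect to $L^2_p(\mathbb{T})$, in which $G$ is self-adjoint. Solutions of the equation with source $Gh$ are mild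 solutions: $u(t)=U(t)u_0+\int_0^tU(t-t')Gh(t')\,dt'$, where $U(t)$ is the Fourier multiplier with symbol $e^{ika(k)t}$, $a$ being the symbol of $\mathcal{A}$. *)

theory Defs
  imports "HOL-Analysis.Analysis"
begin

section \<open>Test functions on the circle\<close>

text \<open>Functions on the circle are represented by \<open>2 * pi\<close>-periodic functions on the real line.\<close>

definition vderiv :: "(real \<Rightarrow> complex) \<Rightarrow> real \<Rightarrow> complex" where
  "vderiv f = (\<lambda>x. vector_derivative f (at x))"

definition smooth :: "(real \<Rightarrow> complex) \<Rightarrow> bool" where
  "smooth f \<longleftrightarrow> (\<forall>n x. (vderiv ^^ n) f differentiable (at x))"

definition test_functions :: "(real \<Rightarrow> complex) set" where
  "test_functions = {f. smooth f \<and> (\<forall>x. f (x + 2 * pi) = f x)}"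

definition test_tendsto :: "(nat \<Rightarrow> real \<Rightarrow> complex) \<Rightarrow> (real \<Rightarrow> complex) \<Rightarrow> bool" where
  "test_tendsto F f \<longleftrightarrow>
     (\<forall>n. uniform_limit UNIV (\<lambda>j. (vderiv ^^ n) (F j)) ((vderiv ^^ n) f) sequentially)"

lemma vderiv_add:
  assumes "\<And>x. f differentiable (at x)" "\<And>x. g differentiable (at x)"
  shows "vderiv (\<lambda>x. f x + g x) = (\<lambda>x. vderiv f x + vderiv g x)"
  using assms by (simp add: vderiv_def)

lemma vderiv_add_upto:
  assumes "\<And>m x. m < n \<Longrightarrow> (vderiv ^^ m) f differentiable (at x)"
    and "\<And>m x. m < n \<Longrightarrow> (vderiv ^^ m) g differentiable (at x)"
  shows "(vderiv ^^ n) (\<lambda>x. f x + g x) = (\<lambda>x. (vderiv ^^ n) f x + (vderiv ^^ n) g x)"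
  using assms
proof (induction n)
  case (Suc n)
  then have "(vderiv ^^ n) (\<lambda>x. f x + g x) = (\<lambda>x. (vderiv ^^ n) f x + (vderiv ^^ n) g x)"
    by simp
  then show ?case
    using Suc.prems(1)[of n] Suc.prems(2)[of n] by (simp add: vderiv_add)
qed simp

lemma smooth_add_pow:
  assumes "smooth f" "smooth g"
  shows "(vderiv ^^ n) (\<lambda>x. f x + g x) = (\<lambda>x. (vderiv ^^ n) f x + (vderiv ^^ n) g x)"
  using assms by (intro vderiv_add_upto) (auto simp: smooth_def)

lemma smooth_add: "smooth f \<Longrightarrow> smooth g \<Longrightarrow> smooth (\<lambda>x. f x + g x)"
  by (auto simp: smooth_def smooth_add_pow[unfolded smooth_def])

lemma smooth_diff_at: "smooth f \<Longrightarrow> f differentiable (at x)"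
  unfolding smooth_def by (metis funpow_0)

lemma smooth_vderiv: "smooth f \<Longrightarrow> smooth (vderiv f)"
  unfolding smooth_def by (metis comp_apply funpow_Suc_right)

lemma vderiv_mult:
  assumes "smooth f" "smooth g"
  shows "vderiv (\<lambda>x. f x * g x) = (\<lambda>x. f x * vderiv g x + vderiv f x * g x)"
  using smooth_diff_at[OF assms(1)] smooth_diff_at[OF assms(2)] by (simp add: vderiv_def)

lemma smooth_mult_upto:
  assumes "smooth f" "smooth g" "m \<le> n"
  shows "(vderiv ^^ m) (\<lambda>x. f x * g x) differentiable (at x)"
  using assms
proof (induction n arbitrary: m f g x)
  case 0
  then show ?case by (simp add: smooth_diff_at)
next
  case (Suc n)
  show ?case
  proof (cases m)
    case 0
    then show ?thesis using Suc.prems by (simp add: smooth_diff_at)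
  next
    case (Suc k)
    note IH = Suc.IH[OF Suc.prems(1) smooth_vderiv[OF Suc.prems(2)]]
      Suc.IH[OF smooth_vderiv[OF Suc.prems(1)] Suc.prems(2)]
    have k: "k \<le> n" using Suc Suc.prems by simp
    have "(vderiv ^^ m) (\<lambda>x. f x * g x) = (vderiv ^^ k) (\<lambda>x. f x * vderiv g x + vderiv f x * g x)"
      using Suc.prems by (simp only: Suc funpow_Suc_right comp_apply vderiv_mult)
    also have "\<dots> = (\<lambda>x. (vderiv ^^ k) (\<lambda>x. f x * vderiv g x) x + (vderiv ^^ k) (\<lambda>x. vderiv f x * g x) x)"
      using IH k by (intro vderiv_add_upto) auto
    finally show ?thesis using IH[of k] k by auto
  qed
qed

lemma smooth_mult: "smooth f \<Longrightarrow> smooth g \<Longrightarrow> smooth (\<lambda>x. f x * g x)"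
  using smooth_mult_upto unfolding smooth_def[of "\<lambda>x. f x * g x"] by blast

lemma smooth_const: "smooth (\<lambda>_. c)"
proof -
  have "(vderiv ^^ n) (\<lambda>_. c) = (\<lambda>_. if n = 0 then c else 0)" for n
    by (induction n) (auto simp: vderiv_def)
  then show ?thesis by (simp add: smooth_def)
qed

lemma differentiable_cnj:
  assumes "f differentiable (at x)"
  shows "(\<lambda>x. cnj (f x)) differentiable (at (x::real))"
proof -
  from assms obtain D where "(f has_vector_derivative D) (at x)"
    using vector_derivative_works by blast
  then have "((\<lambda>x. cnj (f x)) has_vector_derivative cnj D) (at x)"
    by (rule has_vector_derivative_cnj)
  then show ?thesis by (rule differentiableI_vector)
qed

lemma vderiv_cnj:
  assumes "\<And>x. f differentiable (at x)"
  shows "vderiv (\<lambda>x. cnj (f x)) = (\<lambda>x. cnj (vderiv f x))"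
  using assms by (auto simp: vderiv_def vector_derivative_cnj)

lemma smooth_cnj_pow:
  assumes "smooth f"
  shows "(vderiv ^^ n) (\<lambda>x. cnj (f x)) = (\<lambda>x. cnj ((vderiv ^^ n) f x))"
proof (induction n)
  case (Suc n)
  have "vderiv (\<lambda>x. cnj ((vderiv ^^ n) f x)) = (\<lambda>x. cnj (vderiv ((vderiv ^^ n) f) x))"
    using assms by (intro vderiv_cnj) (auto simp: smooth_def)
  then show ?case by (simp add: Suc)
qed simp

lemma smooth_cnj: "smooth f \<Longrightarrow> smooth (\<lambda>x. cnj (f x))"
  by (auto simp: smooth_def smooth_cnj_pow[unfolded smooth_def] intro!: differentiable_cnj)

lemma smooth_exp: "smooth (\<lambda>x. exp (c * complex_of_real x))"
proof -
  have d: "((\<lambda>x. a * exp (c * complex_of_real x)) has_vector_derivative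
      (a * c * exp (c * complex_of_real x))) (at x)" for a x
    by (rule has_vector_derivative_real_field) (auto intro!: derivative_eq_intros)
  have "vderiv (\<lambda>x. a * exp (c * complex_of_real x)) = (\<lambda>x. a * c * exp (c * complex_of_real x))" for a
    by (auto simp: vderiv_def intro!: vector_derivative_at d)
  then have "(vderiv ^^ n) (\<lambda>x. exp (c * complex_of_real x)) = (\<lambda>x. c ^ n * exp (c * complex_of_real x))" for n
    by (induction n) (simp_all add: mult.commute)
  moreover have "(\<lambda>x. exp (c * complex_of_real x)) differentiable (at x)" for x
    using differentiableI_vector[OF d[of 1 x]] by simp
  ultimately show ?thesis by (simp add: smooth_def)
qed

lemma test_add: "f \<in> test_functions \<Longrightarrow> g \<in> test_functions \<Longrightarrow> (\<lambda>x. f x + g x) \<in> test_functions"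
  by (auto simp: test_functions_def smooth_add)

lemma test_mult: "f \<in> test_functions \<Longrightarrow> g \<in> test_functions \<Longrightarrow> (\<lambda>x. f x * g x) \<in> test_functions"
  by (auto simp: test_functions_def smooth_mult)

lemma test_const: "(\<lambda>_. c) \<in> test_functions"
  by (auto simp: test_functions_def smooth_const)

lemma test_cmult: "f \<in> test_functions \<Longrightarrow> (\<lambda>x. c * f x) \<in> test_functions"
  using test_mult[OF test_const] .

lemma test_cnj: "f \<in> test_functions \<Longrightarrow> (\<lambda>x. cnj (f x)) \<in> test_functions"
  by (auto simp: test_functions_def smooth_cnj)

lemma test_exp: "(\<lambda>x. exp (- (\<i> * of_int k * complex_of_real x))) \<in> test_functions"
proof -
  have "exp (- (\<i> * of_int k * complex_of_real (x + 2 * pi))) = exp (- (\<i> * of_int k * complex_of_real x))" for x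
    by (auto simp: exp_eq algebra_simps intro!: exI[of _ "-k"])
  then show ?thesis
    using smooth_exp[of "- (\<i> * of_int k)"] by (auto simp: test_functions_def)
qed

lemma vderiv_periodic:
  assumes "\<And>x. f (x + p) = f x"
  shows "vderiv f (x + p) = vderiv f x"
proof -
  have "(f has_vector_derivative D) (at (x + p)) \<longleftrightarrow> (f has_vector_derivative D) (at x)" for D
  proof
    assume "(f has_vector_derivative D) (at (x + p))"
    then have "(f \<circ> (\<lambda>x. x + p) has_vector_derivative 1 *\<^sub>R D) (at x)"
      by (intro vector_diff_chain_at) (auto intro!: derivative_eq_intros)
    then show "(f has_vector_derivative D) (at x)" using assms by (simp add: comp_def)
  next
    assume D: "(f has_vector_derivative D) (at x)"
    have "f (y - p) = f y" for y using assms[of "y - p"] by simp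
    moreover have "(f \<circ> (\<lambda>x. x - p) has_vector_derivative 1 *\<^sub>R D) (at (x + p))"
      using D by (intro vector_diff_chain_at) (auto intro!: derivative_eq_intros)
    ultimately show "(f has_vector_derivative D) (at (x + p))" by (simp add: comp_def)
  qed
  then show ?thesis by (simp add: vderiv_def vector_derivative_def)
qed

lemma test_vderiv: "f \<in> test_functions \<Longrightarrow> vderiv f \<in> test_functions"
  using vderiv_periodic[of f "2 * pi"] by (auto simp: test_functions_def smooth_vderiv)

lemma test_vderiv_pow: "f \<in> test_functions \<Longrightarrow> (vderiv ^^ n) f \<in> test_functions"
  by (induction n) (auto simp: test_vderiv)

lemma test_continuous: "f \<in> test_functions \<Longrightarrow> continuous_on S f"
  by (auto simp: test_functions_def continuous_on_eq_continuous_within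
      intro!: differentiable_imp_continuous_within differentiable_at_withinI smooth_diff_at)

lemma test_bounded:
  assumes "f \<in> test_functions"
  shows "bounded (range f)"
proof -
  have per: "f (x + 2 * pi) = f x" for x using assms by (auto simp: test_functions_def)
  have pern: "f (x + real n * (2 * pi)) = f x" for x n
  proof (induction n)
    case (Suc n)
    show ?case using per[of "x + real n * (2 * pi)"] Suc by (simp add: algebra_simps)
  qed simp
  have peri: "f (x + of_int n * (2 * pi)) = f x" for x n
  proof (cases n rule: int_cases2)
    case (nonneg m)
    then show ?thesis using pern[of x m] by simp
  next
    case (nonpos m)
    then show ?thesis using pern[of "x - real m * (2 * pi)" m] by simp
  qed
  have "range f \<subseteq> f ` {0..2 * pi}"
  proof clarify
    fix x
    define n where "n = \<lfloor>x / (2 * pi)\<rfloor>"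
    have "of_int n \<le> x / (2 * pi)" "x / (2 * pi) < of_int n + 1" unfolding n_def by linarith+
    then have "x + of_int (- n) * (2 * pi) \<in> {0..2 * pi}" by (auto simp: field_simps)
    then show "f x \<in> f ` {0..2 * pi}" using peri[of x "- n"] by (metis image_eqI)
  qed
  moreover have "bounded (f ` {0..2 * pi})"
    using test_continuous[OF assms] by (intro compact_imp_bounded compact_continuous_image) auto
  ultimately show ?thesis by (rule bounded_subset[rotated])
qed

lemma test_tendsto_vderiv: "test_tendsto F f \<Longrightarrow> test_tendsto (\<lambda>j. vderiv (F j)) (vderiv f)"
  unfolding test_tendsto_def
proof
  fix n
  assume "\<forall>n. uniform_limit UNIV (\<lambda>j. (vderiv ^^ n) (F j)) ((vderiv ^^ n) f) sequentially"
  from spec[OF this, of "Suc n"]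
  show "uniform_limit UNIV (\<lambda>j. (vderiv ^^ n) (vderiv (F j))) ((vderiv ^^ n) (vderiv f)) sequentially"
    by (simp only: funpow_Suc_right comp_apply)
qed

lemma test_tendsto_uniform: "test_tendsto F f \<Longrightarrow> uniform_limit UNIV F f sequentially"
  unfolding test_tendsto_def by (drule spec[of _ 0]) simp

lemma test_tendsto_add:
  assumes "\<And>j. F j \<in> test_functions" "f \<in> test_functions" "test_tendsto F f"
    and "\<And>j. H j \<in> test_functions" "h \<in> test_functions" "test_tendsto H h"
  shows "test_tendsto (\<lambda>j x. F j x + H j x) (\<lambda>x. f x + h x)"
  using assms by (auto simp: test_tendsto_def test_functions_def smooth_add_pow intro!: uniform_limit_intros)

lemma test_tendsto_mult:
  assumes "\<And>j. F j \<in> test_functions" "f \<in> test_functions" "test_tendsto F f"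
    and "\<And>j. H j \<in> test_functions" "h \<in> test_functions" "test_tendsto H h"
  shows "test_tendsto (\<lambda>j x. F j x * H j x) (\<lambda>x. f x * h x)"
proof -
  have "uniform_limit UNIV (\<lambda>j. (vderiv ^^ n) (\<lambda>x. F j x * H j x)) ((vderiv ^^ n) (\<lambda>x. f x * h x)) sequentially" for n
    using assms
  proof (induction n arbitrary: F f H h)
    case 0
    then have "uniform_limit UNIV F f sequentially" "uniform_limit UNIV H h sequentially"
      by (auto intro: test_tendsto_uniform)
    then show ?case using 0 test_bounded by (auto intro!: uniform_lim_mult)
  next
    case (Suc n)
    have s: "smooth u" if "u \<in> test_functions" for u using that by (simp add: test_functions_def)
    have e: "(vderiv ^^ Suc n) (\<lambda>x. u x * v x) =
        (\<lambda>x. (vderiv ^^ n) (\<lambda>x. u x * vderiv v x) x + (vderiv ^^ n) (\<lambda>x. vderiv u x * v x) x)"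
      if "u \<in> test_functions" "v \<in> test_functions" for u v
      using s[OF that(1)] s[OF that(2)]
      by (simp only: funpow_Suc_right comp_apply vderiv_mult smooth_add_pow smooth_mult smooth_vderiv)
    show ?case unfolding e[OF Suc.prems(1,4)] e[OF Suc.prems(2,5)]
      by (intro uniform_limit_add Suc.IH Suc.prems test_vderiv test_tendsto_vderiv)
  qed
  then show ?thesis by (simp add: test_tendsto_def)
qed

lemma test_tendsto_const: "test_tendsto (\<lambda>_. f) f"
  by (simp add: test_tendsto_def uniform_limit_const)

lemma test_tendsto_constants:
  assumes "c \<longlonglongrightarrow> d"
  shows "test_tendsto (\<lambda>j _. c j) (\<lambda>_. d)"
proof -
  have e: "(vderiv ^^ n) (\<lambda>_. z) = (\<lambda>_. if n = 0 then z else 0)" for n z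
    by (induction n) (auto simp: vderiv_def)
  show ?thesis
    using assms unfolding test_tendsto_def e by (auto simp: uniform_limit_iff tendsto_iff)
qed

lemma test_tendsto_cnj:
  assumes "\<And>j. F j \<in> test_functions" "f \<in> test_functions" "test_tendsto F f"
  shows "test_tendsto (\<lambda>j x. cnj (F j x)) (\<lambda>x. cnj (f x))"
proof -
  have "uniform_limit UNIV (\<lambda>j x. cnj ((vderiv ^^ n) (F j) x)) (\<lambda>x. cnj ((vderiv ^^ n) f x)) sequentially" for n
    using assms(3) by (auto simp: test_tendsto_def uniform_limit_iff dist_norm simp flip: complex_cnj_diff)
  then show ?thesis
    using assms(1,2) by (simp add: test_tendsto_def smooth_cnj_pow test_functions_def)
qed

lemma test_tendsto_integral:
  assumes "\<And>j. F j \<in> test_functions" "f \<in> test_functions" "test_tendsto F f"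
  shows "(\<lambda>j. integral {0..2 * pi} (F j)) \<longlonglongrightarrow> integral {0..2 * pi} f"
proof -
  have "uniform_limit UNIV F f sequentially"
    by (rule test_tendsto_uniform[OF assms(3)])
  then have "uniform_limit {0..2 * pi} F f sequentially"
    by (rule uniform_limit_on_subset) auto
  then obtain I J where *: "\<And>j. (F j has_integral I j) {0..2 * pi}" "(f has_integral J) {0..2 * pi}" "I \<longlonglongrightarrow> J"
    by (rule uniform_limit_integral) (use assms test_continuous in auto)
  from *(1) have "integral {0..2 * pi} (F j) = I j" for j by (rule integral_unique)
  with *(2,3) show ?thesis by (simp add: integral_unique)
qed

lemma test_integrable: "f \<in> test_functions \<Longrightarrow> f integrable_on {0..2 * pi}"
  by (intro integrable_continuous_interval test_continuous)

section \<open>Periodic distributions\<close>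

text \<open>A distribution is a sequentially continuous linear functional on the test functions
  (the test functions are metrizable, so this is the topological dual); it is extended by \<open>0\<close> to
  all functions in order to make its representation unique.\<close>

definition is_pdist :: "((real \<Rightarrow> complex) \<Rightarrow> complex) \<Rightarrow> bool" where
  "is_pdist v \<longleftrightarrow>
     (\<forall>f. f \<notin> test_functions \<longrightarrow> v f = 0) \<and>
     (\<forall>f\<in>test_functions. \<forall>h\<in>test_functions. v (\<lambda>x. f x + h x) = v f + v h) \<and>
     (\<forall>c. \<forall>f\<in>test_functions. v (\<lambda>x. c * f x) = c * v f) \<and>
     (\<forall>F f. (\<forall>j. F j \<in> test_functions) \<longrightarrow> f \<in> test_functions \<longrightarrow> test_tendsto F f \<longrightarrow>
        (\<lambda>j. v (F j)) \<longlonglongrightarrow> v f)"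

typedef pdist = "{v. is_pdist v}"
  morphisms pairing Abs_pdist
  by (rule exI[of _ "\<lambda>_. 0"]) (simp add: is_pdist_def)

setup_lifting type_definition_pdist

lift_definition scaleC_pdist :: "complex \<Rightarrow> pdist \<Rightarrow> pdist" is "\<lambda>c v f. c * v f"
  by (auto simp: is_pdist_def algebra_simps intro!: tendsto_intros)

instantiation pdist :: real_vector
begin

lift_definition zero_pdist :: pdist is "\<lambda>_. 0"
  by (simp add: is_pdist_def)

lift_definition plus_pdist :: "pdist \<Rightarrow> pdist \<Rightarrow> pdist" is "\<lambda>v w f. v f + w f"
  by (auto simp: is_pdist_def algebra_simps intro!: tendsto_intros)

lift_definition uminus_pdist :: "pdist \<Rightarrow> pdist" is "\<lambda>v f. - v f"
  by (auto simp: is_pdist_def algebra_simps intro!: tendsto_intros)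

lift_definition minus_pdist :: "pdist \<Rightarrow> pdist \<Rightarrow> pdist" is "\<lambda>v w f. v f - w f"
  by (auto simp: is_pdist_def algebra_simps intro!: tendsto_intros)

definition "scaleR r v = scaleC_pdist (complex_of_real r) v" for v :: pdist

instance
  by standard (unfold scaleR_pdist_def, (transfer; simp add: algebra_simps)+)

end

lift_definition dist_of :: "(real \<Rightarrow> complex) \<Rightarrow> pdist" is
  "\<lambda>p f. if p \<in> test_functions \<and> f \<in> test_functions then integral {0..2 * pi} (\<lambda>x. p x * f x) else 0"
proof -
  fix p :: "real \<Rightarrow> complex"
  show "is_pdist (\<lambda>f. if p \<in> test_functions \<and> f \<in> test_functions
      then integral {0..2 * pi} (\<lambda>x. p x * f x) else 0)"
  proof (cases "p \<in> test_functions")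
    case True
    have "integral {0..2 * pi} (\<lambda>x. p x * (c * f x)) = c * integral {0..2 * pi} (\<lambda>x. p x * f x)" for c f
      by (simp add: mult.left_commute)
    moreover have "integral {0..2 * pi} (\<lambda>x. p x * (f x + h x)) =
        integral {0..2 * pi} (\<lambda>x. p x * f x) + integral {0..2 * pi} (\<lambda>x. p x * h x)"
      if "f \<in> test_functions" "h \<in> test_functions" for f h
      using True that by (simp add: distrib_left integral_add test_integrable test_mult)
    ultimately show ?thesis
      using True by (auto simp: is_pdist_def test_add test_cmult
          intro!: test_tendsto_integral test_mult test_tendsto_mult test_tendsto_const)
  qed (simp add: is_pdist_def)
qed

lift_definition mult_pdist :: "(real \<Rightarrow> complex) \<Rightarrow> pdist \<Rightarrow> pdist" is
  "\<lambda>p v f. if p \<in> test_functions \<and> f \<in> test_functions then v (\<lambda>x. p x * f x) else 0"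
proof -
  fix p :: "real \<Rightarrow> complex" and v
  assume v: "is_pdist v"
  show "is_pdist (\<lambda>f. if p \<in> test_functions \<and> f \<in> test_functions then v (\<lambda>x. p x * f x) else 0)"
  proof (cases "p \<in> test_functions")
    case True
    have "v (\<lambda>x. p x * (c * f x)) = c * v (\<lambda>x. p x * f x)" if "f \<in> test_functions" for c f
      using v that True test_mult[of p f] by (simp add: is_pdist_def mult.left_commute)
    moreover have "v (\<lambda>x. p x * (f x + h x)) = v (\<lambda>x. p x * f x) + v (\<lambda>x. p x * h x)"
      if "f \<in> test_functions" "h \<in> test_functions" for f h
      using v that True test_mult[of p] by (simp add: is_pdist_def distrib_left)
    moreover have "(\<lambda>j. v (\<lambda>x. p x * F j x)) \<longlonglongrightarrow> v (\<lambda>x. p x * f x)"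
      if "\<forall>j. F j \<in> test_functions" "f \<in> test_functions" "test_tendsto F f" for F f
    proof -
      have "test_tendsto (\<lambda>j x. p x * F j x) (\<lambda>x. p x * f x)"
        using that True by (auto intro!: test_tendsto_mult test_tendsto_const)
      then show ?thesis using v that True test_mult[of p] by (simp add: is_pdist_def)
    qed
    ultimately show ?thesis
      using True by (auto simp: is_pdist_def test_add test_cmult)
  qed (simp add: is_pdist_def)
qed

definition fourier :: "pdist \<Rightarrow> int \<Rightarrow> complex" where
  "fourier v k = pairing v (\<lambda>x. exp (- (\<i> * of_int k * complex_of_real x))) / (2 * pi)"

text \<open>A distribution is determined by its Fourier coefficients, so the description below is
  meaningful whenever \<open>m\<close> grows at most polynomially.\<close>

definition fourier_multiplier :: "(int \<Rightarrow> complex) \<Rightarrow> pdist \<Rightarrow> pdist" where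
  "fourier_multiplier m v = (THE w. \<forall>k. fourier w k = m k * fourier v k)"

section \<open>Periodic Sobolev spaces\<close>

definition Hs :: "real \<Rightarrow> pdist set" where
  "Hs s = {v. (\<lambda>k::int. (1 + \<bar>real_of_int k\<bar>) powr (2 * s) * (cmod (fourier v k))\<^sup>2) summable_on UNIV}"

definition Hs_norm :: "real \<Rightarrow> pdist \<Rightarrow> real" where
  "Hs_norm s v = sqrt (2 * pi *
     (\<Sum>\<^sub>\<infinity>k::int. (1 + \<bar>real_of_int k\<bar>) powr (2 * s) * (cmod (fourier v k))\<^sup>2))"

definition bounded_linear_Hs :: "real \<Rightarrow> (pdist \<Rightarrow> pdist) \<Rightarrow> bool" where
  "bounded_linear_Hs s K \<longleftrightarrow>
     (\<forall>v\<in>Hs s. K v \<in> Hs s) \<and>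
     (\<forall>v\<in>Hs s. \<forall>w\<in>Hs s. K (v + w) = K v + K w) \<and>
     (\<forall>c. \<forall>v\<in>Hs s. K (scaleC_pdist c v) = scaleC_pdist c (K v)) \<and>
     (\<exists>C. \<forall>v\<in>Hs s. Hs_norm s (K v) \<le> C * Hs_norm s v)"

definition continuous_Hs :: "real \<Rightarrow> real set \<Rightarrow> (real \<Rightarrow> pdist) \<Rightarrow> bool" where
  "continuous_Hs s I u \<longleftrightarrow>
     (\<forall>t\<in>I. u t \<in> Hs s) \<and>
     (\<forall>t0\<in>I. ((\<lambda>t. Hs_norm s (u t - u t0)) \<longlongrightarrow> 0) (at t0 within I))"

text \<open>The library's strong measurability and Bochner integral are tied to a type class carrying the
  norm. Since \<open>s\<close> is a parameter, the definitions are repeated here for the norm of \<open>Hs s\<close>.\<close>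

definition simple_Hs :: "real \<Rightarrow> 'a measure \<Rightarrow> ('a \<Rightarrow> pdist) \<Rightarrow> bool" where
  "simple_Hs s M f \<longleftrightarrow> Bochner_Integration.simple_bochner_integrable M f \<and> (\<forall>x\<in>space M. f x \<in> Hs s)"

definition strongly_measurable_Hs :: "real \<Rightarrow> 'a measure \<Rightarrow> ('a \<Rightarrow> pdist) \<Rightarrow> bool" where
  "strongly_measurable_Hs s M f \<longleftrightarrow>
     (AE x in M. f x \<in> Hs s) \<and>
     (\<exists>\<sigma>. (\<forall>i. simple_Hs s M (\<sigma> i)) \<and>
        (AE x in M. (\<lambda>i. Hs_norm s (f x - \<sigma> i x)) \<longlonglongrightarrow> 0))"

definition has_bochner_integral_Hs ::
    "real \<Rightarrow> 'a measure \<Rightarrow> ('a \<Rightarrow> pdist) \<Rightarrow> pdist \<Rightarrow> bool" where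
  "has_bochner_integral_Hs s M f y \<longleftrightarrow>
     strongly_measurable_Hs s M f \<and> y \<in> Hs s \<and>
     (\<exists>\<sigma>. (\<forall>i. simple_Hs s M (\<sigma> i)) \<and>
        (\<lambda>i. \<integral>\<^sup>+x. ennreal (Hs_norm s (f x - \<sigma> i x)) \<partial>M) \<longlonglongrightarrow> 0 \<and>
        (\<lambda>i. Hs_norm s (Bochner_Integration.simple_bochner_integral M (\<sigma> i) - y)) \<longlonglongrightarrow> 0)"

definition L2_Hs :: "real \<Rightarrow> real \<Rightarrow> (real \<Rightarrow> pdist) set" where
  "L2_Hs s T = {h. strongly_measurable_Hs s (lebesgue_on {0..T}) h \<and>
     integrable (lebesgue_on {0..T}) (\<lambda>t. (Hs_norm s (h t))\<^sup>2)}"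

definition L2_Hs_norm :: "real \<Rightarrow> real \<Rightarrow> (real \<Rightarrow> pdist) \<Rightarrow> real" where
  "L2_Hs_norm s T h = sqrt (integral\<^sup>L (lebesgue_on {0..T}) (\<lambda>t. (Hs_norm s (h t))\<^sup>2))"

section \<open>The control operator\<close>

definition G_op :: "(real \<Rightarrow> real) \<Rightarrow> pdist \<Rightarrow> pdist" where
  "G_op g v = mult_pdist (\<lambda>x. complex_of_real (g x)) v
     - scaleC_pdist (pairing v (\<lambda>x. complex_of_real (g x))) (dist_of (\<lambda>x. complex_of_real (g x)))"

definition G_test :: "(real \<Rightarrow> real) \<Rightarrow> (real \<Rightarrow> complex) \<Rightarrow> real \<Rightarrow> complex" where
  "G_test g f = (\<lambda>x. complex_of_real (g x) * f x
     - complex_of_real (g x) * integral {0..2 * pi} (\<lambda>y. f y * complex_of_real (g y)))"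

lemma G_test_in_test:
  assumes "(\<lambda>x. complex_of_real (g x)) \<in> test_functions" "f \<in> test_functions"
  shows "G_test g f \<in> test_functions"
proof -
  have "(\<lambda>x. complex_of_real (g x) * f x
      + (- integral {0..2 * pi} (\<lambda>y. f y * complex_of_real (g y))) * complex_of_real (g x)) \<in> test_functions"
    by (intro test_add test_mult test_cmult assms)
  then show ?thesis by (simp add: G_test_def mult.commute)
qed

lemma test_tendsto_G_test:
  assumes "(\<lambda>x. complex_of_real (g x)) \<in> test_functions"
    and "\<And>j. F j \<in> test_functions" "f \<in> test_functions" "test_tendsto F f"
  shows "test_tendsto (\<lambda>j. G_test g (F j)) (G_test g f)"
proof -
  let ?c = "\<lambda>f. - integral {0..2 * pi} (\<lambda>y. f y * complex_of_real (g y))"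
  have "(\<lambda>j. ?c (F j)) \<longlonglongrightarrow> ?c f"
    by (intro tendsto_minus test_tendsto_integral test_tendsto_mult test_mult test_tendsto_const assms)
  then have "test_tendsto (\<lambda>j x. complex_of_real (g x) * F j x + ?c (F j) * complex_of_real (g x))
      (\<lambda>x. complex_of_real (g x) * f x + ?c f * complex_of_real (g x))"
    by (intro test_tendsto_add test_tendsto_mult test_mult test_tendsto_const
        test_tendsto_constants test_const assms)
  then show ?thesis by (simp add: G_test_def mult.commute)
qed

text \<open>On test functions the operator \<open>G_op\<close> acts as \<open>G_test\<close>, and on distributions the adjoint with
  respect to the sesquilinear pairing \<open>(u, f) = \<langle>u, cnj f\<rangle>\<close> of \<open>L\<^sup>2\<close> is determined by
  \<open>(G_adj u, f) = (u, G f)\<close> for all test functions \<open>f\<close>; below this is spelt out at \<open>cnj f\<close>.\<close>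

lift_definition G_adj :: "(real \<Rightarrow> real) \<Rightarrow> pdist \<Rightarrow> pdist" is
  "\<lambda>g v f. if (\<lambda>x. complex_of_real (g x)) \<in> test_functions \<and> f \<in> test_functions
     then v (\<lambda>x. cnj (G_test g (\<lambda>y. cnj (f y)) x)) else 0"
proof -
  fix g :: "real \<Rightarrow> real" and v
  assume v: "is_pdist v"
  let ?g = "\<lambda>x. complex_of_real (g x)"
  let ?S = "\<lambda>f x. cnj (G_test g (\<lambda>y. cnj (f y)) x)"
  show "is_pdist (\<lambda>f. if ?g \<in> test_functions \<and> f \<in> test_functions then v (?S f) else 0)"
  proof (cases "?g \<in> test_functions")
    case True
    have S: "?S f \<in> test_functions" if "f \<in> test_functions" for f
      by (intro test_cnj G_test_in_test True that)
    have i: "(\<lambda>y. cnj (f y) * ?g y) integrable_on {0..2 * pi}" if "f \<in> test_functions" for f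
      by (intro test_integrable test_mult test_cnj True that)
    have "?S (\<lambda>x. f x + h x) = (\<lambda>x. ?S f x + ?S h x)"
      if "f \<in> test_functions" "h \<in> test_functions" for f h
      using integral_add[OF i[OF that(1)] i[OF that(2)]]
      by (simp add: G_test_def algebra_simps)
    then have 1: "v (?S (\<lambda>x. f x + h x)) = v (?S f) + v (?S h)"
      if "f \<in> test_functions" "h \<in> test_functions" for f h
      using v S that by (simp add: is_pdist_def)
    have "?S (\<lambda>x. c * f x) = (\<lambda>x. c * ?S f x)" for c f
      by (simp add: G_test_def algebra_simps)
    then have 2: "v (?S (\<lambda>x. c * f x)) = c * v (?S f)" if "f \<in> test_functions" for c f
      using v S that by (simp add: is_pdist_def)
    have 3: "(\<lambda>j. v (?S (F j))) \<longlonglongrightarrow> v (?S f)"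
      if "\<forall>j. F j \<in> test_functions" "f \<in> test_functions" "test_tendsto F f" for F f
    proof -
      have "test_tendsto (\<lambda>j. ?S (F j)) (?S f)"
        using that by (intro test_tendsto_cnj test_tendsto_G_test G_test_in_test test_cnj True) auto
      then show ?thesis using v S that by (simp add: is_pdist_def)
    qed
    show ?thesis
      using True 1 2 3 by (auto simp: is_pdist_def test_add test_cmult)
  qed (simp add: is_pdist_def)
qed

lemma G_op_dist_of:
  assumes g: "(\<lambda>x. complex_of_real (g x)) \<in> test_functions" and f: "f \<in> test_functions"
  shows "G_op g (dist_of f) = dist_of (G_test g f)"
proof -
  let ?g = "\<lambda>x. complex_of_real (g x)"
  let ?c = "integral {0..2 * pi} (\<lambda>x. f x * ?g x)"
  have "pairing (G_op g (dist_of f)) h = pairing (dist_of (G_test g f)) h" for h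
  proof (cases "h \<in> test_functions")
    case True
    have i: "(\<lambda>x. f x * (?g x * h x)) integrable_on {0..2 * pi}"
      "(\<lambda>x. ?c * (?g x * h x)) integrable_on {0..2 * pi}"
      by (intro test_integrable test_mult test_cmult g f True)+
    have "(\<lambda>x. G_test g f x * h x) = (\<lambda>x. f x * (?g x * h x) - ?c * (?g x * h x))"
      by (simp add: G_test_def algebra_simps)
    then have "integral {0..2 * pi} (\<lambda>x. G_test g f x * h x) =
        integral {0..2 * pi} (\<lambda>x. f x * (?g x * h x)) - ?c * integral {0..2 * pi} (\<lambda>x. ?g x * h x)"
      using integral_diff[OF i] by simp
    then show ?thesis
      using True f g G_test_in_test[OF g f] test_mult[OF g True]
      by (simp add: G_op_def minus_pdist.rep_eq scaleC_pdist.rep_eq mult_pdist.rep_eq dist_of.rep_eq)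
  next
    case False
    then show ?thesis
      by (simp add: G_op_def minus_pdist.rep_eq scaleC_pdist.rep_eq mult_pdist.rep_eq dist_of.rep_eq)
  qed
  then show ?thesis by (intro iffD1[OF pairing_inject] ext)
qed

lemma G_adj_adjoint:
  assumes "(\<lambda>x. complex_of_real (g x)) \<in> test_functions" "f \<in> test_functions"
  shows "pairing (G_adj g v) (\<lambda>x. cnj (f x)) = pairing v (\<lambda>x. cnj (G_test g f x))"
  using assms by (simp add: G_adj.rep_eq test_cnj)

section \<open>Mild solutions\<close>

text \<open>\<open>evol a t\<close> is the group generated by \<open>\<partial>\<^sub>x A\<close>, where \<open>a\<close> is the symbol of \<open>A\<close>, and
  \<open>mild_solution a s I u0 f u\<close> says that \<open>u\<close> is a solution in \<open>C(I; Hs s)\<close> of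
  \<open>\<partial>\<^sub>t u = \<partial>\<^sub>x A u + f\<close>, \<open>u(0) = u0\<close>, the time interval \<open>I\<close> being \<open>{0..T}\<close> or \<open>{0..}\<close>.\<close>

definition evol :: "(int \<Rightarrow> real) \<Rightarrow> real \<Rightarrow> pdist \<Rightarrow> pdist" where
  "evol a t = fourier_multiplier (\<lambda>k. exp (\<i> * of_int k * complex_of_real (a k) * complex_of_real t))"

definition mild_solution ::
    "(int \<Rightarrow> real) \<Rightarrow> real \<Rightarrow> real set \<Rightarrow> pdist \<Rightarrow> (real \<Rightarrow> pdist) \<Rightarrow> (real \<Rightarrow> pdist) \<Rightarrow> bool" where
  "mild_solution a s I u0 f u \<longleftrightarrow>
     continuous_Hs s I u \<and>
     (\<forall>t\<in>I. \<exists>w. has_bochner_integral_Hs s (lebesgue_on {0..t}) (\<lambda>t'. evol a (t - t') (f t')) w \<and>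
        u t = evol a t u0 + w)"

definition smith_symbol :: "int \<Rightarrow> real" where
  "smith_symbol k = 2 * pi * (sqrt ((real_of_int k)\<^sup>2 + 1) - 1)"

end

theory Submission
  imports Defs
begin

text \<open>
  Weighted Fourier coefficients identify \<open>Hs s\<close> with the space of square-summable sequences, and
  undoing the free evolution turns the equations into ordinary differential equations there.
  The gaps between consecutive frequencies of the Smith equation grow linearly, so for every \<open>T > 0\<close>
  there are uniformly bounded functions \<open>q j\<close> on \<open>{0..T}\<close> biorthogonal to the exponentials (for
  large frequencies by inverting a small perturbation of the identity on windowed exponentials; the
  finitely many others are added one at a time as Haraux did).
  A control \<open>h = (\<Sum>j. x j * q j * e j)\<close> then sees only the diagonal of the matrix of \<open>G\<close>, which is bounded
  away from zero off the constants; this gives controllability at every regularity at once.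

  The same controls give an observability inequality, hence exponential decay for the feedback
  \<open>- G G*\<close> at \<open>s = 0\<close>. Conjugation by the weights changes \<open>G G*\<close> by an operator of order \<open>- 1\<close>,
  which carries the same rate to every \<open>s \<ge> 0\<close>, and duality reaches \<open>s < 0\<close>.
\<close>

section \<open>Square-summable sequences indexed by the integers\<close>

text \<open>The functions \<open>q j\<close> are bounded pointwise and uniformly in
  \<open>j\<close>, not merely in the mean square. At each instant \<open>j |-> q j t\<close> is
  therefore a bounded diagonal operator, which commutes with the Sobolev weights; this is why one
  family serves all \<open>s\<close>. A window vanishing to second order at both ends has a
  transform of size xi^-2. The growing gaps turn this into matrix entries of size 1 / (k^2 (k -
  i)^2), and the factor k^-2 makes the high frequencies a small perturbation on however short an
  interval. Observability is a statement on the free flow, while decay concerns the damped one; a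
  unit time interval is short enough for comparing the two. The energy identity needs a self-adjoint
  \<open>G\<close>, hence \<open>s = 0\<close>. For \<open>s > 0\<close> the remainder of order -1
  is driven by the solution at lower regularity, which already decays. The rate that is propagated
  is strictly slower than the contraction of one step at \<open>s = 0\<close>, so nothing is lost
  from level to level and \<alpha> stays independent of \<open>s\<close>.\<close>

typedef ell2 = "{x :: int \<Rightarrow> complex. (\<lambda>k. (cmod (x k))\<^sup>2) summable_on UNIV}"
  morphisms entry Abs_ell2
  by (rule exI[of _ "\<lambda>_. 0"]) simp

setup_lifting type_definition_ell2

lemma abs_inner_le_squares: "\<bar>inner x y\<bar> \<le> (norm x)\<^sup>2 + (norm y)\<^sup>2"
proof -
  have "2 * (norm x * norm y) \<le> (norm x)\<^sup>2 + (norm y)\<^sup>2"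
    using sum_squares_bound[of "norm x" "norm y"] by simp
  moreover have "\<bar>inner x y\<bar> \<le> norm x * norm y" by (rule Cauchy_Schwarz_ineq2)
  moreover have "0 \<le> norm x * norm y" by simp
  ultimately show ?thesis by linarith
qed

lemma summable_on_norm_add_squared:
  fixes x y :: "'a \<Rightarrow> complex"
  assumes "(\<lambda>k. (cmod (x k))\<^sup>2) summable_on A" "(\<lambda>k. (cmod (y k))\<^sup>2) summable_on A"
  shows "(\<lambda>k. (cmod (x k + y k))\<^sup>2) summable_on A"
proof (rule summable_on_comparison_test)
  show "(\<lambda>k. 2 * ((cmod (x k))\<^sup>2 + (cmod (y k))\<^sup>2)) summable_on A"
    by (intro summable_on_cmult_right summable_on_add assms)
  fix k
  have "(cmod (x k + y k))\<^sup>2 \<le> (cmod (x k) + cmod (y k))\<^sup>2"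
    by (intro power_mono norm_triangle_ineq) simp
  also have "\<dots> \<le> 2 * ((cmod (x k))\<^sup>2 + (cmod (y k))\<^sup>2)"
    using sum_squares_bound[of "cmod (x k)" "cmod (y k)"] by (simp add: power2_sum)
  finally show "(cmod (x k + y k))\<^sup>2 \<le> 2 * ((cmod (x k))\<^sup>2 + (cmod (y k))\<^sup>2)" .
qed simp

lemma summable_on_inner:
  fixes x y :: "'a \<Rightarrow> complex"
  assumes "(\<lambda>k. (cmod (x k))\<^sup>2) summable_on A" "(\<lambda>k. (cmod (y k))\<^sup>2) summable_on A"
  shows "(\<lambda>k. inner (x k) (y k)) summable_on A"
proof -
  have "(\<lambda>k. (cmod (x k))\<^sup>2 + (cmod (y k))\<^sup>2) summable_on A"
    by (intro summable_on_add assms)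
  then have "(\<lambda>k. norm (inner (x k) (y k))) summable_on A"
    by (rule summable_on_comparison_test) (auto simp: abs_inner_le_squares)
  then show ?thesis by (rule abs_summable_summable)
qed

instantiation ell2 :: real_vector
begin

lift_definition zero_ell2 :: ell2 is "\<lambda>_. 0" by simp

lift_definition plus_ell2 :: "ell2 \<Rightarrow> ell2 \<Rightarrow> ell2" is "\<lambda>x y k. x k + y k"
  by (rule summable_on_norm_add_squared)

lift_definition uminus_ell2 :: "ell2 \<Rightarrow> ell2" is "\<lambda>x k. - x k" by simp

lift_definition minus_ell2 :: "ell2 \<Rightarrow> ell2 \<Rightarrow> ell2" is "\<lambda>x y k. x k - y k"
  using summable_on_norm_add_squared[where y = "\<lambda>k. - y k" for y] by fastforce

lift_definition scaleR_ell2 :: "real \<Rightarrow> ell2 \<Rightarrow> ell2" is "\<lambda>r x k. r *\<^sub>R x k"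
  by (auto simp: power_mult_distrib intro!: summable_on_cmult_right)

instance
  by standard (transfer; simp add: algebra_simps)+

end

lemma entry_add [simp]: "entry (x + y) k = entry x k + entry y k" by transfer simp
lemma entry_diff [simp]: "entry (x - y) k = entry x k - entry y k" by transfer simp
lemma entry_minus [simp]: "entry (- x) k = - entry x k" by transfer simp
lemma entry_zero [simp]: "entry 0 k = 0" by transfer simp
lemma entry_scaleR [simp]: "entry (r *\<^sub>R x) k = r *\<^sub>R entry x k" by transfer simp
lemma entry_sum [simp]: "entry (sum f A) k = (\<Sum>a\<in>A. entry (f a) k)"
  by (induction A rule: infinite_finite_induct) auto

lemma ell2_eqI: "(\<And>k. entry x k = entry y k) \<Longrightarrow> x = y"
  by (simp add: entry_inject[symmetric] ext)

lemma summable_entry: "(\<lambda>k. (cmod (entry x k))\<^sup>2) summable_on A"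
  using entry[of x] summable_on_subset_banach[of _ UNIV A] by auto

lemma ex_ell2:
  assumes "(\<lambda>k. (cmod (f k))\<^sup>2) summable_on UNIV"
  shows "\<exists>x. entry x = f"
  using assms Abs_ell2_inverse[of f] by auto

lemma summable_entry_inner: "(\<lambda>k. inner (entry x k) (entry y k)) summable_on A"
  by (intro summable_on_inner summable_entry)

instantiation ell2 :: real_inner
begin

text \<open>The inner product of two complex numbers is the real part of \<open>z * cnj w\<close>,
  so this is the real part of the Hermitian product. It gives the same norm and suffices for
  adjoints and energy identities; linearity below always means real linearity.\<close>

definition inner_ell2 :: "ell2 \<Rightarrow> ell2 \<Rightarrow> real" where
  "inner x y = (\<Sum>\<^sub>\<infinity>k. inner (entry x k) (entry y k))"

definition norm_ell2 :: "ell2 \<Rightarrow> real" where "norm x = sqrt (inner x x)" for x :: ell2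

definition dist_ell2 :: "ell2 \<Rightarrow> ell2 \<Rightarrow> real" where "dist x y = norm (x - y)" for x y :: ell2

definition sgn_ell2 :: "ell2 \<Rightarrow> ell2" where "sgn x = x /\<^sub>R norm x" for x :: ell2

definition uniformity_ell2 :: "(ell2 \<times> ell2) filter" where
  "uniformity_ell2 = (INF e\<in>{0 <..}. principal {(x, y). dist x y < e})"

definition open_ell2 :: "ell2 set \<Rightarrow> bool" where
  "open_ell2 U \<longleftrightarrow> (\<forall>x\<in>U. eventually (\<lambda>(x', y). x' = x \<longrightarrow> y \<in> U) uniformity)"

instance
proof
  fix x y z :: ell2 and r :: real
  show "inner x y = inner y x" by (simp add: inner_ell2_def inner_commute)
  show "inner (x + y) z = inner x z + inner y z"
    by (simp add: inner_ell2_def inner_add_left infsum_add summable_entry_inner)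
  show "inner (r *\<^sub>R x) y = r * inner x y"
    by (simp add: inner_ell2_def infsum_cmult_right')
  show "0 \<le> inner x x" by (simp add: inner_ell2_def infsum_nonneg)
  show "(inner x x = 0) = (x = 0)"
  proof
    assume "inner x x = 0"
    then have "inner (entry x k) (entry x k) = 0" for k
      using nonneg_infsum_le_0D[of "\<lambda>k. inner (entry x k) (entry x k)" UNIV k] summable_entry_inner
      by (simp add: inner_ell2_def)
    then show "x = 0" by (intro ell2_eqI) simp
  qed (simp add: inner_ell2_def)
qed (auto simp: norm_ell2_def dist_ell2_def sgn_ell2_def uniformity_ell2_def open_ell2_def)

end

lemma norm_ell2_eq: "norm x = sqrt (\<Sum>\<^sub>\<infinity>k. (cmod (entry x k))\<^sup>2)"
  unfolding norm_ell2_def inner_ell2_def power2_norm_eq_inner ..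

lemma norm_ell2_squared: "(norm x)\<^sup>2 = (\<Sum>\<^sub>\<infinity>k. (cmod (entry x k))\<^sup>2)"
  unfolding norm_ell2_eq by (simp add: infsum_nonneg)

lemma sum_entry_le: "finite A \<Longrightarrow> (\<Sum>k\<in>A. (cmod (entry x k))\<^sup>2) \<le> (norm x)\<^sup>2"
  unfolding norm_ell2_squared by (intro finite_sum_le_infsum summable_entry) auto

lemma entry_le_norm: "cmod (entry x k) \<le> norm x"
  by (rule power2_le_imp_le) (use sum_entry_le[of "{k}" x] in auto)

lemma bounded_linear_entry: "bounded_linear (\<lambda>x. entry x k)"
  by (rule bounded_linear_intro[where K = 1]) (auto simp: entry_le_norm)

lemma ell2_bounded_sums:
  assumes "\<And>A. finite A \<Longrightarrow> (\<Sum>k\<in>A. (cmod (f k))\<^sup>2) \<le> B\<^sup>2" "0 \<le> B"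
  shows "\<exists>x. entry x = f \<and> norm x \<le> B"
proof -
  have s: "(\<lambda>k. (cmod (f k))\<^sup>2) summable_on UNIV"
    by (rule nonneg_bdd_above_summable_on) (auto intro!: bdd_aboveI[where M = "B\<^sup>2"] assms)
  then obtain x where x: "entry x = f" using ex_ell2 by blast
  have "(norm x)\<^sup>2 \<le> B\<^sup>2"
    unfolding norm_ell2_squared x by (rule infsum_le_finite_sums) (use s assms in auto)
  then have "norm x \<le> B" using assms(2) by (rule power2_le_imp_le)
  then show ?thesis using x by blast
qed

lemma norm_ell2_le:
  assumes "\<And>A. finite A \<Longrightarrow> (\<Sum>k\<in>A. (cmod (entry x k))\<^sup>2) \<le> B\<^sup>2" "0 \<le> B"
  shows "norm x \<le> B"
  using ell2_bounded_sums[of "entry x" B, OF assms] by (auto simp: entry_inject)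

lemma norm_ell2_mono:
  assumes "\<And>k. cmod (entry x k) \<le> c * cmod (entry y k)" "0 \<le> c"
  shows "norm x \<le> c * norm y"
proof (rule norm_ell2_le)
  fix A :: "int set" assume A: "finite A"
  have "(\<Sum>k\<in>A. (cmod (entry x k))\<^sup>2) \<le> (\<Sum>k\<in>A. (c * cmod (entry y k))\<^sup>2)"
    by (intro sum_mono power_mono assms) auto
  also have "\<dots> = c\<^sup>2 * (\<Sum>k\<in>A. (cmod (entry y k))\<^sup>2)"
    by (simp add: power_mult_distrib sum_distrib_left)
  also have "\<dots> \<le> c\<^sup>2 * (norm y)\<^sup>2" using sum_entry_le[OF A] by (intro mult_left_mono) auto
  finally show "(\<Sum>k\<in>A. (cmod (entry x k))\<^sup>2) \<le> (c * norm y)\<^sup>2" by (simp add: power_mult_distrib)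
qed (use assms in auto)

instance ell2 :: complete_space
proof
  fix X :: "nat \<Rightarrow> ell2" assume X: "Cauchy X"
  have "convergent (\<lambda>n. entry (X n) k)" for k
    using bounded_linear.Cauchy[OF bounded_linear_entry X] by (rule Cauchy_convergent)
  then have "\<forall>k. \<exists>l. (\<lambda>n. entry (X n) k) \<longlonglongrightarrow> l" by (simp add: convergent_def)
  then obtain f where f: "(\<lambda>n. entry (X n) k) \<longlonglongrightarrow> f k" for k
    by metis
  \<comment> \<open>A finite sum of squared entries passes to the limit in \<open>n\<close>, so the
    Cauchy bound survives for \<open>X m - f\<close> before \<open>f\<close> is known to be square
    summable.\<close>
  have tail: "(\<Sum>k\<in>A. (cmod (entry (X m) k - f k))\<^sup>2) \<le> e\<^sup>2"
    if "\<forall>n\<ge>N. \<forall>m\<ge>N. dist (X n) (X m) < e" "m \<ge> N" "finite A" "0 < e" for e N m A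
  proof (rule LIMSEQ_le_const2)
    show "(\<lambda>n. \<Sum>k\<in>A. (cmod (entry (X m) k - entry (X n) k))\<^sup>2) \<longlonglongrightarrow> (\<Sum>k\<in>A. (cmod (entry (X m) k - f k))\<^sup>2)"
      by (intro tendsto_intros f)
    have "(\<Sum>k\<in>A. (cmod (entry (X m) k - entry (X n) k))\<^sup>2) \<le> e\<^sup>2" if "n \<ge> N" for n
    proof -
      have "(\<Sum>k\<in>A. (cmod (entry (X m) k - entry (X n) k))\<^sup>2) \<le> (norm (X m - X n))\<^sup>2"
        using sum_entry_le[OF \<open>finite A\<close>, of "X m - X n"] by simp
      also have "\<dots> \<le> e\<^sup>2"
        using \<open>\<forall>n\<ge>N. \<forall>m\<ge>N. dist (X n) (X m) < e\<close> \<open>n \<ge> N\<close> \<open>m \<ge> N\<close>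
        by (intro power_mono) (auto simp: dist_norm less_imp_le)
      finally show ?thesis .
    qed
    then show "\<exists>N. \<forall>n\<ge>N. (\<Sum>k\<in>A. (cmod (entry (X m) k - entry (X n) k))\<^sup>2) \<le> e\<^sup>2" by blast
  qed
  obtain N1 where "\<forall>n\<ge>N1. \<forall>m\<ge>N1. dist (X n) (X m) < 1" using metric_CauchyD[OF X, of 1] by force
  \<comment> \<open>Only the difference from a late member of the sequence is known to be square
    summable, so the limit is represented as \<open>X N1 - y\<close>.\<close>
  from ell2_bounded_sums[of "\<lambda>k. entry (X N1) k - f k" 1] tail[OF this order_refl]
  obtain y where y: "entry y = (\<lambda>k. entry (X N1) k - f k)" by auto
  have l: "entry (X N1 - y) k = f k" for k by (simp add: y)
  have "X \<longlonglongrightarrow> X N1 - y"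
  proof (rule metric_LIMSEQ_I)
    fix e :: real assume e: "0 < e"
    then obtain N where N: "\<forall>n\<ge>N. \<forall>m\<ge>N. dist (X n) (X m) < e / 2" using metric_CauchyD[OF X, of "e / 2"] by force
    have "norm (X m - (X N1 - y)) \<le> e / 2" if "m \<ge> N" for m
      using tail[OF N that] e l by (intro norm_ell2_le) auto
    then show "\<exists>N. \<forall>m\<ge>N. dist (X m) (X N1 - y) < e" using e by (force simp: dist_norm)
  qed
  then show "convergent X" by (auto simp: convergent_def)
qed

instance ell2 :: banach ..

lift_definition single :: "int \<Rightarrow> complex \<Rightarrow> ell2" is "\<lambda>j z k. if k = j then z else 0"
proof -
  fix j and z :: complex
  have "(\<lambda>k. (cmod (if k = j then z else 0))\<^sup>2) summable_on {j}" by simp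
  then show "(\<lambda>k. (cmod (if k = j then z else 0))\<^sup>2) summable_on UNIV"
    by (rule iffD1[OF summable_on_cong_neutral, rotated -1]) auto
qed

lemma entry_single: "entry (single j z) k = (if k = j then z else 0)" by transfer simp

lemma inner_single: "inner x (single k z) = inner (entry x k) z"
proof -
  have "inner x (single k z) = infsum (\<lambda>j. inner (entry x j) (entry (single k z) j)) {k}"
    unfolding inner_ell2_def by (rule infsum_cong_neutral) (auto simp: entry_single)
  then show ?thesis by (simp add: entry_single)
qed

lemma norm_single: "norm (single k z) = cmod z"
  by (simp add: norm_eq_sqrt_inner inner_single entry_single)

text \<open>Pythagoras: the squared distance from \<open>x\<close> to a partial sum is the squared
  norm minus the squares already collected.\<close>

lemma has_sum_single: "((\<lambda>k. single k (entry x k)) has_sum x) UNIV"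
proof -
  have eq: "(norm ((\<Sum>k\<in>A. single k (entry x k)) - x))\<^sup>2 = (norm x)\<^sup>2 - (\<Sum>k\<in>A. (cmod (entry x k))\<^sup>2)"
    if "finite A" for A
  proof -
    let ?p = "\<Sum>k\<in>A. single k (entry x k)"
    have "inner x ?p = (\<Sum>k\<in>A. (cmod (entry x k))\<^sup>2)" "inner ?p ?p = (\<Sum>k\<in>A. (cmod (entry x k))\<^sup>2)"
      using that by (simp_all add: inner_sum_right inner_single entry_single power2_norm_eq_inner)
    then show ?thesis
      unfolding power2_norm_eq_inner[of "?p - x"] power2_norm_eq_inner[of x]
      by (simp add: inner_diff_left inner_diff_right inner_commute)
  qed
  have "((\<lambda>k. (cmod (entry x k))\<^sup>2) has_sum (norm x)\<^sup>2) UNIV"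
    unfolding norm_ell2_squared by (intro has_sum_infsum summable_entry)
  then have "((\<lambda>A. (norm x)\<^sup>2 - (\<Sum>k\<in>A. (cmod (entry x k))\<^sup>2)) \<longlongrightarrow> (norm x)\<^sup>2 - (norm x)\<^sup>2) (finite_subsets_at_top UNIV)"
    unfolding has_sum_def by (intro tendsto_intros)
  then have "((\<lambda>A. (norm ((\<Sum>k\<in>A. single k (entry x k)) - x))\<^sup>2) \<longlongrightarrow> 0) (finite_subsets_at_top UNIV)"
    by (simp only: diff_self, elim Lim_transform_eventually)
       (auto intro!: eventually_finite_subsets_at_top_weakI simp: eq)
  then have "((\<lambda>A. sqrt ((norm ((\<Sum>k\<in>A. single k (entry x k)) - x))\<^sup>2)) \<longlongrightarrow> sqrt 0) (finite_subsets_at_top UNIV)"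
    by (rule tendsto_real_sqrt)
  then show ?thesis
    unfolding has_sum_def by (simp add: tendsto_norm_zero_iff LIM_zero_iff)
qed

text \<open>Finite sums of coordinate vectors are dense, so operator identities reduce to matrix
  entries. All complex \<open>z\<close> occur because the maps are only assumed real linear.\<close>

lemma bounded_linear_eq_on_singles:
  fixes f g :: "ell2 \<Rightarrow> 'b :: real_normed_vector"
  assumes "bounded_linear f" "bounded_linear g" "\<And>k z. f (single k z) = g (single k z)"
  shows "f x = g x"
proof -
  have "((\<lambda>k. g (single k (entry x k))) has_sum f x) UNIV"
    using has_sum_bounded_linear[OF assms(1) has_sum_single[of x]] by (simp add: assms(3) comp_def)
  moreover have "((\<lambda>k. g (single k (entry x k))) has_sum g x) UNIV"
    using has_sum_bounded_linear[OF assms(2) has_sum_single[of x]] by (simp add: comp_def)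
  ultimately show ?thesis by (rule has_sum_unique)
qed

subsection \<open>Multipliers\<close>

text \<open>The value for an unbounded symbol is a dummy that makes the function total; every use
  supplies a bound.\<close>

lift_definition mult_ell2 :: "(int \<Rightarrow> complex) \<Rightarrow> ell2 \<Rightarrow> ell2" is
  "\<lambda>d x k. if bounded (range d) then d k * x k else 0"
proof -
  fix d x :: "int \<Rightarrow> complex" assume x: "(\<lambda>k. (cmod (x k))\<^sup>2) summable_on UNIV"
  show "(\<lambda>k. (cmod (if bounded (range d) then d k * x k else 0))\<^sup>2) summable_on UNIV"
  proof (cases "bounded (range d)")
    case True
    then obtain C where C: "\<And>k. cmod (d k) \<le> C" by (auto simp: bounded_iff)
    show ?thesis
    proof (rule summable_on_comparison_test)
      show "(\<lambda>k. C\<^sup>2 * (cmod (x k))\<^sup>2) summable_on UNIV" by (intro summable_on_cmult_right x)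
      show "(cmod (if bounded (range d) then d k * x k else 0))\<^sup>2 \<le> C\<^sup>2 * (cmod (x k))\<^sup>2" for k
        using True power_mono[OF C[of k], of 2]
        by (simp add: norm_mult power_mult_distrib mult_right_mono)
    qed simp
  qed simp
qed

lemma entry_mult_ell2: "bounded (range d) \<Longrightarrow> entry (mult_ell2 d x) k = d k * entry x k"
  by transfer simp

lemma bounded_rangeI: "(\<And>k. cmod (d k) \<le> C) \<Longrightarrow> bounded (range d)"
  by (auto simp: bounded_iff)

lemma norm_mult_ell2_le:
  assumes "\<And>k. cmod (d k) \<le> C" shows "norm (mult_ell2 d x) \<le> C * norm x"
proof -
  have "0 \<le> C" using assms[of 0] norm_ge_zero[of "d 0"] by linarith
  then show ?thesis
    using assms by (intro norm_ell2_mono) (auto simp: entry_mult_ell2[OF bounded_rangeI[OF assms]] norm_mult mult_right_mono)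
qed

lemma bounded_linear_mult_ell2: 
  assumes "bounded (range d)" shows "bounded_linear (mult_ell2 d)"
proof -
  obtain C where C: "\<And>k. cmod (d k) \<le> C" using assms by (auto simp: bounded_iff)
  show ?thesis
  proof (rule bounded_linear_intro)
    show "norm (mult_ell2 d x) \<le> norm x * C" for x
      using norm_mult_ell2_le[OF C] by (simp add: mult.commute)
  qed (auto intro!: ell2_eqI simp: entry_mult_ell2[OF assms] algebra_simps)
qed

lemma mult_ell2_single: "bounded (range d) \<Longrightarrow> mult_ell2 d (single k z) = single k (d k * z)"
  by (rule ell2_eqI) (auto simp: entry_mult_ell2 entry_single)

lemma bounded_linear_single: "bounded_linear (single k)"
  by (rule bounded_linear_intro[where K = 1]) (auto intro!: ell2_eqI simp: entry_single norm_single)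

text \<open>Only strong continuity can hold, since the phases have unbounded frequencies. For a
  fixed vector the finite sections converge uniformly in \<open>t\<close> by the common bound
  \<open>C\<close>, so the limit is continuous; moving the vector costs at most a factor
  \<open>C\<close>.\<close>

lemma continuous_mult_ell2:
  fixes d :: "'a::topological_space \<Rightarrow> int \<Rightarrow> complex"
  assumes d: "\<And>k. continuous_on S (\<lambda>t. d t k)" and C: "\<And>t k. t \<in> S \<Longrightarrow> cmod (d t k) \<le> C"
    and x: "continuous_on S x"
  shows "continuous_on S (\<lambda>t. mult_ell2 (d t) (x t))"
  unfolding continuous_on_def
proof
  fix t0 assume t0: "t0 \<in> S"
  have b: "bounded (range (d t))" if "t \<in> S" for t using C[OF that] by (rule bounded_rangeI)
  have lin: "linear (mult_ell2 (d t))" if "t \<in> S" for t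
    using bounded_linear_mult_ell2[OF b[OF that]] by (rule bounded_linear.linear)
  define y where "y = x t0"
  have "uniform_limit S (\<lambda>A t. \<Sum>k\<in>A. single k (d t k * entry y k)) (\<lambda>t. mult_ell2 (d t) y) (finite_subsets_at_top UNIV)"
  proof (rule uniform_limitI)
    fix e :: real assume e: "0 < e"
    have C0: "0 \<le> C" using C[OF t0, of 0] norm_ge_zero[of "d t0 0"] by linarith
    have "eventually (\<lambda>A. dist (\<Sum>k\<in>A. single k (entry y k)) y < e / (C + 1)) (finite_subsets_at_top UNIV)"
      using has_sum_single[of y] e C0 unfolding has_sum_def tendsto_iff by simp
    then show "\<forall>\<^sub>F A in finite_subsets_at_top UNIV. \<forall>t\<in>S. dist (\<Sum>k\<in>A. single k (d t k * entry y k)) (mult_ell2 (d t) y) < e"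
    proof eventually_elim
      case (elim A)
      show ?case
      proof
        fix t assume t: "t \<in> S"
        have "(\<Sum>k\<in>A. single k (d t k * entry y k)) - mult_ell2 (d t) y
            = mult_ell2 (d t) ((\<Sum>k\<in>A. single k (entry y k)) - y)"
          by (simp add: linear_diff[OF lin[OF t]] linear_sum[OF lin[OF t]] mult_ell2_single[OF b[OF t]])
        then have "dist (\<Sum>k\<in>A. single k (d t k * entry y k)) (mult_ell2 (d t) y)
            \<le> C * dist (\<Sum>k\<in>A. single k (entry y k)) y"
          using norm_mult_ell2_le[OF C[OF t]] by (simp add: dist_norm)
        also have "\<dots> \<le> (C + 1) * dist (\<Sum>k\<in>A. single k (entry y k)) y" by (simp add: mult_right_mono)
        also have "\<dots> < e" using elim C0 by (simp add: pos_less_divide_eq mult.commute)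
        finally show "dist (\<Sum>k\<in>A. single k (d t k * entry y k)) (mult_ell2 (d t) y) < e" .
      qed
    qed
  qed
  moreover have "continuous_on S (\<lambda>t. \<Sum>k\<in>A. single k (d t k * entry y k))" for A
    by (intro continuous_on_sum bounded_linear.continuous_on[OF bounded_linear_single] continuous_on_mult d
        continuous_on_const)
  ultimately have "continuous_on S (\<lambda>t. mult_ell2 (d t) y)"
    by (intro uniform_limit_theorem[where F = "finite_subsets_at_top UNIV"]) auto
  then have 1: "((\<lambda>t. mult_ell2 (d t) y) \<longlongrightarrow> mult_ell2 (d t0) y) (at t0 within S)"
    using t0 by (simp add: continuous_on_def)
  have "((\<lambda>t. x t - y) \<longlongrightarrow> 0) (at t0 within S)"
    using x t0 by (auto simp: continuous_on_def y_def intro: LIM_zero)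
  then have "((\<lambda>t. mult_ell2 (d t) (x t - y)) \<longlongrightarrow> 0) (at t0 within S)"
    by (rule tendsto_0_le[where K = C])
       (auto simp: eventually_at_filter mult.commute[of _ C] intro!: always_eventually norm_mult_ell2_le C)
  from tendsto_add[OF 1 this]
  have "((\<lambda>t. mult_ell2 (d t) y + mult_ell2 (d t) (x t - y)) \<longlongrightarrow> mult_ell2 (d t0) (x t0)) (at t0 within S)"
    by (simp add: y_def)
  then show "((\<lambda>t. mult_ell2 (d t) (x t)) \<longlongrightarrow> mult_ell2 (d t0) (x t0)) (at t0 within S)"
  proof (rule Lim_transform_eventually)
    show "\<forall>\<^sub>F t in at t0 within S. mult_ell2 (d t) y + mult_ell2 (d t) (x t - y) = mult_ell2 (d t) (x t)"
      using lin by (auto simp: eventually_at_filter linear_diff)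
  qed
qed

subsection \<open>Matrices with summable off-diagonal decay\<close>

lift_definition shift_ell2 :: "int \<Rightarrow> ell2 \<Rightarrow> ell2" is "\<lambda>m x k. x (k - m)"
proof -
  fix m and x :: "int \<Rightarrow> complex" assume x: "(\<lambda>k. (cmod (x k))\<^sup>2) summable_on UNIV"
  have "bij (\<lambda>k::int. k - m)" by (rule bij_betw_byWitness[where f' = "\<lambda>k. k + m"]) auto
  from summable_on_reindex_bij_betw[OF this, of "\<lambda>k. (cmod (x k))\<^sup>2"] x
  show "(\<lambda>k. (cmod (x (k - m)))\<^sup>2) summable_on UNIV" by simp
qed

lemma entry_shift: "entry (shift_ell2 m x) k = entry x (k - m)" by transfer simp

lemma norm_shift: "norm (shift_ell2 m x) = norm x"
proof -
  have "bij (\<lambda>k::int. k - m)" by (rule bij_betw_byWitness[where f' = "\<lambda>k. k + m"]) auto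
  from infsum_reindex_bij_betw[OF this, of "\<lambda>k. (cmod (entry x k))\<^sup>2"]
  show ?thesis by (simp add: norm_ell2_eq entry_shift)
qed

text \<open>Domination by a summable convolution kernel: the hypothesis of Young's inequality, which
  makes the matrix bounded on square-summable sequences.\<close>

definition off_diagonal_bound :: "(int \<Rightarrow> int \<Rightarrow> complex) \<Rightarrow> (int \<Rightarrow> real) \<Rightarrow> bool" where
  "off_diagonal_bound a c \<longleftrightarrow> c summable_on UNIV \<and> (\<forall>k l. cmod (a k l) \<le> c (k - l))"

text \<open>The matrix is summed diagonal by diagonal, the \<open>m\<close>-th one being a shift
  followed by a multiplier. The triangle inequality then gives boundedness without any rearrangement
  of double sums.\<close>

definition mat_ell2 :: "(int \<Rightarrow> int \<Rightarrow> complex) \<Rightarrow> ell2 \<Rightarrow> ell2" where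
  "mat_ell2 a x = (\<Sum>\<^sub>\<infinity>m. mult_ell2 (\<lambda>k. a k (k - m)) (shift_ell2 m x))"

context
  fixes a c assumes bound: "off_diagonal_bound a c"
begin

lemma off_diagonal_bound_mult: "cmod (a k (k - m)) \<le> c m"
  using bound unfolding off_diagonal_bound_def by (metis diff_diff_eq2 add_diff_cancel_left')

lemma summable_mat_ell2: "(\<lambda>m. mult_ell2 (\<lambda>k. a k (k - m)) (shift_ell2 m x)) abs_summable_on UNIV"
proof (rule summable_on_comparison_test)
  show "(\<lambda>m. c m * norm x) summable_on UNIV"
    using bound by (intro summable_on_cmult_left) (simp add: off_diagonal_bound_def)
  show "norm (mult_ell2 (\<lambda>k. a k (k - m)) (shift_ell2 m x)) \<le> c m * norm x" for m
    using norm_mult_ell2_le[OF off_diagonal_bound_mult, where x = "shift_ell2 m x"] by (simp add: norm_shift)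
qed simp

lemma has_sum_mat_ell2: "((\<lambda>m. mult_ell2 (\<lambda>k. a k (k - m)) (shift_ell2 m x)) has_sum mat_ell2 a x) UNIV"
  unfolding mat_ell2_def by (rule has_sum_infsum[OF abs_summable_summable[OF summable_mat_ell2]])

lemma norm_mat_ell2_le: "norm (mat_ell2 a x) \<le> infsum c UNIV * norm x"
proof (rule norm_infsum_le[OF has_sum_mat_ell2])
  show "((\<lambda>m. c m * norm x) has_sum infsum c UNIV * norm x) UNIV"
    using bound by (intro has_sum_cmult_left has_sum_infsum) (simp add: off_diagonal_bound_def)
  show "norm (mult_ell2 (\<lambda>k. a k (k - m)) (shift_ell2 m x)) \<le> c m * norm x" for m
    using norm_mult_ell2_le[OF off_diagonal_bound_mult, where x = "shift_ell2 m x"] by (simp add: norm_shift)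
qed

lemma bounded_linear_mat_ell2: "bounded_linear (mat_ell2 a)"
proof (rule bounded_linear_intro)
  have lin: "linear (mult_ell2 (\<lambda>k. a k (k - m)))" for m
    using bounded_linear_mult_ell2[OF bounded_rangeI[OF off_diagonal_bound_mult]] by (rule bounded_linear.linear)
  have shift: "shift_ell2 m (x + y) = shift_ell2 m x + shift_ell2 m y"
    "shift_ell2 m (r *\<^sub>R x) = r *\<^sub>R shift_ell2 m x" for m x y r
    by (auto intro!: ell2_eqI simp: entry_shift)
  show "mat_ell2 a (x + y) = mat_ell2 a x + mat_ell2 a y" for x y
    using has_sum_add[OF has_sum_mat_ell2[of x] has_sum_mat_ell2[of y]] has_sum_mat_ell2[of "x + y"]
    by (simp add: shift linear_add[OF lin] has_sum_unique)
  show "mat_ell2 a (r *\<^sub>R x) = r *\<^sub>R mat_ell2 a x" for r x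
    using has_sum_scaleR[OF has_sum_mat_ell2[of x], of r] has_sum_mat_ell2[of "r *\<^sub>R x"]
    by (simp add: shift linear_scale[OF lin] has_sum_unique)
  show "norm (mat_ell2 a x) \<le> norm x * infsum c UNIV" for x
    using norm_mat_ell2_le[of x] by (simp add: mult.commute)
qed

lemma entry_mat_ell2_has_sum: "((\<lambda>l. a k l * entry x l) has_sum entry (mat_ell2 a x) k) UNIV"
proof -
  have "((\<lambda>m. a k (k - m) * entry x (k - m)) has_sum entry (mat_ell2 a x) k) UNIV"
    using has_sum_bounded_linear[OF bounded_linear_entry[of k] has_sum_mat_ell2[of x]]
    by (simp add: entry_mult_ell2[OF bounded_rangeI[OF off_diagonal_bound_mult]] entry_shift)
  moreover have "bij (\<lambda>m. k - m)" by (rule bij_betw_byWitness[where f' = "\<lambda>m. k - m"]) auto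
  ultimately show ?thesis
    using has_sum_reindex_bij_betw[of "\<lambda>m. k - m" UNIV UNIV "\<lambda>l. a k l * entry x l"] by simp
qed

lemma entry_mat_ell2_single: "entry (mat_ell2 a (single l z)) k = a k l * z"
proof (rule has_sum_unique[OF entry_mat_ell2_has_sum])
  have "((\<lambda>j. a k j * entry (single l z) j) has_sum (a k l * z)) {l}"
    by (rule has_sum_finiteI) (auto simp: entry_single)
  then show "((\<lambda>j. a k j * entry (single l z) j) has_sum (a k l * z)) UNIV"
    by (rule iffD1[OF has_sum_cong_neutral, rotated -1]) (auto simp: entry_single)
qed

end

lemma off_diagonal_bound_adjoint:
  assumes "off_diagonal_bound a c" shows "off_diagonal_bound (\<lambda>k l. cnj (a l k)) (\<lambda>m. c (- m))"
proof -
  have "bij (uminus :: int \<Rightarrow> int)" by (rule bij_uminus)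
  from summable_on_reindex_bij_betw[OF this, of c] assms
  show ?thesis unfolding off_diagonal_bound_def by (auto simp: minus_diff_eq)
qed

lemma mat_ell2_adjoint:
  assumes "off_diagonal_bound a c"
  shows "inner (mat_ell2 a x) y = inner x (mat_ell2 (\<lambda>k l. cnj (a l k)) y)"
proof -
  note b = assms off_diagonal_bound_adjoint[OF assms]
  note lin = b[THEN bounded_linear_mat_ell2]
  have "inner (mat_ell2 a (single k z)) (single l w) = inner (single k z) (mat_ell2 (\<lambda>k l. cnj (a l k)) (single l w))" for k z l w
    unfolding inner_commute[of "single k z"]
    by (simp add: inner_single entry_mat_ell2_single[OF b(1)] entry_mat_ell2_single[OF b(2)] inner_complex_def algebra_simps)
  then have "inner (mat_ell2 a (single k z)) y = inner (single k z) (mat_ell2 (\<lambda>k l. cnj (a l k)) y)" for k z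
    by (rule bounded_linear_eq_on_singles[OF bounded_linear_inner_right
        bounded_linear_compose[OF bounded_linear_inner_right lin(2)]])
  then show ?thesis
    by (rule bounded_linear_eq_on_singles[OF bounded_linear_compose[OF bounded_linear_inner_left lin(1)]
        bounded_linear_inner_left])
qed

section \<open>Functions biorthogonal to a family of exponentials\<close>

lemma summable_on_int_inverse_square: "(\<lambda>k::int. 1 / (1 + \<bar>real_of_int k\<bar>)\<^sup>2) summable_on UNIV"
proof -
  have "summable (\<lambda>n. inverse (real (Suc n) ^ 2))"
    using inverse_power_summable[of 2, where 'a = real] by (subst summable_Suc_iff) simp
  then have nat: "(\<lambda>n::nat. 1 / (1 + real n)\<^sup>2) summable_on UNIV"
    by (intro summable_nonneg_imp_summable_on) (simp_all add: inverse_eq_divide add.commute)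
  have 1: "(\<lambda>k::int. 1 / (1 + \<bar>real_of_int k\<bar>)\<^sup>2) summable_on range int"
    using nat by (subst summable_on_reindex) (auto simp: comp_def)
  have 2: "(\<lambda>k::int. 1 / (1 + \<bar>real_of_int k\<bar>)\<^sup>2) summable_on range (\<lambda>n. - int n)"
    using nat by (subst summable_on_reindex) (auto simp: comp_def inj_def)
  have "UNIV = range int \<union> range (\<lambda>n. - int n)"
    by (auto simp: image_iff) (metis int_cases2)
  then show ?thesis using summable_on_union[OF 1 2] by simp
qed

lemma inverse_square_le: "k \<noteq> 0 \<Longrightarrow> 1 / (real_of_int k)\<^sup>2 \<le> 4 * (1 / (1 + \<bar>real_of_int k\<bar>)\<^sup>2)"
proof -
  assume "k \<noteq> 0"
  then have "1 \<le> \<bar>k\<bar>" by linarith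
  then have "1 \<le> \<bar>real_of_int k\<bar>" by linarith
  then have "(1 + \<bar>real_of_int k\<bar>)\<^sup>2 \<le> (2 * \<bar>real_of_int k\<bar>)\<^sup>2"
    by (intro power_mono) auto
  moreover have "(2 * \<bar>real_of_int k\<bar>)\<^sup>2 = 4 * (real_of_int k)\<^sup>2" by (simp add: power_mult_distrib)
  ultimately have "(1 + \<bar>real_of_int k\<bar>)\<^sup>2 \<le> 4 * (real_of_int k)\<^sup>2" "0 < (1 + \<bar>real_of_int k\<bar>)\<^sup>2"
      "0 < (real_of_int k)\<^sup>2"
    using \<open>k \<noteq> 0\<close> by auto
  then show ?thesis by (simp add: divide_simps)
qed

text \<open>The term at \<open>k = 0\<close> is \<open>1 / 0 = 0\<close>. This default is harmless
  below because the quantities estimated by it vanish at that index.\<close>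

lemma summable_on_int_inverse_square': "(\<lambda>k::int. 1 / (real_of_int k)\<^sup>2) summable_on UNIV"
proof (rule summable_on_comparison_test)
  show "(\<lambda>k::int. 4 * (1 / (1 + \<bar>real_of_int k\<bar>)\<^sup>2)) summable_on UNIV"
    by (intro summable_on_cmult_right summable_on_int_inverse_square)
  show "1 / (real_of_int k)\<^sup>2 \<le> 4 * (1 / (1 + \<bar>real_of_int k\<bar>)\<^sup>2)" for k
    using inverse_square_le[of k] by (cases "k = 0") auto
qed simp

lemma has_sum_minus:
  fixes f g :: "'a \<Rightarrow> 'b::real_normed_vector"
  assumes "(f has_sum a) A" "(g has_sum b) A" shows "((\<lambda>x. f x - g x) has_sum (a - b)) A"
  using has_sum_add[OF assms(1), of "\<lambda>x. - g x" "- b"] assms(2) by (simp add: has_sum_uminus)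

section \<open>Transforms over a time interval and their termwise evaluation\<close>

definition exp_transform :: "real \<Rightarrow> (real \<Rightarrow> complex) \<Rightarrow> real \<Rightarrow> complex" where
  "exp_transform L f \<xi> = integral {0..L} (\<lambda>t. cis (- (\<xi> * t)) * f t)"

lemma integrable_exp_transform:
  assumes "continuous_on UNIV f"
  shows "(\<lambda>t. cis (- (\<xi> * t)) * f t) integrable_on {a..b}"
  by (intro integrable_continuous_interval continuous_intros continuous_on_subset[OF assms]) auto

context
  fixes f :: "'k \<Rightarrow> real \<Rightarrow> complex" and M :: "'k \<Rightarrow> real"
  assumes cont: "\<And>k. continuous_on UNIV (f k)" and le: "\<And>k t. cmod (f k t) \<le> M k"
    and M: "M summable_on UNIV"
begin

lemma continuous_on_infsum: "continuous_on UNIV (\<lambda>t. \<Sum>\<^sub>\<infinity>k. f k t)"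
  using Weierstrass_m_test_general[of UNIV UNIV f M, OF le M]
  by (rule uniform_limit_theorem[rotated]) (auto intro!: always_eventually continuous_intros cont)

lemma summable_on_dominated: "(\<lambda>k. f k t) summable_on UNIV"
proof (rule abs_summable_summable)
  show "(\<lambda>k. norm (f k t)) summable_on UNIV"
    by (rule summable_on_comparison_test[OF M]) (auto simp: le)
qed

lemma norm_infsum_dominated: "cmod (\<Sum>\<^sub>\<infinity>k. f k t) \<le> infsum M UNIV"
  by (rule norm_infsum_le[OF has_sum_infsum[OF summable_on_dominated] has_sum_infsum[OF M]]) (rule le)

lemma exp_transform_infsum:
  "((\<lambda>k. exp_transform L (f k) \<xi>) has_sum exp_transform L (\<lambda>t. \<Sum>\<^sub>\<infinity>k. f k t) \<xi>) UNIV"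
proof -
  let ?e = "\<lambda>t. cis (- (\<xi> * t))"
  have "uniform_limit {0..L} (\<lambda>A t. \<Sum>k\<in>A. ?e t * f k t) (\<lambda>t. \<Sum>\<^sub>\<infinity>k. ?e t * f k t) (finite_subsets_at_top UNIV)"
    by (rule Weierstrass_m_test_general[OF _ M]) (simp add: norm_mult le)
  then obtain I J where I: "\<And>A. ((\<lambda>t. \<Sum>k\<in>A. ?e t * f k t) has_integral I A) {0..L}"
    and J: "((\<lambda>t. \<Sum>\<^sub>\<infinity>k. ?e t * f k t) has_integral J) {0..L}"
    and lim: "(I \<longlongrightarrow> J) (finite_subsets_at_top UNIV)"
  proof (rule uniform_limit_integral)
    show "continuous_on {0..L} (\<lambda>t. \<Sum>k\<in>A. ?e t * f k t)" for A
      by (intro continuous_intros continuous_on_subset[OF cont]) auto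
  qed auto
  have "J = exp_transform L (\<lambda>t. \<Sum>\<^sub>\<infinity>k. f k t) \<xi>"
    using integral_unique[OF J] by (simp add: exp_transform_def infsum_cmult_right')
  moreover have I_def: "I = (\<lambda>A. \<Sum>k\<in>A. exp_transform L (f k) \<xi>)"
  proof
  fix A show "I A = (\<Sum>k\<in>A. exp_transform L (f k) \<xi>)"
  proof (cases "finite A")
    case True
    then show ?thesis
      using integral_unique[OF I[of A]] by (simp add: exp_transform_def integral_sum integrable_exp_transform cont)
  next
    case False
    then show ?thesis using integral_unique[OF I[of A]] by simp
  qed
  qed
  ultimately show ?thesis using lim by (simp add: has_sum_def I_def)
qed

end

lemma exp_transform_cmult: "exp_transform L (\<lambda>t. c * f t) \<xi> = c * exp_transform L f \<xi>"
  by (simp add: exp_transform_def mult.left_commute)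

lemma exp_transform_diff:
  assumes "continuous_on UNIV f" "continuous_on UNIV g"
  shows "exp_transform L (\<lambda>t. f t - g t) \<xi> = exp_transform L f \<xi> - exp_transform L g \<xi>"
  using assms by (simp add: exp_transform_def right_diff_distrib integral_diff integrable_exp_transform)

subsection \<open>A window function\<close>

text \<open>Squaring makes the function continuously differentiable on the whole line: value and
  slope vanish at both ends, so two integrations by parts leave no boundary terms.\<close>

definition window :: "real \<Rightarrow> real \<Rightarrow> real" where "window T t = (max 0 (t * (T - t)))\<^sup>2"

lemma window_outside: "0 < T \<Longrightarrow> t \<notin> {0..T} \<Longrightarrow> window T t = 0"
  by (auto simp: window_def max_def zero_le_mult_iff)

lemma window_inside: "t \<in> {0..T} \<Longrightarrow> window T t = (t * (T - t))\<^sup>2"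
  by (auto simp: window_def max_def zero_le_mult_iff)

lemma continuous_window: "continuous_on S (window T)"
  unfolding window_def by (intro continuous_intros)

lemma window_le: "0 < T \<Longrightarrow> \<bar>window T t\<bar> \<le> T ^ 4"
proof (cases "t \<in> {0..T}")
  case True
  then have "t * (T - t) \<le> T * T" "0 \<le> t * (T - t)" by (auto intro!: mult_mono)
  then have "(t * (T - t))\<^sup>2 \<le> (T * T)\<^sup>2" by (intro power_mono)
  then show ?thesis using window_inside[OF True] by (simp add: power4_eq_xxxx power2_eq_square[of "T * T"] mult.assoc)
qed (simp add: window_outside)

lemma exp_transform_superset:
  assumes "continuous_on UNIV f" "\<And>t. t \<notin> {0..T} \<Longrightarrow> f t = 0" "T \<le> L"
  shows "exp_transform L f \<xi> = exp_transform T f \<xi>"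
proof -
  have "((\<lambda>t. cis (- (\<xi> * t)) * f t) has_integral exp_transform T f \<xi>) {0..T}"
    unfolding exp_transform_def by (intro integrable_integral integrable_exp_transform assms)
  then have "((\<lambda>t. cis (- (\<xi> * t)) * f t) has_integral exp_transform T f \<xi>) {0..L}"
    by (rule has_integral_on_superset) (use assms in auto)
  then show ?thesis unfolding exp_transform_def by (rule integral_unique)
qed

lemma has_vector_derivative_cis: "((\<lambda>t. cis (a * t)) has_vector_derivative (\<i> * a * cis (a * t))) (at t within S)"
proof -
  have "((\<lambda>z. exp (\<i> * a * z)) has_field_derivative \<i> * a * exp (\<i> * a * of_real t)) (at (of_real t))"
    by (auto intro!: derivative_eq_intros)
  from has_vector_derivative_real_field[OF this]
  show ?thesis by (simp add: cis_conv_exp mult.assoc)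
qed

text \<open>Two integrations by parts move the derivatives onto the quartic polynomial
  \<open>P\<close>; its second derivative \<open>P2\<close> is bounded, crudely, by
  \<open>6 * T\<^sup>2\<close> on the interval.\<close>

lemma window_transform_le:
  assumes T: "0 < T" "T \<le> L" and \<xi>: "\<xi> \<noteq> 0"
  shows "cmod (exp_transform L (\<lambda>t. of_real (window T t)) \<xi>) \<le> 6 * T ^ 3 / \<xi>\<^sup>2"
proof -
  let ?e = "\<lambda>t. cis (- \<xi> * t)"
  define c where "c = - (\<i> * complex_of_real \<xi>)"
  have c: "c \<noteq> 0" "cmod c = \<bar>\<xi>\<bar>" using \<xi> by (simp_all add: c_def norm_mult)
  define P P1 P2 where "P = (\<lambda>t::real. (t * (T - t))\<^sup>2)" and "P1 = (\<lambda>t::real. 2 * (t * (T - t)) * (T - 2 * t))"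
    and "P2 = (\<lambda>t::real. 2 * ((T - 2 * t)\<^sup>2 - 2 * (t * (T - t))))"
  have dP: "((\<lambda>t. complex_of_real (P t)) has_vector_derivative of_real (P1 t)) (at t within S)"
    "((\<lambda>t. complex_of_real (P1 t)) has_vector_derivative of_real (P2 t)) (at t within S)" for t S
  proof -
    have "(P has_real_derivative P1 t) (at t within S)" "(P1 has_real_derivative P2 t) (at t within S)"
      unfolding P_def P1_def P2_def
      by (auto intro!: derivative_eq_intros simp: algebra_simps power2_eq_square)
    then show "((\<lambda>t. complex_of_real (P t)) has_vector_derivative of_real (P1 t)) (at t within S)"
      "((\<lambda>t. complex_of_real (P1 t)) has_vector_derivative of_real (P2 t)) (at t within S)"
      by (intro has_vector_derivative_of_real; simp add: has_real_derivative_iff_has_vector_derivative)+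
  qed
  \<comment> \<open>Both integrations by parts at once: the derivative of \<open>?H\<close> is the
    exponential times \<open>P - P2 / c\<^sup>2\<close>, and \<open>?H\<close> vanishes at both ends
    because \<open>P\<close> and \<open>P1\<close> do.\<close>
  let ?H = "\<lambda>t. ?e t * (of_real (P t) / c - of_real (P1 t) / c\<^sup>2)"
  have dH: "(?H has_vector_derivative (?e t * of_real (P t) - ?e t * of_real (P2 t) / c\<^sup>2)) (at t within {0..T})" for t
  proof -
    have "((\<lambda>t. of_real (P t) / c - of_real (P1 t) / c\<^sup>2) has_vector_derivative
        (of_real (P1 t) / c - of_real (P2 t) / c\<^sup>2)) (at t within {0..T})"
      by (intro has_vector_derivative_diff has_vector_derivative_divide dP)
    from has_vector_derivative_mult[OF has_vector_derivative_cis[of "- \<xi>"] this]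
    show ?thesis using c by (simp add: c_def field_simps power2_eq_square)
  qed
  have "((\<lambda>t. ?e t * of_real (P t) - ?e t * of_real (P2 t) / c\<^sup>2) has_integral (?H T - ?H 0)) {0..T}"
    using T by (intro fundamental_theorem_of_calculus dH) auto
  then have 0: "((\<lambda>t. ?e t * of_real (P t) - ?e t * of_real (P2 t) / c\<^sup>2) has_integral 0) {0..T}"
    by (simp add: P_def P1_def)
  have i: "(\<lambda>t. ?e t * of_real (P t)) integrable_on {0..T}" "(\<lambda>t. ?e t * of_real (P2 t) / c\<^sup>2) integrable_on {0..T}"
    unfolding P_def P2_def by (intro integrable_continuous_interval continuous_intros; simp add: c)+
  have "integral {0..T} (\<lambda>t. ?e t * of_real (P t)) = integral {0..T} (\<lambda>t. ?e t * of_real (P2 t) / c\<^sup>2)"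
    using integral_diff[OF i] integral_unique[OF 0] by simp
  moreover have "cmod (integral {0..T} (\<lambda>t. ?e t * of_real (P2 t) / c\<^sup>2)) \<le> (6 * T\<^sup>2 / \<xi>\<^sup>2) * (T - 0)"
  proof (rule integral_bound)
    show "continuous_on {0..T} (\<lambda>t. ?e t * of_real (P2 t) / c\<^sup>2)"
      unfolding P2_def by (intro continuous_intros) (simp add: c)
    fix t assume t: "t \<in> {0..T}"
    have "0 \<le> t * (T - t)" using t by auto
    moreover have "t * (T - t) \<le> T * T" using t T by (intro mult_mono) auto
    moreover have "(T - 2 * t)\<^sup>2 \<le> T\<^sup>2" using t T by (intro power2_le_iff_abs_le[THEN iffD2]) auto
    moreover have "0 \<le> (T - 2 * t)\<^sup>2" by simp
    ultimately have "\<bar>2 * ((T - 2 * t)\<^sup>2 - 2 * (t * (T - t)))\<bar> \<le> 6 * (T * T)"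
      unfolding power2_eq_square[of T] by (smt (verit))
    then have "\<bar>P2 t\<bar> \<le> 6 * T\<^sup>2" by (simp only: P2_def power2_eq_square[of T])
    then show "cmod (?e t * of_real (P2 t) / c\<^sup>2) \<le> 6 * T\<^sup>2 / \<xi>\<^sup>2"
      by (simp add: norm_mult norm_divide norm_power c divide_right_mono)
  qed (use T in auto)
  moreover have "exp_transform L (\<lambda>t. of_real (window T t)) \<xi> = integral {0..T} (\<lambda>t. ?e t * of_real (P t))"
  proof -
    have "exp_transform L (\<lambda>t. of_real (window T t)) \<xi> = exp_transform T (\<lambda>t. of_real (window T t)) \<xi>"
      using T by (intro exp_transform_superset) (auto intro!: continuous_intros continuous_window simp: window_outside)
    also have "\<dots> = integral {0..T} (\<lambda>t. ?e t * of_real (P t))"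
      unfolding exp_transform_def P_def by (intro integral_cong) (simp add: window_inside)
    finally show ?thesis .
  qed
  ultimately show ?thesis by (simp add: power2_eq_square power3_eq_cube mult.assoc)
qed

text \<open>The value is \<open>T ^ 5 / 30\<close>, the area under the window. It is the diagonal
  entry of the matrix of windowed exponentials, by which both constructions below divide.\<close>

lemma window_transform_0:
  assumes T: "0 < T" "T \<le> L"
  shows "exp_transform L (\<lambda>t. of_real (window T t)) 0 \<noteq> 0"
proof -
  have "((\<lambda>t. (t * (T - t))\<^sup>2) has_integral ((T\<^sup>2 * T ^ 3 / 3 - T * T ^ 4 / 2 + T ^ 5 / 5) - 0)) {0..T}"
  proof -
    have "((\<lambda>t. T\<^sup>2 * t ^ 3 / 3 - T * t ^ 4 / 2 + t ^ 5 / 5) has_vector_derivative (t * (T - t))\<^sup>2) (at t within {0..T})" for t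
      unfolding has_real_derivative_iff_has_vector_derivative[symmetric]
      by (auto intro!: derivative_eq_intros simp: algebra_simps power2_eq_square power3_eq_cube power4_eq_xxxx)
    from fundamental_theorem_of_calculus[OF _ this] T show ?thesis by simp
  qed
  then have "((\<lambda>t. complex_of_real ((t * (T - t))\<^sup>2)) has_integral of_real ((T\<^sup>2 * T ^ 3 / 3 - T * T ^ 4 / 2 + T ^ 5 / 5) - 0)) {0..T}"
    by (rule has_integral_of_real)
  moreover have "T\<^sup>2 * T ^ 3 / 3 - T * T ^ 4 / 2 + T ^ 5 / 5 = T ^ 5 / 30"
    by (simp add: field_simps flip: power_add power_Suc)
  moreover have "exp_transform L (\<lambda>t. of_real (window T t)) 0 = integral {0..T} (\<lambda>t. complex_of_real ((t * (T - t))\<^sup>2))"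
  proof -
    have "exp_transform L (\<lambda>t. of_real (window T t)) 0 = exp_transform T (\<lambda>t. of_real (window T t)) 0"
      using T by (intro exp_transform_superset) (auto intro!: continuous_intros continuous_window simp: window_outside)
    also have "\<dots> = integral {0..T} (\<lambda>t. complex_of_real ((t * (T - t))\<^sup>2))"
      unfolding exp_transform_def by (intro integral_cong) (simp add: window_inside)
    finally show ?thesis .
  qed
  ultimately have "exp_transform L (\<lambda>t. of_real (window T t)) 0 = complex_of_real (T ^ 5 / 30)"
    by (simp only: integral_unique diff_0_right)
  moreover have "complex_of_real (T ^ 5 / 30) \<noteq> 0" using T by (simp only: of_real_eq_0_iff) simp
  ultimately show ?thesis by metis
qed

text \<open>The bound must be uniform on an unbounded set. Since \<open>y - sin y\<close> increases,
  the distance to 1 is at least \<open>(y1 - sin y1) / 2\<close> up to \<open>y = 2\<close>; beyond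
  that \<open>sin y \<le> 1\<close> already gives 1/2.\<close>

lemma sinc_le:
  fixes y0 :: real
  assumes "0 < y0"
  shows "\<exists>c>0. \<forall>y. y0 \<le> \<bar>y\<bar> \<longrightarrow> sin y / y \<le> 1 - c"
proof -
  define y1 where "y1 = min y0 1"
  have y1: "0 < y1" "y1 \<le> 1" "y1 \<le> y0" using assms by (auto simp: y1_def)
  have "sin y1 = 2 * sin (y1 / 2) * cos (y1 / 2)" using sin_double[of "y1 / 2"] by simp
  also have "\<dots> < 2 * sin (y1 / 2) * 1"
  proof (rule mult_strict_left_mono)
    show "cos (y1 / 2) < 1" using cos_monotone_0_pi[of 0 "y1 / 2"] y1 pi_gt3 by simp
    show "0 < 2 * sin (y1 / 2)" using sin_gt_zero[of "y1 / 2"] y1 pi_gt3 by simp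
  qed
  also have "\<dots> \<le> y1" using sin_x_le_x[of "y1 / 2"] y1 by simp
  finally have d: "0 < y1 - sin y1" by simp
  have mono: "y1 - sin y1 \<le> y - sin y" if "y1 \<le> y" for y
  proof (rule DERIV_nonneg_imp_nondecreasing[OF that])
    fix x
    show "\<exists>z. ((\<lambda>y. y - sin y) has_real_derivative z) (at x) \<and> 0 \<le> z"
      by (rule exI[of _ "1 - cos x"]) (auto intro!: derivative_eq_intros)
  qed
  define c where "c = min ((y1 - sin y1) / 2) (1 / 2)"
  have pos: "sin y / y \<le> 1 - c" if "y1 \<le> y" for y
  proof (cases "y \<le> 2")
    case True
    have "(y1 - sin y1) / 2 \<le> (y - sin y) / y"
      using mono[OF that] True d y1 that by (intro frac_le) auto
    also have "\<dots> = 1 - sin y / y" using y1 that by (simp add: diff_divide_distrib)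
    finally show ?thesis unfolding c_def by linarith
  next
    case False
    have "sin y \<le> 1 / 2 * y" using sin_le_one[of y] False by linarith
    then have "sin y / y \<le> 1 / 2" using False by (simp add: pos_divide_le_eq)
    then show ?thesis unfolding c_def by linarith
  qed
  have "sin y / y \<le> 1 - c" if "y0 \<le> \<bar>y\<bar>" for y
    using pos[of "\<bar>y\<bar>"] that y1 by (cases "0 \<le> y") auto
  moreover have "0 < c" using d by (simp add: c_def)
  ultimately show ?thesis by blast
qed

definition modulated_window :: "real \<Rightarrow> real \<Rightarrow> real \<Rightarrow> complex" where
  "modulated_window T \<mu> t = of_real (window T t) * cis (\<mu> * t)"

lemma continuous_modulated_window: "continuous_on S (modulated_window T \<mu>)"
  unfolding modulated_window_def by (intro continuous_intros continuous_window)

lemma norm_modulated_window_le: "0 < T \<Longrightarrow> cmod (modulated_window T \<mu> t) \<le> T ^ 4"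
  using window_le by (simp add: modulated_window_def norm_mult)

lemma modulated_window_outside: "0 < T \<Longrightarrow> t \<notin> {0..T} \<Longrightarrow> modulated_window T \<mu> t = 0"
  using window_outside by (simp add: modulated_window_def)

lemma exp_transform_modulated_window:
  "exp_transform L (modulated_window T \<mu>) \<xi> = exp_transform L (\<lambda>t. of_real (window T t)) (\<xi> - \<mu>)"
proof -
  have "cis (- (\<xi> * t)) * modulated_window T \<mu> t = cis (- ((\<xi> - \<mu>) * t)) * of_real (window T t)" for t
    by (simp add: modulated_window_def mult.left_commute cis_mult algebra_simps)
  then show ?thesis by (simp add: exp_transform_def)
qed

subsection \<open>Separating one more exponential\<close>

text \<open>Haraux's device: averaging the translates of \<open>q\<close> with the phase of \<mu>
  multiplies its transform at \<xi> by \<open>average_factor \<tau> (\<mu> - \<xi>)\<close>, which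
  equals 1 at \<mu>. Hence \<open>q\<close> minus its average loses the frequency \<mu>, while the
  support grows only by \<tau>.\<close>

definition average :: "real \<Rightarrow> real \<Rightarrow> (real \<Rightarrow> complex) \<Rightarrow> real \<Rightarrow> complex" where
  "average \<tau> \<mu> q t = integral {0..\<tau>} (\<lambda>\<sigma>. cis (\<mu> * \<sigma>) * q (t - \<sigma>)) / \<tau>"

definition average_factor :: "real \<Rightarrow> real \<Rightarrow> complex" where
  "average_factor \<tau> a = integral {0..\<tau>} (\<lambda>\<sigma>. cis (a * \<sigma>)) / \<tau>"

lemma average_factor_0: "0 < \<tau> \<Longrightarrow> average_factor \<tau> 0 = 1"
  by (simp add: average_factor_def scaleR_conv_of_real)

lemma Re_average_factor:
  assumes "0 < \<tau>" "a \<noteq> 0"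
  shows "Re (average_factor \<tau> a) = sin (a * \<tau>) / (a * \<tau>)"
proof -
  have "((\<lambda>\<sigma>. cis (a * \<sigma>) / (\<i> * a)) has_vector_derivative cis (a * \<sigma>)) (at \<sigma> within {0..\<tau>})" for \<sigma>
    using has_vector_derivative_divide[OF has_vector_derivative_cis[of a], of "\<i> * a"] assms by simp
  from fundamental_theorem_of_calculus[OF _ this] assms
  have "average_factor \<tau> a = (cis (a * \<tau>) / (\<i> * a) - 1 / (\<i> * a)) / \<tau>"
    by (simp add: average_factor_def integral_unique)
  also have "\<dots> = (cis (a * \<tau>) - 1) * (- \<i>) / complex_of_real (a * \<tau>)"
    using assms by (simp add: field_simps)
  finally show ?thesis by (simp add: Re_divide_of_real)
qed

context
  fixes q :: "real \<Rightarrow> complex" and T \<tau> L \<mu> Q :: real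
  assumes cont: "continuous_on UNIV q" and supp: "\<And>t. t \<notin> {0..T} \<Longrightarrow> q t = 0" and \<tau>: "0 < \<tau>"
begin

lemma continuous_average_integrand: "continuous_on S (\<lambda>(t, \<sigma>). cis (f t \<sigma>) * q (t - \<sigma>))"
  if "continuous_on S (\<lambda>(t, \<sigma>). f t \<sigma>)"
  using that by (auto simp: case_prod_unfold intro!: continuous_intros continuous_on_compose2[OF cont])

lemma continuous_average: "continuous_on UNIV (average \<tau> \<mu> q)"
proof -
  have "continuous_on UNIV (\<lambda>t. integral (cbox 0 \<tau>) (\<lambda>\<sigma>. cis (\<mu> * \<sigma>) * q (t - \<sigma>)))"
    by (intro integral_continuous_on_param continuous_average_integrand)
       (auto simp: case_prod_unfold intro!: continuous_intros)
  then show ?thesis unfolding average_def[abs_def] by (intro continuous_intros) (use \<tau> in auto)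
qed

lemma norm_average_le:
  assumes "\<And>t. cmod (q t) \<le> Q" shows "cmod (average \<tau> \<mu> q t) \<le> Q"
proof -
  have "cmod (integral {0..\<tau>} (\<lambda>\<sigma>. cis (\<mu> * \<sigma>) * q (t - \<sigma>))) \<le> Q * (\<tau> - 0)"
    by (rule integral_bound)
       (use \<tau> assms in \<open>auto simp: norm_mult intro!: continuous_intros continuous_on_compose2[OF cont]\<close>)
  then show ?thesis using \<tau> by (simp add: average_def norm_divide pos_divide_le_eq)
qed

lemma average_outside:
  assumes "t \<notin> {0..T + \<tau>}" shows "average \<tau> \<mu> q t = 0"
proof -
  have "integral {0..\<tau>} (\<lambda>\<sigma>. cis (\<mu> * \<sigma>) * q (t - \<sigma>)) = integral {0..\<tau>} (\<lambda>\<sigma>. 0)"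
    using assms by (intro integral_cong) (auto simp: supp)
  then show ?thesis by (simp add: average_def)
qed

text \<open>Exchange the two integrations and translate; \<open>T + \<tau> \<le> L\<close> keeps
  every translated support inside the interval of integration.\<close>

lemma exp_transform_average:
  assumes "T + \<tau> \<le> L"
  shows "exp_transform L (average \<tau> \<mu> q) \<xi> = average_factor \<tau> (\<mu> - \<xi>) * exp_transform L q \<xi>"
proof -
  let ?f = "\<lambda>t \<sigma>. cis (- (\<xi> * t) + \<mu> * \<sigma>) * q (t - \<sigma>)"
  have "exp_transform L (average \<tau> \<mu> q) \<xi> = integral {0..L} (\<lambda>t. integral {0..\<tau>} (?f t)) / \<tau>"
  proof -
    have "?f t = (\<lambda>\<sigma>. cis (- (\<xi> * t)) * (cis (\<mu> * \<sigma>) * q (t - \<sigma>)))" for t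
      by (simp only: cis_mult[symmetric] mult.assoc)
    then have "cis (- (\<xi> * t)) * average \<tau> \<mu> q t = integral {0..\<tau>} (?f t) / \<tau>" for t
      by (simp add: average_def)
    then show ?thesis by (simp add: exp_transform_def)
  qed
  also have "integral {0..L} (\<lambda>t. integral {0..\<tau>} (?f t)) = integral {0..\<tau>} (\<lambda>\<sigma>. integral {0..L} (\<lambda>t. ?f t \<sigma>))"
  proof -
    have "continuous_on (cbox (0, 0) (L, \<tau>)) (\<lambda>(t, \<sigma>). ?f t \<sigma>)"
      by (rule continuous_average_integrand) (auto simp: case_prod_unfold intro!: continuous_intros)
    from integral_swap_continuous[OF this] show ?thesis by (simp only: cbox_interval)
  qed
  also have "\<dots> = integral {0..\<tau>} (\<lambda>\<sigma>. cis ((\<mu> - \<xi>) * \<sigma>) * exp_transform L q \<xi>)"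
  proof (rule integral_cong)
    fix \<sigma> assume \<sigma>: "\<sigma> \<in> {0..\<tau>}"
    let ?G = "\<lambda>s. cis (- (\<xi> * s)) * q s"
    have "exp_transform L q \<xi> = exp_transform T q \<xi>"
      using assms \<tau> by (intro exp_transform_superset cont supp) auto
    then have "(?G has_integral exp_transform L q \<xi>) {0..T}"
      unfolding exp_transform_def by (metis integrable_integral integrable_exp_transform cont)
    from has_integral_shift_real_ivl[OF this, of "- \<sigma>"]
    have "((\<lambda>t. ?G (t - \<sigma>)) has_integral exp_transform L q \<xi>) {\<sigma>..T + \<sigma>}" by simp
    then have "((\<lambda>t. ?G (t - \<sigma>)) has_integral exp_transform L q \<xi>) {0..L}"
      by (rule has_integral_on_superset) (use \<sigma> assms in \<open>auto simp: supp\<close>)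
    moreover have "(\<lambda>t. ?f t \<sigma>) = (\<lambda>t. cis ((\<mu> - \<xi>) * \<sigma>) * ?G (t - \<sigma>))"
      by (simp only: mult.assoc[symmetric] cis_mult) (simp add: algebra_simps)
    ultimately show "integral {0..L} (\<lambda>t. ?f t \<sigma>) = cis ((\<mu> - \<xi>) * \<sigma>) * exp_transform L q \<xi>"
      by (simp only: integral_mult_right integral_unique)
  qed
  finally show ?thesis by (simp add: average_factor_def)
qed

end

text \<open>The factor \<open>\<bar>j - k\<bar>\<close> alone would be an ordinary uniform gap and
  gives summability away from the diagonal. The factor
  \<open>max \<bar>j\<bar> \<bar>k\<bar>\<close> says that the gaps grow with the frequency; it is
  what permits arbitrarily short times.\<close>

definition gap_condition :: "(int \<Rightarrow> real) \<Rightarrow> real \<Rightarrow> bool" where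
  "gap_condition lam c \<longleftrightarrow> 0 < c \<and>
     (\<forall>j k. c * real_of_int (max \<bar>j\<bar> \<bar>k\<bar> * \<bar>j - k\<bar>) \<le> \<bar>lam j - lam k\<bar>)"

text \<open>The first two forms serve for inserting one frequency, the third for the high
  frequencies.\<close>

lemma gap_condition_le:
  assumes "gap_condition lam c" "j \<noteq> k"
  shows "c * \<bar>real_of_int (j - k)\<bar> \<le> \<bar>lam j - lam k\<bar>" "c \<le> \<bar>lam j - lam k\<bar>"
    "c * (\<bar>real_of_int j\<bar> * \<bar>real_of_int (j - k)\<bar>) \<le> \<bar>lam j - lam k\<bar>"
proof -
  have *: "0 < c" "c * real_of_int (max \<bar>j\<bar> \<bar>k\<bar> * \<bar>j - k\<bar>) \<le> \<bar>lam j - lam k\<bar>"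
    using assms by (auto simp: gap_condition_def)
  have le: "c * real_of_int a \<le> \<bar>lam j - lam k\<bar>" if "a \<le> max \<bar>j\<bar> \<bar>k\<bar> * \<bar>j - k\<bar>" for a
  proof -
    have "real_of_int a \<le> real_of_int (max \<bar>j\<bar> \<bar>k\<bar> * \<bar>j - k\<bar>)" using that by (simp only: of_int_le_iff)
    from mult_left_mono[OF this, of c] show ?thesis using * by linarith
  qed
  have 1: "1 \<le> max \<bar>j\<bar> \<bar>k\<bar>" "1 \<le> \<bar>j - k\<bar>" using assms(2) by linarith+
  have 2: "\<bar>j - k\<bar> \<le> max \<bar>j\<bar> \<bar>k\<bar> * \<bar>j - k\<bar>" using mult_right_mono[OF 1(1), of "\<bar>j - k\<bar>"] by simp
  show "c * \<bar>real_of_int (j - k)\<bar> \<le> \<bar>lam j - lam k\<bar>" using le[OF 2] by simp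
  show "c \<le> \<bar>lam j - lam k\<bar>" using le[of 1] 1 2 by simp
  show "c * (\<bar>real_of_int j\<bar> * \<bar>real_of_int (j - k)\<bar>) \<le> \<bar>lam j - lam k\<bar>"
    using le[of "\<bar>j\<bar> * \<bar>j - k\<bar>"] by (simp add: mult_right_mono)
qed

text \<open>The bound \<open>Q\<close> does not depend on \<open>j\<close>. Transforms are taken
  over the fixed interval \<open>{0..L}\<close> while the support interval \<open>{0..T}\<close> may
  grow inside it, so the orthogonality relations already obtained keep their meaning. Outside
  \<open>F\<close> only size and support are prescribed.\<close>

definition biorthogonal_family ::
    "real \<Rightarrow> (int \<Rightarrow> real) \<Rightarrow> real \<Rightarrow> int set \<Rightarrow> (int \<Rightarrow> real \<Rightarrow> complex) \<Rightarrow> real \<Rightarrow> bool" where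
  "biorthogonal_family L lam T F q Q \<longleftrightarrow>
     (\<forall>j. continuous_on UNIV (q j)) \<and> (\<forall>j t. cmod (q j t) \<le> Q) \<and> (\<forall>j t. t \<notin> {0..T} \<longrightarrow> q j t = 0) \<and>
     (\<forall>j\<in>F. \<forall>k\<in>F. exp_transform L (q j) (lam k) = of_bool (j = k))"

text \<open>Subtracting averages makes the old functions blind to the new frequency \<mu>. The new
  function is a windowed exponential at \<mu> from which its components at the old frequencies are
  removed by means of the modified old functions; removing them leaves its value at \<mu>
  untouched.\<close>

lemma biorthogonal_family_insert:
  assumes gap: "gap_condition lam c" and q: "biorthogonal_family L lam T F q Q"
    and T: "0 < T" "T < T'" "T' \<le> L" and m: "m \<notin> F"
  shows "\<exists>q' Q'. biorthogonal_family L lam T' (insert m F) q' Q'"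
proof -
  define \<tau> where "\<tau> = T' - T"
  define \<mu> where "\<mu> = lam m"
  define W where "W = (\<lambda>\<xi>. exp_transform L (\<lambda>t. of_real (window T t)) \<xi>)"
  have \<tau>: "0 < \<tau>" "T + \<tau> = T'" and c: "0 < c" using T gap by (auto simp: \<tau>_def gap_condition_def)
  have W0: "W 0 \<noteq> 0" using window_transform_0 T by (simp add: W_def)
  have cont: "continuous_on UNIV (q j)" and le: "cmod (q j t) \<le> Q"
    and supp: "t \<notin> {0..T} \<Longrightarrow> q j t = 0" for j t
    using q by (auto simp: biorthogonal_family_def)
  have orth: "exp_transform L (q j) (lam k) = of_bool (j = k)" if "j \<in> F" "k \<in> F" for j k
    using q that by (auto simp: biorthogonal_family_def)
  have Q0: "0 \<le> Q" using le[of 0 0] norm_ge_zero[of "q 0 0"] by linarith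
  obtain d where d: "0 < d" "\<And>y. c * \<tau> \<le> \<bar>y\<bar> \<Longrightarrow> sin y / y \<le> 1 - d"
    using sinc_le[of "c * \<tau>"] c \<tau> by auto
  \<comment> \<open>The factor that subtracting the average puts on the transform at
    \<open>lam k\<close>. Its real part is 1 minus a value of sin y / y, and the gap keeps
    \<open>\<bar>y\<bar>\<close> above \<open>c * \<tau>\<close>, so one \<open>d\<close> bounds all
    these factors from below.\<close>
  define \<kappa> where "\<kappa> = (\<lambda>k. 1 - average_factor \<tau> (\<mu> - lam k))"
  have \<kappa>: "d \<le> cmod (\<kappa> k)" if "k \<in> F" for k
  proof -
    have "c \<le> \<bar>\<mu> - lam k\<bar>" using gap_condition_le(2)[OF gap, of m k] m that by (auto simp: \<mu>_def)
    then have "c * \<tau> \<le> \<bar>(\<mu> - lam k) * \<tau>\<bar>" "\<mu> - lam k \<noteq> 0" using \<tau> c by (auto simp: abs_mult)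
    then have "d \<le> Re (\<kappa> k)" using d(2)[of "(\<mu> - lam k) * \<tau>"] Re_average_factor[OF \<tau>(1)] by (simp add: \<kappa>_def)
    then show ?thesis using complex_Re_le_cmod[of "\<kappa> k"] by linarith
  qed
  have \<kappa>m: "1 - average_factor \<tau> (\<mu> - \<mu>) = 0" using average_factor_0 \<tau> by simp
  define p where "p = (\<lambda>j t. if j \<in> F then (1 / \<kappa> j) * (q j t - average \<tau> \<mu> (q j) t) else 0)"
  have p_cont: "continuous_on UNIV (p j)" for j
    unfolding p_def using continuous_average[where q = "q j" and T = T and \<mu> = \<mu>, OF cont supp \<tau>(1)] cont
    by (cases "j \<in> F") (auto intro!: continuous_on_mult continuous_on_const continuous_on_diff simp del: times_divide_eq_left)
  have p_le: "cmod (p j t) \<le> 2 * Q / d" for j t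
  proof (cases "j \<in> F")
    case True
    have "cmod (q j t - average \<tau> \<mu> (q j) t) \<le> 2 * Q"
      using norm_triangle_ineq4[of "q j t" "average \<tau> \<mu> (q j) t"] le[of j t] norm_average_le[OF cont supp \<tau>(1) le]
      by (smt (verit))
    then have "cmod (q j t - average \<tau> \<mu> (q j) t) / cmod (\<kappa> j) \<le> 2 * Q / d"
      using \<kappa>[OF True] d Q0 by (intro frac_le) auto
    then show ?thesis using True by (simp add: p_def norm_mult norm_divide)
  qed (use Q0 d in \<open>simp add: p_def\<close>)
  have p_supp: "p j t = 0" if "t \<notin> {0..T'}" for j t
    using average_outside[where q = "q j" and T = T and t = t and \<mu> = \<mu>, OF cont supp \<tau>(1)] that \<tau> T supp[of t j] by (auto simp: p_def)
  have p_trans: "exp_transform L (p j) \<xi> = (1 - average_factor \<tau> (\<mu> - \<xi>)) / \<kappa> j * exp_transform L (q j) \<xi>"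
    if "j \<in> F" for j \<xi>
  proof -
    have "exp_transform L (p j) \<xi> = (1 / \<kappa> j) * exp_transform L (\<lambda>t. q j t - average \<tau> \<mu> (q j) t) \<xi>"
      using that by (simp add: p_def exp_transform_cmult[symmetric])
    also have "exp_transform L (\<lambda>t. q j t - average \<tau> \<mu> (q j) t) \<xi> =
        exp_transform L (q j) \<xi> - average_factor \<tau> (\<mu> - \<xi>) * exp_transform L (q j) \<xi>"
      using T \<tau> exp_transform_average[where q = "q j" and T = T and \<mu> = \<mu> and \<xi> = \<xi> and L = L, OF cont supp \<tau>(1)]
        exp_transform_diff[OF cont continuous_average[where q = "q j" and T = T and \<mu> = \<mu>, OF cont supp \<tau>(1)], of L j \<xi>]
      by simp
    finally show ?thesis by (simp add: left_diff_distrib)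
  qed
  have p_orth: "exp_transform L (p j) (lam k) = of_bool (j = k)" if "j \<in> F" "k \<in> F" for j k
    using p_trans[OF that(1), of "lam k"] orth[OF that] \<kappa>[OF that(1)] d by (auto simp: \<kappa>_def)
  have p_m: "exp_transform L (p j) \<mu> = 0" if "j \<in> F" for j
    using p_trans[OF that, of \<mu>] \<kappa>m by simp
  \<comment> \<open>The component of the windowed exponential at the old frequency
    \<open>lam k\<close>. The coefficients decay like \<open>1 / (k - m)\<^sup>2\<close>, so the
    infinitely many corrections sum uniformly in time.\<close>
  define g where "g = (\<lambda>k t. (if k \<in> F then W (lam k - \<mu>) else 0) * p k t)"
  define M where "M = (\<lambda>k. (6 * T ^ 3 / c\<^sup>2 * (2 * Q / d)) * (1 / (real_of_int (k - m))\<^sup>2))"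
  have g_cont: "continuous_on UNIV (g k)" for k unfolding g_def by (intro continuous_intros p_cont)
  have g_le: "cmod (g k t) \<le> M k" for k t
  proof (cases "k \<in> F")
    case True
    then have km: "k \<noteq> m" using m by blast
    then have r: "c * \<bar>real_of_int (k - m)\<bar> \<le> \<bar>lam k - \<mu>\<bar>" "lam k - \<mu> \<noteq> 0"
      using gap_condition_le[OF gap km] c by (auto simp: \<mu>_def)
    have "(c * \<bar>real_of_int (k - m)\<bar>)\<^sup>2 \<le> (lam k - \<mu>)\<^sup>2"
      using power_mono[OF r(1), of 2] c by simp
    then have "6 * T ^ 3 / (lam k - \<mu>)\<^sup>2 \<le> 6 * T ^ 3 / (c * \<bar>real_of_int (k - m)\<bar>)\<^sup>2"
      using T c km r by (intro divide_left_mono) auto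
    then have "cmod (W (lam k - \<mu>)) \<le> 6 * T ^ 3 / c\<^sup>2 * (1 / (real_of_int (k - m))\<^sup>2)"
      using window_transform_le[OF T(1) _ r(2), of L] T by (simp add: W_def power_mult_distrib)
    from mult_mono[OF this p_le[of k t]] show ?thesis
      using True T by (simp add: g_def M_def norm_mult mult_ac)
  qed (use T Q0 d in \<open>simp add: g_def M_def\<close>)
  have M: "M summable_on UNIV"
  proof -
    have "bij (\<lambda>k. k - m)" by (rule bij_betw_byWitness[where f' = "\<lambda>k. k + m"]) auto
    from summable_on_reindex_bij_betw[OF this, of "\<lambda>k. 1 / (real_of_int k)\<^sup>2"]
    show ?thesis unfolding M_def using summable_on_int_inverse_square' by (intro summable_on_cmult_right) simp
  qed
  define S where "S = (\<lambda>t. \<Sum>\<^sub>\<infinity>k. g k t)"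
  have S_trans: "((\<lambda>k. (if k \<in> F then W (lam k - \<mu>) else 0) * exp_transform L (p k) \<xi>) has_sum exp_transform L S \<xi>) UNIV" for \<xi>
    using exp_transform_infsum[OF g_cont g_le M, of L \<xi>] unfolding S_def g_def exp_transform_cmult .
  define r where "r = (\<lambda>t. (1 / W 0) * (modulated_window T \<mu> t - S t))"
  have S_cont: "continuous_on UNIV S" unfolding S_def by (rule continuous_on_infsum[OF g_cont g_le M])
  have r_trans: "exp_transform L r \<xi> = (1 / W 0) * (W (\<xi> - \<mu>) - exp_transform L S \<xi>)" for \<xi>
    unfolding r_def exp_transform_cmult
    by (simp add: exp_transform_diff S_cont continuous_modulated_window exp_transform_modulated_window W_def)
  have r_m: "exp_transform L r \<mu> = 1"
  proof -
    have "exp_transform L S \<mu> = 0"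
      by (rule has_sum_unique[OF S_trans]) (auto simp: p_m intro!: has_sum_0)
    then show ?thesis using W0 by (simp add: r_trans)
  qed
  have r_F: "exp_transform L r (lam l) = 0" if l: "l \<in> F" for l
  proof -
    have "((\<lambda>k. (if k \<in> F then W (lam k - \<mu>) else 0) * exp_transform L (p k) (lam l)) has_sum W (lam l - \<mu>)) UNIV"
      by (rule has_sum_finite_neutralI[of "{l}"]) (use l in \<open>auto simp: p_orth\<close>)
    then have "exp_transform L S (lam l) = W (lam l - \<mu>)" using S_trans has_sum_unique by blast
    then show ?thesis by (simp add: r_trans)
  qed
  define Q' where "Q' = 2 * Q / d + (T ^ 4 + infsum M UNIV) / cmod (W 0)"
  have M0: "0 \<le> infsum M UNIV" using T Q0 d by (intro infsum_nonneg) (simp add: M_def)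
  have "cmod (r t) \<le> (T ^ 4 + infsum M UNIV) / cmod (W 0)" for t
  proof -
    have "cmod (modulated_window T \<mu> t - S t) \<le> T ^ 4 + infsum M UNIV"
      using norm_triangle_ineq4[of "modulated_window T \<mu> t" "S t"] norm_modulated_window_le[OF T(1), of \<mu> t]
        norm_infsum_dominated[OF g_cont g_le M, of t] by (simp add: S_def)
    then show ?thesis by (simp add: r_def norm_mult norm_divide divide_right_mono)
  qed
  then have le': "cmod (if j = m then r t else p j t) \<le> Q'" for j t
    using p_le[of j t] Q0 d T M0 by (smt (verit) Q'_def divide_nonneg_nonneg norm_ge_zero zero_le_power)
  have "S t = 0" if "t \<notin> {0..T'}" for t using that by (simp add: S_def g_def p_supp)
  then have "r t = 0" if "t \<notin> {0..T'}" for t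
    using that modulated_window_outside[OF T(1), of t \<mu>] T by (auto simp: r_def)
  then have "t \<notin> {0..T'} \<longrightarrow> (if j = m then r else p j) t = 0" for j t using p_supp by simp
  moreover have "continuous_on UNIV r"
    unfolding r_def
    by (intro continuous_on_mult continuous_on_const continuous_on_diff S_cont continuous_modulated_window)
  then have "continuous_on UNIV (if j = m then r else p j)" for j using p_cont by simp
  moreover have "cmod ((if j = m then r else p j) t) \<le> Q'" for j t using le'[of j t] by (cases "j = m") simp_all
  moreover have "exp_transform L (if j = m then r else p j) (lam k) = of_bool (j = k)"
    if "j \<in> insert m F" "k \<in> insert m F" for j k
    using that m p_orth r_F r_m p_m by (auto simp: \<mu>_def)
  ultimately have "biorthogonal_family L lam T' (insert m F) (\<lambda>j. if j = m then r else p j) Q'"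
    unfolding biorthogonal_family_def by blast
  then show ?thesis by blast
qed

subsection \<open>Frequencies of large modulus\<close>

text \<open>On windowed exponentials with frequencies in \<open>F\<close> the transforms form the
  matrix \<open>W (lam k - lam i)\<close>, that is \<open>W 0\<close> times the identity minus
  \<open>E\<close>. For large \<open>N\<close> the operator \<open>E\<close> is a contraction, and
  the columns of the inverse matrix are the coefficients of the functions
  \<open>q j\<close>.\<close>

lemma biorthogonal_family_tail:
  assumes gap: "gap_condition lam c" and T: "0 < T" "T \<le> L"
  shows "\<exists>N q Q. biorthogonal_family L lam T {k. int N \<le> \<bar>k\<bar>} q Q"
proof -
  define W where "W = (\<lambda>\<xi>. exp_transform L (\<lambda>t. of_real (window T t)) \<xi>)"
  have c: "0 < c" using gap by (auto simp: gap_condition_def)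
  have W0: "W 0 \<noteq> 0" using window_transform_0 T by (simp add: W_def)
  define K where "K = 6 * T ^ 3 / c\<^sup>2 / cmod (W 0)"
  define \<Sigma> where "\<Sigma> = (\<Sum>\<^sub>\<infinity>k::int. 1 / (real_of_int k)\<^sup>2)"
  have K: "0 \<le> K" and \<Sigma>: "0 \<le> \<Sigma>" using T by (auto simp: K_def \<Sigma>_def infsum_nonneg)
  \<comment> \<open>The norm of \<open>E\<close> is at most \<open>K * \<Sigma> / N\<^sup>2\<close>;
    this choice, together with \<open>N \<le> N\<^sup>2\<close>, makes it at most 1/2.\<close>
  obtain N :: nat where N: "2 * (K * \<Sigma>) \<le> real N" "1 \<le> N"
    using real_arch_simple[of "max 1 (2 * (K * \<Sigma>))"] by auto
  define F where "F = {k. int N \<le> \<bar>k\<bar>}"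
  define E where "E = (\<lambda>k i. if k \<in> F \<and> i \<in> F \<and> k \<noteq> i then - (W (lam k - lam i) / W 0) else 0)"
  have F0: "k \<noteq> 0" if "k \<in> F" for k using that N by (auto simp: F_def)
  have E_le: "cmod (E k i) \<le> K / (real_of_int k)\<^sup>2 * (1 / (real_of_int (k - i))\<^sup>2)" for k i
  proof (cases "k \<in> F \<and> i \<in> F \<and> k \<noteq> i")
    case True
    then have r: "c * (\<bar>real_of_int k\<bar> * \<bar>real_of_int (k - i)\<bar>) \<le> \<bar>lam k - lam i\<bar>" "lam k - lam i \<noteq> 0"
      using gap_condition_le[OF gap, of k i] c by auto
    have "(c * (\<bar>real_of_int k\<bar> * \<bar>real_of_int (k - i)\<bar>))\<^sup>2 \<le> (lam k - lam i)\<^sup>2"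
      using power_mono[OF r(1), of 2] c by simp
    then have "6 * T ^ 3 / (lam k - lam i)\<^sup>2 \<le> 6 * T ^ 3 / (c * (\<bar>real_of_int k\<bar> * \<bar>real_of_int (k - i)\<bar>))\<^sup>2"
      using T c r True F0[of k] by (intro divide_left_mono) auto
    also have "\<dots> = 6 * T ^ 3 / c\<^sup>2 * (1 / (real_of_int k)\<^sup>2 * (1 / (real_of_int (k - i))\<^sup>2))"
      by (simp add: power_mult_distrib)
    finally have "cmod (W (lam k - lam i)) \<le> 6 * T ^ 3 / c\<^sup>2 * (1 / (real_of_int k)\<^sup>2 * (1 / (real_of_int (k - i))\<^sup>2))"
      using window_transform_le[OF T(1,2) r(2)] by (simp add: W_def)
    from divide_right_mono[OF this, of "cmod (W 0)"] show ?thesis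
      using True by (simp add: E_def K_def norm_divide mult_ac)
  qed (use K in \<open>auto simp: E_def\<close>)
  have E_bound: "off_diagonal_bound E (\<lambda>m. K / (real N)\<^sup>2 * (1 / (real_of_int m)\<^sup>2))"
    unfolding off_diagonal_bound_def
  proof (intro conjI allI)
    show "(\<lambda>m. K / (real N)\<^sup>2 * (1 / (real_of_int m)\<^sup>2)) summable_on UNIV"
      by (intro summable_on_cmult_right summable_on_int_inverse_square')
    show "cmod (E k i) \<le> K / (real N)\<^sup>2 * (1 / (real_of_int (k - i))\<^sup>2)" for k i
    proof (cases "k \<in> F")
      case True
      then have "real N \<le> \<bar>real_of_int k\<bar>" by (simp add: F_def)
      then have "(real N)\<^sup>2 \<le> (real_of_int k)\<^sup>2" using power_mono[of "real N" "\<bar>real_of_int k\<bar>" 2] by simp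
      then have "K / (real_of_int k)\<^sup>2 \<le> K / (real N)\<^sup>2"
        using K N F0[OF True] by (intro divide_left_mono) auto
      then show ?thesis
        using E_le[of k i] mult_right_mono[of "K / (real_of_int k)\<^sup>2" _ "1 / (real_of_int (k - i))\<^sup>2"]
        by (meson order_trans zero_le_divide_1_iff zero_le_power2)
    qed (use K in \<open>auto simp: E_def\<close>)
  qed
  have E_half: "norm (mat_ell2 E x) \<le> 1 / 2 * norm x" for x
  proof -
    have "real N \<le> (real N)\<^sup>2" using N by (simp add: self_le_power)
    then have "K * \<Sigma> * 2 \<le> (real N)\<^sup>2" using N(1) by linarith
    moreover have "0 < (real N)\<^sup>2" using N(2) by simp
    ultimately have "K * \<Sigma> / (real N)\<^sup>2 \<le> 1 / 2" by (simp add: pos_divide_le_eq)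
    then have "(\<Sum>\<^sub>\<infinity>m. K / (real N)\<^sup>2 * (1 / (real_of_int m)\<^sup>2)) \<le> 1 / 2"
      unfolding infsum_cmult_right' \<Sigma>_def[symmetric] by simp
    from mult_right_mono[OF this, of "norm x"] norm_mat_ell2_le[OF E_bound, of x]
    show ?thesis by simp
  qed
  have lin: "linear (mat_ell2 E)"
    using bounded_linear_mat_ell2[OF E_bound] by (rule bounded_linear.linear)
  \<comment> \<open>The fixed point solves (I - E) x = e_j / W 0, so it is a column of the inverse
    matrix.\<close>
  have "\<exists>x. single j (1 / W 0) + mat_ell2 E x = x" for j
  proof -
    have "dist (single j (1 / W 0) + mat_ell2 E x) (single j (1 / W 0) + mat_ell2 E y) \<le> 1 / 2 * dist x y" for x y
      using E_half[of "x - y"] by (simp add: dist_norm linear_diff[OF lin])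
    then show ?thesis
      using banach_fix_type[of "1 / 2" "\<lambda>x. single j (1 / W 0) + mat_ell2 E x"] by auto
  qed
  then obtain x where x: "x j = single j (1 / W 0) + mat_ell2 E (x j)" for j by metis
  define R where "R = 1 / cmod (W 0)"
  have x_norm: "norm (x j) \<le> 2 * R" for j
  proof -
    have "norm (x j) \<le> norm (single j (1 / W 0)) + norm (mat_ell2 E (x j))"
      using norm_triangle_ineq x by metis
    then show ?thesis using E_half[of "x j"] by (simp add: norm_single norm_divide R_def)
  qed
  have x_entry: "entry (x j) i = (if i = j then 1 / W 0 else 0) + entry (mat_ell2 E (x j)) i" for i j
    by (subst x) (simp add: entry_single)
  \<comment> \<open>A square-summable coefficient sequence would not make the series of windowed
    exponentials converge uniformly. The fixed point equation improves it: row \<open>i\<close> of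
    \<open>E\<close> carries the factor \<open>K / i\<^sup>2\<close>, so the entries of
    \<open>x j\<close> are absolutely summable with a total that does not depend on
    \<open>j\<close>.\<close>
  define M where "M = (\<lambda>j i. (if i = j then R else 0) + K * \<Sigma> * (2 * R) * (1 / (real_of_int i)\<^sup>2))"
  have x_le: "cmod (entry (x j) i) \<le> M j i" for i j
  proof -
    have "cmod (entry (mat_ell2 E (x j)) i) \<le> K / (real_of_int i)\<^sup>2 * \<Sigma> * (2 * R)"
    proof (rule norm_infsum_le[OF entry_mat_ell2_has_sum[OF E_bound]])
      have "bij (\<lambda>l. i - l)" by (rule bij_betw_byWitness[where f' = "\<lambda>l. i - l"]) auto
      from has_sum_reindex_bij_betw[OF this, of "\<lambda>k. 1 / (real_of_int k)\<^sup>2" \<Sigma>]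
      have "((\<lambda>l. 1 / (real_of_int (i - l))\<^sup>2) has_sum \<Sigma>) UNIV"
        using has_sum_infsum[OF summable_on_int_inverse_square'] by (simp add: \<Sigma>_def)
      then show "((\<lambda>l. K / (real_of_int i)\<^sup>2 * (1 / (real_of_int (i - l))\<^sup>2) * (2 * R)) has_sum K / (real_of_int i)\<^sup>2 * \<Sigma> * (2 * R)) UNIV"
        by (intro has_sum_cmult_left has_sum_cmult_right)
      show "cmod (E i l * entry (x j) l) \<le> K / (real_of_int i)\<^sup>2 * (1 / (real_of_int (i - l))\<^sup>2) * (2 * R)" for l
        unfolding norm_mult using K
        by (intro mult_mono E_le order_trans[OF entry_le_norm x_norm]) auto
    qed
    moreover have "cmod (entry (x j) i) \<le> (if i = j then R else 0) + cmod (entry (mat_ell2 E (x j)) i)"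
      using norm_triangle_ineq[of "if i = j then 1 / W 0 else 0" "entry (mat_ell2 E (x j)) i"]
      unfolding x_entry[of j i] by (simp add: R_def norm_divide split: if_splits)
    ultimately show ?thesis by (simp add: M_def)
  qed
  have M: "(M j has_sum (R + K * \<Sigma> * (2 * R) * \<Sigma>)) UNIV" for j
    unfolding M_def
  proof (intro has_sum_add has_sum_cmult_right)
    show "((\<lambda>i. if i = j then R else 0) has_sum R) UNIV"
      by (rule has_sum_finite_neutralI[of "{j}"]) auto
    show "((\<lambda>i. 1 / (real_of_int i)\<^sup>2) has_sum \<Sigma>) UNIV"
      unfolding \<Sigma>_def by (intro has_sum_infsum summable_on_int_inverse_square')
  qed
  define g where "g = (\<lambda>j i t. entry (x j) i * modulated_window T (lam i) t)"
  have g_cont: "continuous_on UNIV (g j i)" for i j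
    unfolding g_def by (intro continuous_intros continuous_modulated_window)
  have g_le: "cmod (g j i t) \<le> M j i * T ^ 4" for i j t
    unfolding g_def norm_mult using x_le[of j i] norm_modulated_window_le[OF T(1)] order_trans[OF norm_ge_zero x_le]
    by (intro mult_mono) auto
  have gM: "((\<lambda>i. M j i * T ^ 4) has_sum ((R + K * \<Sigma> * (2 * R) * \<Sigma>) * T ^ 4)) UNIV" for j
    by (intro has_sum_cmult_left M)
  define q where "q = (\<lambda>j t. \<Sum>\<^sub>\<infinity>i. g j i t)"
  have q_cont: "continuous_on UNIV (q j)" for j
    unfolding q_def by (rule continuous_on_infsum[OF g_cont g_le has_sum_imp_summable[OF gM]])
  have q_le: "cmod (q j t) \<le> (R + K * \<Sigma> * (2 * R) * \<Sigma>) * T ^ 4" for j t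
    using norm_infsum_dominated[OF g_cont g_le has_sum_imp_summable[OF gM], of j t] infsumI[OF gM, of j]
    by (simp add: q_def)
  have q_supp: "q j t = 0" if "t \<notin> {0..T}" for j t
    using modulated_window_outside[OF T(1) that] by (simp add: q_def g_def)
  have E_out: "entry (mat_ell2 E y) i = 0" if "i \<notin> F" for i y
    by (rule has_sum_unique[OF entry_mat_ell2_has_sum[OF E_bound]]) (use that in \<open>auto simp: E_def intro!: has_sum_0\<close>)
  have q_trans: "exp_transform L (q j) (lam k) = of_bool (j = k)" if jk: "j \<in> F" "k \<in> F" for j k
  proof (rule has_sum_unique)
    show "((\<lambda>i. exp_transform L (g j i) (lam k)) has_sum exp_transform L (q j) (lam k)) UNIV"
      unfolding q_def by (rule exp_transform_infsum[OF g_cont g_le has_sum_imp_summable[OF gM]])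
    \<comment> \<open>Entries of \<open>x j\<close> outside \<open>F\<close> vanish, so only the
      diagonal value \<open>W 0\<close> and the entries of \<open>E\<close> enter.\<close>
    have eq: "exp_transform L (g j i) (lam k) = W 0 * ((if i = k then entry (x j) k else 0) - E k i * entry (x j) i)" for i
    proof -
      have "exp_transform L (g j i) (lam k) = entry (x j) i * W (lam k - lam i)"
        by (simp add: g_def exp_transform_cmult exp_transform_modulated_window W_def)
      moreover have "entry (x j) i = 0" if "i \<notin> F"
        using x_entry[of j i] E_out[OF that] that jk by auto
      ultimately show ?thesis using jk W0 by (auto simp: E_def)
    qed
    have "((\<lambda>i. W 0 * ((if i = k then entry (x j) k else 0) - E k i * entry (x j) i)) has_sum
        W 0 * (entry (x j) k - entry (mat_ell2 E (x j)) k)) UNIV"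
      by (intro has_sum_cmult_right has_sum_minus entry_mat_ell2_has_sum[OF E_bound]
          has_sum_finite_neutralI[of "{k}"]) auto
    moreover have "W 0 * (entry (x j) k - entry (mat_ell2 E (x j)) k) = of_bool (j = k)"
      using x_entry[of j k] W0 by auto
    ultimately show "((\<lambda>i. exp_transform L (g j i) (lam k)) has_sum of_bool (j = k)) UNIV"
      by (simp add: eq)
  qed
  have "biorthogonal_family L lam T F q ((R + K * \<Sigma> * (2 * R) * \<Sigma>) * T ^ 4)"
    unfolding biorthogonal_family_def using q_cont q_le q_supp q_trans by blast
  then show ?thesis unfolding F_def by blast
qed

text \<open>Each insertion needs additional time, but however little: half of the spare time is kept
  for the frequency inserted last, the other half for all the earlier ones.\<close>

lemma biorthogonal_family_finite_union:
  assumes gap: "gap_condition lam c" and q: "biorthogonal_family L lam T F q Q"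
    and S: "finite S" and T: "0 < T" "T < T'" "T' \<le> L"
  shows "\<exists>q' Q'. biorthogonal_family L lam T' (F \<union> S) q' Q'"
  using S T
proof (induction S arbitrary: T' rule: finite_induct)
  case empty
  then have "biorthogonal_family L lam T' F q Q" using q by (auto simp: biorthogonal_family_def)
  then show ?case by auto
next
  case (insert m S)
  have *: "T < (T + T') / 2" "(T + T') / 2 < T'" using insert.prems by auto
  obtain q1 Q1 where q1: "biorthogonal_family L lam ((T + T') / 2) (F \<union> S) q1 Q1"
    using insert.IH[of "(T + T') / 2"] insert.prems * by auto
  show ?case
  proof (cases "m \<in> F")
    case True
    then have "biorthogonal_family L lam T' (F \<union> insert m S) q1 Q1"
      using q1 * unfolding biorthogonal_family_def by (auto simp: insert_absorb)
    then show ?thesis by blast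
  next
    case False
    with insert.hyps biorthogonal_family_insert[OF gap q1, of T' m] insert.prems *
    show ?thesis by auto
  qed
qed

text \<open>Half of the interval is spent on the high frequencies, the rest on the finitely many low
  ones.\<close>

theorem biorthogonal_family_exists:
  assumes gap: "gap_condition lam c" and L: "0 < L"
  shows "\<exists>q Q. biorthogonal_family L lam L UNIV q Q"
proof -
  obtain N q Q where q: "biorthogonal_family L lam (L / 2) {k. int N \<le> \<bar>k\<bar>} q Q"
    using biorthogonal_family_tail[OF gap, of "L / 2" L] L by auto
  have "finite {- int N..int N}" "{k. int N \<le> \<bar>k\<bar>} \<union> {- int N..int N} = UNIV" by auto
  then show ?thesis using biorthogonal_family_finite_union[OF gap q, of "{- int N..int N}" L] L by auto
qed

section \<open>Fourier series of test functions\<close>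

definition tcoef :: "(real \<Rightarrow> complex) \<Rightarrow> int \<Rightarrow> complex" where
  "tcoef f k = integral {0..2 * pi} (\<lambda>x. f x * cis (- (of_int k * x))) / (2 * pi)"

lemma exp_conv_cis: "exp (- (\<i> * of_int k * complex_of_real x)) = cis (- (of_int k * x))"
  by (simp add: cis_conv_exp mult.assoc)

lemma cis_int_periodic: "cis (of_int k * (x + 2 * pi)) = cis (of_int k * x)"
proof -
  have "cis (of_int k * (x + 2 * pi)) = cis (of_int k * x) * cis (2 * pi * of_int k)"
    by (simp add: cis_mult algebra_simps)
  then show ?thesis by (simp add: cis_multiple_2pi)
qed

lemma test_cis: "(\<lambda>x. cis (of_int k * x)) \<in> test_functions"
  using test_exp[of "- k"] unfolding exp_conv_cis by simp

lemma tcoef_integrable: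
  "f \<in> test_functions \<Longrightarrow> (\<lambda>x. f x * cis (- (of_int k * x))) integrable_on {0..2 * pi}"
  by (intro integrable_continuous_interval continuous_intros test_continuous)

lemma tcoef_add:
  "f \<in> test_functions \<Longrightarrow> h \<in> test_functions \<Longrightarrow> tcoef (\<lambda>x. f x + h x) k = tcoef f k + tcoef h k"
  by (simp add: tcoef_def distrib_right integral_add tcoef_integrable add_divide_distrib)

lemma tcoef_cmult: "tcoef (\<lambda>x. c * f x) k = c * tcoef f k"
  by (simp add: tcoef_def mult.assoc)

lemma tcoef_diff_le:
  assumes "f \<in> test_functions" "h \<in> test_functions" "\<And>x. cmod (f x - h x) \<le> e"
  shows "cmod (tcoef f k - tcoef h k) \<le> e"
proof -
  have "tcoef f k - tcoef h k = integral {0..2 * pi} (\<lambda>x. (f x - h x) * cis (- (of_int k * x))) / (2 * pi)"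
    using assms by (simp add: tcoef_def left_diff_distrib integral_diff tcoef_integrable diff_divide_distrib)
  moreover have "cmod (integral {0..2 * pi} (\<lambda>x. (f x - h x) * cis (- (of_int k * x)))) \<le> e * (2 * pi - 0)"
    using assms by (intro integral_bound continuous_intros test_continuous) (auto simp: norm_mult)
  ultimately show ?thesis by (simp add: norm_divide pos_divide_le_eq)
qed

lemma tcoef_zero: "tcoef (\<lambda>_. 0) k = 0"
  by (simp add: tcoef_def)

lemma integral_cis_int: "integral {0..2 * pi} (\<lambda>x. cis (of_int k * x)) = (if k = 0 then 2 * pi else 0)"
proof (cases "k = 0")
  case False
  have "((\<lambda>x. cis (of_int k * x) / (\<i> * of_int k)) has_vector_derivative cis (of_int k * x)) (at x within {0..2 * pi})" for x
    using has_vector_derivative_divide[OF has_vector_derivative_cis[of "of_int k"], of "\<i> * of_int k"] False by simp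
  from fundamental_theorem_of_calculus[OF _ this] show ?thesis
    using cis_int_periodic[of k 0] False by (simp add: integral_unique)
qed (simp add: scaleR_conv_of_real)

lemma tcoef_cis: "tcoef (\<lambda>x. cis (of_int j * x)) k = of_bool (j = k)"
proof -
  have "cis (of_int j * x) * cis (- (of_int k * x)) = cis (of_int (j - k) * x)" for x
    by (simp add: cis_mult algebra_simps)
  then show ?thesis using integral_cis_int[of "j - k"] by (simp add: tcoef_def)
qed

lemma test_has_vector_derivative:
  "f \<in> test_functions \<Longrightarrow> (f has_vector_derivative vderiv f x) (at x within S)"
  unfolding vderiv_def test_functions_def
  by (rule has_vector_derivative_at_within, rule vector_derivative_works[THEN iffD1]) (simp add: smooth_diff_at)

lemma test_periodic: "f \<in> test_functions \<Longrightarrow> f (x + 2 * pi) = f x"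
  by (simp add: test_functions_def)

lemma tcoef_vderiv:
  assumes f: "f \<in> test_functions"
  shows "tcoef (vderiv f) k = \<i> * of_int k * tcoef f k"
proof -
  let ?e = "\<lambda>x. cis (- of_int k * x)"
  have "((\<lambda>x. f x * ?e x) has_vector_derivative (f x * (\<i> * of_real (- of_int k) * ?e x) + vderiv f x * ?e x)) (at x within {0..2 * pi})" for x
    by (intro has_vector_derivative_mult test_has_vector_derivative f has_vector_derivative_cis)
  then have "((\<lambda>x. f x * (\<i> * of_real (- of_int k) * ?e x) + vderiv f x * ?e x) has_integral
      (f (2 * pi) * ?e (2 * pi) - f 0 * ?e 0)) {0..2 * pi}"
    by (intro fundamental_theorem_of_calculus) auto
  moreover have "f (2 * pi) * ?e (2 * pi) = f 0 * ?e 0"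
    using test_periodic[OF f, of 0] cis_int_periodic[of "- k" 0] by simp
  ultimately have 0: "integral {0..2 * pi} (\<lambda>x. - (\<i> * of_int k) * (f x * ?e x) + vderiv f x * ?e x) = 0"
    by (simp add: integral_unique mult_ac)
  have "(\<lambda>x. - (\<i> * of_int k) * (f x * ?e x)) integrable_on {0..2 * pi}" "(\<lambda>x. vderiv f x * ?e x) integrable_on {0..2 * pi}"
    by (intro integrable_continuous_interval continuous_intros test_continuous test_vderiv f)+
  from integral_add[OF this] 0
  have "integral {0..2 * pi} (\<lambda>x. vderiv f x * ?e x) = \<i> * of_int k * integral {0..2 * pi} (\<lambda>x. f x * ?e x)"
    by (simp add: add_eq_0_iff)
  then show ?thesis by (simp add: tcoef_def)
qed

lemma tcoef_vderiv_pow: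
  "f \<in> test_functions \<Longrightarrow> tcoef ((vderiv ^^ n) f) k = (\<i> * of_int k) ^ n * tcoef f k"
  by (induction n) (simp_all add: tcoef_vderiv test_vderiv_pow mult_ac)

lemma weight_mult_le:
  assumes "cmod z \<le> e" "cmod ((\<i> * of_int k) ^ n * z) \<le> e"
  shows "(1 + \<bar>real_of_int k\<bar>) ^ n * cmod z \<le> 2 ^ n * e"
proof -
  have m: "1 + \<bar>real_of_int k\<bar> \<le> 2 * max 1 \<bar>real_of_int k\<bar>" by simp
  have "max 1 \<bar>real_of_int k\<bar> ^ n * cmod z \<le> e"
  proof (cases "\<bar>real_of_int k\<bar> \<le> 1")
    case True
    then have "max 1 \<bar>real_of_int k\<bar> = 1" by simp
    then show ?thesis using assms(1) by simp
  next
    case False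
    then have "max 1 \<bar>real_of_int k\<bar> = \<bar>real_of_int k\<bar>" by simp
    then show ?thesis using assms(2) by (simp add: norm_mult norm_power)
  qed
  then have "(2 * max 1 \<bar>real_of_int k\<bar>) ^ n * cmod z \<le> 2 ^ n * e"
    by (simp add: power_mult_distrib mult.assoc)
  moreover have "(1 + \<bar>real_of_int k\<bar>) ^ n * cmod z \<le> (2 * max 1 \<bar>real_of_int k\<bar>) ^ n * cmod z"
    by (intro mult_right_mono power_mono m) auto
  ultimately show ?thesis by linarith
qed

text \<open>Formulated for a difference because the continuity of the functionals in
  \<open>ex_fourier\<close> needs it in this form; \<open>h = 0\<close> gives the decay of the
  coefficients of one function.\<close>

lemma tcoef_diff_weighted_le:
  assumes "f \<in> test_functions" "h \<in> test_functions" "\<And>x. cmod (f x - h x) \<le> e"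
    "\<And>x. cmod ((vderiv ^^ n) f x - (vderiv ^^ n) h x) \<le> e"
  shows "(1 + \<bar>real_of_int k\<bar>) ^ n * cmod (tcoef f k - tcoef h k) \<le> 2 ^ n * e"
proof (rule weight_mult_le)
  show "cmod (tcoef f k - tcoef h k) \<le> e" using assms by (intro tcoef_diff_le)
  have "cmod (tcoef ((vderiv ^^ n) f) k - tcoef ((vderiv ^^ n) h) k) \<le> e"
    using assms by (intro tcoef_diff_le test_vderiv_pow)
  then show "cmod ((\<i> * of_int k) ^ n * (tcoef f k - tcoef h k)) \<le> e"
    using assms by (simp add: tcoef_vderiv_pow right_diff_distrib)
qed

lemma test_bound: 
  assumes "f \<in> test_functions" obtains C where "\<And>x. cmod (f x) \<le> C"
  using test_bounded[OF assms] by (auto simp: bounded_iff)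

lemma tcoef_decay:
  assumes f: "f \<in> test_functions"
  obtains C where "0 \<le> C" "\<And>k. (1 + \<bar>real_of_int k\<bar>) ^ n * cmod (tcoef f k) \<le> C"
proof -
  obtain A where A: "\<And>x. cmod (f x) \<le> A" using test_bound[OF f] by blast
  obtain B where B: "\<And>x. cmod ((vderiv ^^ n) f x) \<le> B" using test_bound[OF test_vderiv_pow[OF f]] by blast
  have z: "(vderiv ^^ n) (\<lambda>_. 0) = (\<lambda>_. 0)"
    by (induction n) (auto simp: vderiv_def)
  have "(1 + \<bar>real_of_int k\<bar>) ^ n * cmod (tcoef f k) \<le> 2 ^ n * max A B" for k
    using tcoef_diff_weighted_le[OF f test_const[of 0], of "max A B" n k] A B
    by (simp add: z tcoef_zero le_max_iff_disj)
  moreover have "0 \<le> max A B" using order_trans[OF norm_ge_zero A[of 0]] by (simp add: le_max_iff_disj)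
  then have "0 \<le> 2 ^ n * max A B" by simp
  ultimately show ?thesis using that by blast
qed

text \<open>Trades two powers of the weight for the summable factor
  \<open>1 / w\<^sup>2\<close>.\<close>

lemma inverse_power_eq: "0 < (w::real) \<Longrightarrow> (w ^ (n + 2) * z \<le> C) = (w ^ n * z \<le> C * (1 / w\<^sup>2))"
  by (simp add: power_add field_simps power2_eq_square)

lemma tcoef_weighted_summable:
  assumes f: "f \<in> test_functions"
  shows "(\<lambda>k. (1 + \<bar>real_of_int k\<bar>) ^ n * cmod (tcoef f k)) summable_on UNIV"
proof -
  obtain C where C: "0 \<le> C" "\<And>k. (1 + \<bar>real_of_int k\<bar>) ^ (n + 2) * cmod (tcoef f k) \<le> C"
    using tcoef_decay[OF f, of "n + 2"] by blast
  show ?thesis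
  proof (rule summable_on_comparison_test)
    show "(\<lambda>k. C * (1 / (1 + \<bar>real_of_int k\<bar>)\<^sup>2)) summable_on UNIV"
      by (intro summable_on_cmult_right summable_on_int_inverse_square)
    show "(1 + \<bar>real_of_int k\<bar>) ^ n * cmod (tcoef f k) \<le> C * (1 / (1 + \<bar>real_of_int k\<bar>)\<^sup>2)" for k
      using C(2)[of k] by (subst inverse_power_eq[symmetric]) auto
  qed simp
qed

lemma tcoef_summable:
  assumes "f \<in> test_functions" shows "(\<lambda>k. cmod (tcoef f k)) summable_on UNIV"
  using tcoef_weighted_summable[OF assms, of 0] by simp

section \<open>Bessel's inequality and pointwise convergence of Fourier series\<close>

lemma cmod_diff_squared: "(cmod (a - b))\<^sup>2 = (cmod a)\<^sup>2 - 2 * Re (a * cnj b) + (cmod b)\<^sup>2"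
  unfolding cmod_power2 by (simp add: power2_eq_square algebra_simps)

text \<open>The squared distance of the function to its partial sum has a nonnegative integral.
  Continuity on one closed period is all that is assumed, since the application is to a difference
  quotient rather than to a test function.\<close>

lemma bessel:
  fixes \<phi> :: "real \<Rightarrow> complex"
  assumes c: "continuous_on {0..2 * pi} \<phi>" and A: "finite A"
  shows "2 * pi * (\<Sum>k\<in>A. (cmod (tcoef \<phi> k))\<^sup>2) \<le> integral {0..2 * pi} (\<lambda>x. (cmod (\<phi> x))\<^sup>2)"
proof -
  let ?e = "\<lambda>k x. cis (of_int k * x)"
  let ?S = "\<lambda>x. \<Sum>k\<in>A. tcoef \<phi> k * ?e k x"
  have i\<phi>: "((\<lambda>x. \<phi> x * cis (- (of_int k * x))) has_integral (2 * pi * tcoef \<phi> k)) {0..2 * pi}" for k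
    unfolding tcoef_def by (intro has_integral_eq_rhs[OF integrable_integral] integrable_continuous_interval continuous_intros c) auto
  have 1: "((\<lambda>x. cnj (tcoef \<phi> k) * (\<phi> x * cis (- (of_int k * x)))) has_integral cnj (tcoef \<phi> k) * (2 * pi * tcoef \<phi> k)) {0..2 * pi}" for k
    by (intro has_integral_mult_right i\<phi>)
  have "((\<lambda>x. \<Sum>k\<in>A. cnj (tcoef \<phi> k) * (\<phi> x * cis (- (of_int k * x)))) has_integral (\<Sum>k\<in>A. cnj (tcoef \<phi> k) * (2 * pi * tcoef \<phi> k))) {0..2 * pi}"
    using A by (intro has_integral_sum 1) auto
  then have I1: "((\<lambda>x. \<phi> x * cnj (?S x)) has_integral (2 * pi * (\<Sum>k\<in>A. (cmod (tcoef \<phi> k))\<^sup>2))) {0..2 * pi}"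
    by (rule has_integral_eq_rhs[OF has_integral_eq, rotated])
       (simp_all add: sum_distrib_left cis_cnj mult_ac complex_norm_square[unfolded of_real_power])
  have orth: "((\<lambda>x. (tcoef \<phi> k * cnj (tcoef \<phi> l)) * cis (of_int (k - l) * x)) has_integral
      (tcoef \<phi> k * cnj (tcoef \<phi> l)) * (if k - l = 0 then 2 * pi else 0)) {0..2 * pi}" for k l
    unfolding integral_cis_int[symmetric]
    by (intro has_integral_mult_right integrable_integral integrable_continuous_interval continuous_intros)
  have "((\<lambda>x. \<Sum>k\<in>A. \<Sum>l\<in>A. (tcoef \<phi> k * cnj (tcoef \<phi> l)) * cis (of_int (k - l) * x)) has_integral
      (\<Sum>k\<in>A. \<Sum>l\<in>A. (tcoef \<phi> k * cnj (tcoef \<phi> l)) * (if k - l = 0 then 2 * pi else 0))) {0..2 * pi}"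
    using A by (intro has_integral_sum orth) auto
  moreover have "(\<Sum>k\<in>A. \<Sum>l\<in>A. (tcoef \<phi> k * cnj (tcoef \<phi> l)) * cis (of_int (k - l) * x)) = ?S x * cnj (?S x)" for x
  proof -
    have "cis (of_int (k - l) * x) = cis (of_int k * x) * cis (- (of_int l * x))" for k l
      by (simp add: cis_mult algebra_simps)
    then show ?thesis by (simp only: sum_product cnj_sum complex_cnj_mult cis_cnj mult_ac)
  qed
  moreover have "(\<Sum>k\<in>A. \<Sum>l\<in>A. (tcoef \<phi> k * cnj (tcoef \<phi> l)) * (if k - l = 0 then 2 * pi else 0))
      = complex_of_real (2 * pi * (\<Sum>k\<in>A. (cmod (tcoef \<phi> k))\<^sup>2))"
    using A by (simp add: if_distrib sum.delta sum_distrib_left mult_ac complex_norm_square[unfolded of_real_power] cong: if_cong)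
  ultimately have I2: "((\<lambda>x. ?S x * cnj (?S x)) has_integral complex_of_real (2 * pi * (\<Sum>k\<in>A. (cmod (tcoef \<phi> k))\<^sup>2))) {0..2 * pi}"
    by simp
  have I3: "((\<lambda>x. (cmod (\<phi> x))\<^sup>2) has_integral integral {0..2 * pi} (\<lambda>x. (cmod (\<phi> x))\<^sup>2)) {0..2 * pi}"
    by (intro integrable_integral integrable_continuous_interval continuous_intros c)
  have I1': "((\<lambda>x. Re (\<phi> x * cnj (?S x))) has_integral (2 * pi * (\<Sum>k\<in>A. (cmod (tcoef \<phi> k))\<^sup>2))) {0..2 * pi}"
    using has_integral_Re[OF I1] by simp
  have I2': "((\<lambda>x. (cmod (?S x))\<^sup>2) has_integral (2 * pi * (\<Sum>k\<in>A. (cmod (tcoef \<phi> k))\<^sup>2))) {0..2 * pi}"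
    using has_integral_Re[OF I2] by (simp only: complex_norm_square[symmetric] Re_complex_of_real)
  have "((\<lambda>x. (cmod (\<phi> x))\<^sup>2 - 2 * Re (\<phi> x * cnj (?S x)) + (cmod (?S x))\<^sup>2) has_integral
      (integral {0..2 * pi} (\<lambda>x. (cmod (\<phi> x))\<^sup>2) - 2 * (2 * pi * (\<Sum>k\<in>A. (cmod (tcoef \<phi> k))\<^sup>2))
        + 2 * pi * (\<Sum>k\<in>A. (cmod (tcoef \<phi> k))\<^sup>2))) {0..2 * pi}"
    by (intro has_integral_add has_integral_diff has_integral_mult_right I1' I2' I3)
  moreover have "0 \<le> (cmod (\<phi> x))\<^sup>2 - 2 * Re (\<phi> x * cnj (?S x)) + (cmod (?S x))\<^sup>2" for x
    unfolding cmod_diff_squared[symmetric] by simp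
  ultimately have "0 \<le> integral {0..2 * pi} (\<lambda>x. (cmod (\<phi> x))\<^sup>2)
      - 2 * (2 * pi * (\<Sum>k\<in>A. (cmod (tcoef \<phi> k))\<^sup>2)) + 2 * pi * (\<Sum>k\<in>A. (cmod (tcoef \<phi> k))\<^sup>2)"
    by (rule has_integral_nonneg)
  then show ?thesis by simp
qed

lemma filterlim_int_intervals: "filterlim (\<lambda>n. {- int n..int n}) (finite_subsets_at_top UNIV) sequentially"
  unfolding filterlim_iff eventually_finite_subsets_at_top
proof (intro allI impI, elim exE conjE)
  fix P and X :: "int set" assume X: "finite X" "\<forall>Y. finite Y \<and> X \<subseteq> Y \<and> Y \<subseteq> UNIV \<longrightarrow> P Y"
  obtain N where N: "\<And>x. x \<in> X \<Longrightarrow> \<bar>x\<bar> \<le> N"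
    using bounded_iff[of "real_of_int ` X"] finite_imp_bounded[of "real_of_int ` X"] X(1)
    by (metis (mono_tags) Max_ge abs_ge_self dual_order.trans finite_imageI image_eqI)
  have "P {- int n..int n}" if "nat N \<le> n" for n
  proof -
    have "X \<subseteq> {- int n..int n}" using N that by fastforce
    then show ?thesis using X(2) by blast
  qed
  then show "\<forall>\<^sub>F n in sequentially. P {- int n..int n}" by (auto simp: eventually_sequentially)
qed

lemma has_sum_int_LIMSEQ:
  fixes f :: "int \<Rightarrow> 'a::{topological_space, comm_monoid_add}"
  shows "(f has_sum a) UNIV \<Longrightarrow> (\<lambda>n. \<Sum>k\<in>{- int n..int n}. f k) \<longlonglongrightarrow> a"
  unfolding has_sum_def by (rule filterlim_compose[OF _ filterlim_int_intervals])


text \<open>A form of the Riemann-Lebesgue lemma: by Bessel the coefficients are square summable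
  along any injective enumeration of frequencies. The telescoping sum below needs it at both
  ends.\<close>

lemma tcoef_tendsto_0:
  fixes \<phi> :: "real \<Rightarrow> complex" and g :: "nat \<Rightarrow> int"
  assumes c: "continuous_on {0..2 * pi} \<phi>" and g: "inj g"
  shows "(\<lambda>n. tcoef \<phi> (g n)) \<longlonglongrightarrow> 0"
proof -
  let ?B = "integral {0..2 * pi} (\<lambda>x. (cmod (\<phi> x))\<^sup>2) / (2 * pi)"
  have "(\<lambda>k. (cmod (tcoef \<phi> k))\<^sup>2) summable_on UNIV"
  proof (rule nonneg_bdd_above_summable_on)
    show "bdd_above (sum (\<lambda>k. (cmod (tcoef \<phi> k))\<^sup>2) ` {F. F \<subseteq> UNIV \<and> finite F})"
      using bessel[OF c] by (intro bdd_aboveI[where M = ?B]) (auto simp: pos_le_divide_eq mult.commute)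
  qed simp
  then have "(\<lambda>k. (cmod (tcoef \<phi> k))\<^sup>2) summable_on range g"
    by (rule summable_on_subset_banach) simp
  then have "(\<lambda>n. (cmod (tcoef \<phi> (g n)))\<^sup>2) summable_on UNIV"
    using g by (simp add: summable_on_reindex comp_def)
  then have "(\<lambda>n. (cmod (tcoef \<phi> (g n)))\<^sup>2) \<longlonglongrightarrow> 0"
    by (intro summable_LIMSEQ_zero summable_on_imp_summable)
  from tendsto_real_sqrt[OF this] show ?thesis by (simp add: tendsto_norm_zero_iff)
qed

lemma cis_diff_eq_1_imp:
  assumes "x \<in> {0..2 * pi}" "y \<in> {0<..<2 * pi}" "cis (x - y) = 1" shows "x = y"
proof -
  have "cos (x - y) = 1" using assms(3) by (metis cis.simps(1) one_complex.simps(1))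
  then obtain n :: int where n: "x - y = of_int n * 2 * pi" using cos_one_2pi_int by blast
  have "\<bar>x - y\<bar> < 2 * pi" using assms by auto
  then have "\<bar>of_int n\<bar> * (2 * pi) < 1 * (2 * pi)" using n by (simp add: abs_mult)
  then have "\<bar>real_of_int n\<bar> < 1" by (rule mult_right_less_imp_less) simp
  then have "n = 0" by linarith
  then show ?thesis using n by simp
qed

lemma tendsto_difference_quotient:
  fixes f :: "real \<Rightarrow> complex"
  assumes "(f has_vector_derivative D) (at y within S)"
  shows "((\<lambda>x. (f x - f y) / of_real (x - y)) \<longlongrightarrow> D) (at y within S)"
proof -
  have "((\<lambda>x. (1 / norm (x - y)) *\<^sub>R (f x - (f y + (x - y) *\<^sub>R D))) \<longlongrightarrow> 0) (at y within S)"
    using assms by (simp add: has_vector_derivative_def has_derivative_within)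
  then have "((\<lambda>x. (f x - f y) / of_real (x - y) - D) \<longlongrightarrow> 0) (at y within S)"
  proof (rule tendsto_0_le[where K = 1])
    show "\<forall>\<^sub>F x in at y within S. norm ((f x - f y) / of_real (x - y) - D)
        \<le> norm ((1 / norm (x - y)) *\<^sub>R (f x - (f y + (x - y) *\<^sub>R D))) * 1"
      unfolding eventually_at_filter
    proof (intro always_eventually allI impI)
      fix x assume "x \<noteq> y"
      then have "(f x - f y) / of_real (x - y) - D = (f x - (f y + (x - y) *\<^sub>R D)) / of_real (x - y)"
        by (simp add: scaleR_conv_of_real field_simps)
      then show "norm ((f x - f y) / of_real (x - y) - D)
        \<le> norm ((1 / norm (x - y)) *\<^sub>R (f x - (f y + (x - y) *\<^sub>R D))) * 1"
        by (simp add: norm_divide flip: of_real_diff)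
    qed
  qed
  then show ?thesis by (rule LIM_zero_cancel)
qed

text \<open>Chernoff's argument: dividing \<open>f - f y\<close> by \<open>cis (x - y) - 1\<close> makes the Fourier series at \<open>y\<close> telescope.\<close>

lemma fourier_series_inside:
  assumes f: "f \<in> test_functions" and y: "y \<in> {0<..<2 * pi}"
  shows "(\<lambda>n. \<Sum>k\<in>{- int n..int n}. tcoef f k * cis (of_int k * y)) \<longlonglongrightarrow> f y"
proof -
  let ?d = "\<lambda>x. cis (x - y) - 1"
  \<comment> \<open>The value at \<open>y\<close> is the limit of the quotient, as
    \<open>cis (x - y)\<close> has derivative \<i> there. Since \<open>y\<close> is an interior
    point, the denominator has no other zero on the closed interval.\<close>
  define \<phi> where "\<phi> = (\<lambda>x. if x = y then vderiv f y / \<i> else (f x - f y) / ?d x)"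
  have cont_f: "continuous_on S f" for S using test_continuous[OF f] .
  have d0: "?d x \<noteq> 0" if "x \<in> {0..2 * pi}" "x \<noteq> y" for x
    using cis_diff_eq_1_imp[OF that(1) y] that(2) by auto
  have "continuous (at x within {0..2 * pi}) \<phi>" if x: "x \<in> {0..2 * pi}" for x
  proof (cases "x = y")
    case True
    have "((\<lambda>x. cis (x - y)) has_vector_derivative \<i>) (at y within {0..2 * pi})"
      using has_vector_derivative_mult_right[OF has_vector_derivative_cis[of 1 y "{0..2 * pi}"], of "cis (- y)"]
      by (simp add: cis_mult mult.left_commute[of "cis (- y)"])
    from tendsto_divide[OF tendsto_difference_quotient[OF test_has_vector_derivative[OF f]] tendsto_difference_quotient[OF this]]
    have "((\<lambda>x. ((f x - f y) / of_real (x - y)) / ((cis (x - y) - cis (y - y)) / of_real (x - y))) \<longlongrightarrow> \<phi> y)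
        (at y within {0..2 * pi})" by (simp add: \<phi>_def)
    then have "(\<phi> \<longlongrightarrow> \<phi> y) (at y within {0..2 * pi})"
    proof (rule Lim_transform_eventually)
      show "\<forall>\<^sub>F x in at y within {0..2 * pi}. ((f x - f y) / of_real (x - y)) / ((cis (x - y) - cis (y - y)) / of_real (x - y)) = \<phi> x"
        unfolding eventually_at_filter by (intro always_eventually) (auto simp: \<phi>_def simp flip: of_real_diff)
    qed
    then show ?thesis using True by (simp add: continuous_within)
  next
    case False
    have "continuous_on {0..2 * pi} (\<lambda>x. f x - f y)" "continuous_on {0..2 * pi} ?d"
      by (intro continuous_intros cont_f)+
    then have "continuous (at x within {0..2 * pi}) (\<lambda>x. (f x - f y) / ?d x)"
      using x d0[OF x False] by (intro continuous_at_within_divide) (auto simp: continuous_on_eq_continuous_within)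
    then show ?thesis
      by (rule continuous_transform_within[where \<delta> = "\<bar>x - y\<bar>"])
        (use False x in \<open>auto simp: \<phi>_def dist_real_def\<close>)
  qed
  then have cont: "continuous_on {0..2 * pi} \<phi>" by (simp add: continuous_on_eq_continuous_within)
  have prod: "f x - f y = \<phi> x * ?d x" if "x \<in> {0..2 * pi}" for x
    using d0[OF that] by (cases "x = y") (auto simp: \<phi>_def)
  have i\<phi>: "(\<lambda>x. \<phi> x * cis (- (of_int k * x))) integrable_on {0..2 * pi}" for k
    by (intro integrable_continuous_interval continuous_intros cont)
  have coef: "tcoef f k - f y * of_bool (k = 0) = cis (- y) * tcoef \<phi> (k - 1) - tcoef \<phi> k" for k
  proof -
    have "tcoef (\<lambda>x. f x + (- f y) * cis (of_int 0 * x)) k = tcoef f k + (- f y) * of_bool (0 = k)"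
      by (subst tcoef_add[OF f test_cmult[OF test_cis]]) (simp only: tcoef_cmult tcoef_cis)
    then have "tcoef f k - f y * of_bool (k = 0) = tcoef (\<lambda>x. f x - f y) k" by (simp split: if_splits)
    also have "\<dots> = integral {0..2 * pi} (\<lambda>x. cis (- y) * (\<phi> x * cis (- (of_int (k - 1) * x))) - \<phi> x * cis (- (of_int k * x))) / (2 * pi)"
    proof -
      have "(f x - f y) * cis (- (of_int k * x)) = cis (- y) * (\<phi> x * cis (- (of_int (k - 1) * x))) - \<phi> x * cis (- (of_int k * x))"
        if "x \<in> {0..2 * pi}" for x
      proof -
        have "cis (- y) * cis (- (of_int (k - 1) * x)) = cis (x - y) * cis (- (of_int k * x))"
          by (simp add: cis_mult algebra_simps)
        then show ?thesis unfolding prod[OF that] by (simp add: algebra_simps)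
      qed
      then have "integral {0..2 * pi} (\<lambda>x. (f x - f y) * cis (- (of_int k * x))) =
          integral {0..2 * pi} (\<lambda>x. cis (- y) * (\<phi> x * cis (- (of_int (k - 1) * x))) - \<phi> x * cis (- (of_int k * x)))"
        by (rule integral_cong)
      then show ?thesis by (simp only: tcoef_def)
    qed
    also have "\<dots> = cis (- y) * tcoef \<phi> (k - 1) - tcoef \<phi> k"
      using integral_diff[OF integrable_on_mult_right[OF i\<phi>[of "k - 1"], of "cis (- y)"] i\<phi>[of k]]
      by (simp add: tcoef_def diff_divide_distrib)
    finally show ?thesis .
  qed
  \<comment> \<open>Multiplication by \<open>cis (of_int k * y)\<close> absorbs the factor
    \<open>cis (- y)\<close> of the shifted coefficient and leaves a pure difference.\<close>
  define a where "a = (\<lambda>k. cis (of_int k * y) * tcoef \<phi> k)"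
  have step: "tcoef f k * cis (of_int k * y) - f y * of_bool (k = 0) = a (k - 1) - a k" for k
  proof -
    have "cis (of_int k * y) * cis (- y) = cis (of_int (k - 1) * y)" by (simp add: cis_mult algebra_simps)
    then have "cis (of_int k * y) * (tcoef f k - f y * of_bool (k = 0)) = a (k - 1) - a k"
      unfolding coef by (simp add: a_def algebra_simps)
    then show ?thesis by (cases "k = 0") (auto simp: algebra_simps)
  qed
  have tele: "(\<Sum>k\<in>{- int n..int n}. a (k - 1) - a k) = a (- int n - 1) - a (int n)" for n
  proof (induction n)
    case (Suc n)
    have "{- int (Suc n)..int (Suc n)} = insert (- int n - 1) (insert (int n + 1) {- int n..int n})" by auto
    then show ?case using Suc.IH by (simp add: add.commute[of 1])
  qed simp
  have "(\<Sum>k\<in>{- int n..int n}. tcoef f k * cis (of_int k * y)) = f y + (a (- int n - 1) - a (int n))" for n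
  proof -
    have "(\<Sum>k\<in>{- int n..int n}. tcoef f k * cis (of_int k * y) - f y * of_bool (k = 0)) = a (- int n - 1) - a (int n)"
      unfolding step by (rule tele)
    moreover have "(\<Sum>k\<in>{- int n..int n}. f y * of_bool (k = 0)) = f y"
      by (simp add: sum.delta if_distrib of_bool_def cong: if_cong)
    ultimately show ?thesis by (simp add: sum_subtractf algebra_simps)
  qed
  moreover have "(\<lambda>n. f y + (a (- int n - 1) - a (int n))) \<longlonglongrightarrow> f y + (0 - 0)"
  proof -
    have lim: "(\<lambda>n. a (g n)) \<longlonglongrightarrow> 0" if "inj g" for g :: "nat \<Rightarrow> int"
      using tcoef_tendsto_0[OF cont that] unfolding a_def
      by (rule tendsto_0_le[where K = 1]) (simp add: norm_mult)
    show ?thesis using lim[of "\<lambda>n. - int n - 1"] lim[of int] by (intro tendsto_intros) (auto simp: inj_def)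
  qed
  ultimately show ?thesis by simp
qed

lemma periodic_int:
  fixes h :: "real \<Rightarrow> 'a"
  assumes "\<And>x. h (x + p) = h x" shows "h (x + of_int n * p) = h x"
proof -
  have nat: "h (x + real n * p) = h x" for x n
  proof (induction n)
    case (Suc n)
    have "x + real (Suc n) * p = (x + real n * p) + p" by (simp add: algebra_simps)
    then show ?case using Suc assms by metis
  qed simp
  show ?thesis
  proof (cases n rule: int_cases2)
    case (nonneg m)
    then show ?thesis using nat by simp
  next
    case (nonpos m)
    then show ?thesis using nat[of "x - real m * p" m] by simp
  qed
qed

lemma tcoef_cis_summable:
  assumes "f \<in> test_functions" shows "(\<lambda>k. tcoef f k * cis (of_int k * x)) summable_on UNIV"
  by (rule summable_on_dominated[OF _ _ tcoef_summable[OF assms], of "\<lambda>k x. tcoef f k * cis (of_int k * x)"])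
     (auto simp: norm_mult intro!: continuous_intros)

text \<open>Absolute summability makes the sum of the series continuous, and its symmetric partial
  sums identify it inside the period. The closure adds the end points and periodicity the rest of
  the line.\<close>

theorem fourier_series:
  assumes f: "f \<in> test_functions"
  shows "((\<lambda>k. tcoef f k * cis (of_int k * x)) has_sum f x) UNIV"
proof -
  define F where "F = (\<lambda>x. \<Sum>\<^sub>\<infinity>k. tcoef f k * cis (of_int k * x))"
  have hs: "((\<lambda>k. tcoef f k * cis (of_int k * x)) has_sum F x) UNIV" for x
    unfolding F_def by (intro has_sum_infsum tcoef_cis_summable f)
  have cont: "continuous_on UNIV F"
    unfolding F_def
    by (rule continuous_on_infsum[OF _ _ tcoef_summable[OF f]]) (auto simp: norm_mult intro!: continuous_intros)
  have "F y = f y" if "y \<in> {0<..<2 * pi}" for y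
    using LIMSEQ_unique[OF has_sum_int_LIMSEQ[OF hs] fourier_series_inside[OF f that]] .
  then have "{0<..<2 * pi} \<subseteq> {x. F x = f x}" by auto
  moreover have "closed {x. F x = f x}" by (intro closed_Collect_eq cont test_continuous f)
  ultimately have "closure {0<..<2 * pi} \<subseteq> {x. F x = f x}" by (rule closure_minimal)
  then have eq: "F x = f x" if "x \<in> {0..2 * pi}" for x using that by auto
  define n where "n = \<lfloor>x / (2 * pi)\<rfloor>"
  have "of_int n \<le> x / (2 * pi)" "x / (2 * pi) < of_int n + 1" unfolding n_def by linarith+
  then have "x + of_int (- n) * (2 * pi) \<in> {0..2 * pi}" by (auto simp: field_simps)
  from eq[OF this] have "F (x + of_int (- n) * (2 * pi)) = f (x + of_int (- n) * (2 * pi))" .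
  moreover have "F (x + of_int (- n) * (2 * pi)) = F x"
    by (rule periodic_int) (simp only: F_def cis_int_periodic)
  moreover have "f (x + of_int (- n) * (2 * pi)) = f x"
    by (rule periodic_int) (rule test_periodic[OF f])
  ultimately show ?thesis using hs[of x] by simp
qed

section \<open>Convergence in the space of test functions, and distributions with given Fourier
  coefficients\<close>

definition fourier_sum :: "(real \<Rightarrow> complex) \<Rightarrow> nat \<Rightarrow> real \<Rightarrow> complex" where
  "fourier_sum f n x = (\<Sum>k\<in>{- int n..int n}. tcoef f k * cis (of_int k * x))"

lemma test_sum:
  "finite A \<Longrightarrow> (\<And>k. k \<in> A \<Longrightarrow> F k \<in> test_functions) \<Longrightarrow> (\<lambda>x. \<Sum>k\<in>A. F k x) \<in> test_functions"
  by (induction A rule: finite_induct) (auto simp: test_const intro!: test_add)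

lemma test_fourier_sum: "fourier_sum f n \<in> test_functions"
  unfolding fourier_sum_def[abs_def] by (intro test_sum test_cmult test_cis) auto

lemma vderiv_fourier_sum:
  assumes f: "f \<in> test_functions" shows "vderiv (fourier_sum f n) = fourier_sum (vderiv f) n"
proof
  fix x
  have "((\<lambda>x. \<Sum>k\<in>{- int n..int n}. tcoef f k * cis (of_int k * x)) has_vector_derivative
      (\<Sum>k\<in>{- int n..int n}. tcoef f k * (\<i> * of_real (of_int k) * cis (of_int k * x)))) (at x)"
    by (intro has_vector_derivative_sum has_vector_derivative_mult_right has_vector_derivative_cis)
  then show "vderiv (fourier_sum f n) x = fourier_sum (vderiv f) n x"
    by (simp add: vderiv_def fourier_sum_def[abs_def] vector_derivative_at tcoef_vderiv[OF f, unfolded vderiv_def] mult_ac)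
qed

lemma vderiv_pow_fourier_sum:
  "f \<in> test_functions \<Longrightarrow> (vderiv ^^ m) (fourier_sum f n) = fourier_sum ((vderiv ^^ m) f) n"
  by (induction m) (simp_all add: vderiv_fourier_sum test_vderiv_pow)

lemma uniform_limit_fourier_sum:
  assumes f: "f \<in> test_functions" shows "uniform_limit UNIV (fourier_sum f) f sequentially"
proof -
  have "uniform_limit UNIV (\<lambda>A x. \<Sum>k\<in>A. tcoef f k * cis (of_int k * x)) f (finite_subsets_at_top UNIV)"
    by (rule Weierstrass_m_test_general'[OF _ fourier_series[OF f] tcoef_summable[OF f]]) (simp add: norm_mult)
  from filterlim_compose[OF this filterlim_int_intervals] show ?thesis
    by (simp add: fourier_sum_def[abs_def])
qed

text \<open>Differentiation commutes with forming partial sums, so every derivative is again a case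
  of uniform convergence. This is what allows a distribution to be evaluated term by term.\<close>

lemma test_tendsto_fourier_sum:
  "f \<in> test_functions \<Longrightarrow> test_tendsto (fourier_sum f) f"
  by (simp add: test_tendsto_def vderiv_pow_fourier_sum uniform_limit_fourier_sum test_vderiv_pow)

lemma pairing_add: "f \<in> test_functions \<Longrightarrow> h \<in> test_functions \<Longrightarrow> pairing v (\<lambda>x. f x + h x) = pairing v f + pairing v h"
  using pairing[of v] by (simp add: is_pdist_def)

lemma pairing_cmult: "f \<in> test_functions \<Longrightarrow> pairing v (\<lambda>x. c * f x) = c * pairing v f"
  using pairing[of v] by (simp add: is_pdist_def)

lemma pairing_outside: "f \<notin> test_functions \<Longrightarrow> pairing v f = 0"
  using pairing[of v] by (simp add: is_pdist_def)

lemma pairing_tendsto: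
  "(\<And>j. F j \<in> test_functions) \<Longrightarrow> f \<in> test_functions \<Longrightarrow> test_tendsto F f \<Longrightarrow> (\<lambda>j. pairing v (F j)) \<longlonglongrightarrow> pairing v f"
  using pairing[of v] by (simp add: is_pdist_def)

lemma pairing_sum:
  "finite A \<Longrightarrow> (\<And>k. k \<in> A \<Longrightarrow> F k \<in> test_functions) \<Longrightarrow> pairing v (\<lambda>x. \<Sum>k\<in>A. F k x) = (\<Sum>k\<in>A. pairing v (F k))"
proof (induction A rule: finite_induct)
  case empty
  show ?case using pairing_cmult[OF test_const[of 0], of v 0] by simp
next
  case (insert k A)
  then show ?case by (simp add: pairing_add test_sum)
qed

lemma pairing_cis: "pairing v (\<lambda>x. cis (of_int k * x)) = 2 * pi * fourier v (- k)"
  by (simp add: fourier_def exp_conv_cis[of "- k", simplified])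

text \<open>The pairing is bilinear, so the exponential of frequency \<open>k\<close> reads off the
  coefficient at \<open>- k\<close>.\<close>

theorem pairing_fourier_series:
  assumes f: "f \<in> test_functions"
  shows "(\<lambda>n. \<Sum>k\<in>{- int n..int n}. 2 * pi * tcoef f k * fourier v (- k)) \<longlonglongrightarrow> pairing v f"
proof -
  have eq: "pairing v (\<lambda>x. tcoef f k * cis (of_int k * x)) = 2 * pi * tcoef f k * fourier v (- k)" for k
    by (simp only: pairing_cmult[OF test_cis] pairing_cis) (simp add: mult_ac)
  have "pairing v (fourier_sum f n) = (\<Sum>k\<in>{- int n..int n}. 2 * pi * tcoef f k * fourier v (- k))" for n
    unfolding fourier_sum_def[abs_def]
    by (subst pairing_sum) (simp_all only: eq test_cmult test_cis finite_atLeastAtMost_int)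
  then show ?thesis
    using pairing_tendsto[OF test_fourier_sum f test_tendsto_fourier_sum[OF f], of v] by simp
qed

theorem fourier_inject: "(\<And>k. fourier v k = fourier w k) \<Longrightarrow> v = w"
proof -
  assume eq: "\<And>k. fourier v k = fourier w k"
  have "pairing v f = pairing w f" for f
  proof (cases "f \<in> test_functions")
    case True
    show ?thesis
      using LIMSEQ_unique[OF pairing_fourier_series[OF True, of v, unfolded eq] pairing_fourier_series[OF True, of w]] .
  qed (simp add: pairing_outside)
  then show ?thesis by (simp add: pairing_inject[symmetric] ext)
qed

text \<open>The functional is forced by the expansion of the pairing: sum the coefficients of the
  test function against \<open>2 * pi * c (- k)\<close>. Polynomial growth of \<open>c\<close> is
  absorbed by the rapid decay of the coefficients.\<close>

theorem ex_fourier: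
  assumes c: "\<And>k. cmod (c k) \<le> C * (1 + \<bar>real_of_int k\<bar>) ^ m"
  shows "\<exists>v. fourier v = c"
proof -
  let ?w = "\<lambda>k::int. 1 + \<bar>real_of_int k\<bar>"
  define b where "b = (\<lambda>k. 2 * pi * c (- k))"
  have b_le: "cmod (z * b k) \<le> 2 * pi * C * (?w k ^ m * cmod z)" for k z
    using mult_left_mono[OF c[of "- k"], of "cmod z * (2 * pi)"]
    by (simp add: b_def norm_mult mult_ac)
  have C0: "0 \<le> C" using order_trans[OF norm_ge_zero c[of 0]] by simp
  have summ: "(\<lambda>k. tcoef f k * b k) summable_on UNIV" if "f \<in> test_functions" for f
  proof (rule abs_summable_summable)
    show "(\<lambda>k. norm (tcoef f k * b k)) summable_on UNIV"
      by (rule summable_on_comparison_test[OF summable_on_cmult_right[OF tcoef_weighted_summable[OF that, of m], of "2 * pi * C"]])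
         (use b_le in auto)
  qed
  define v where "v = (\<lambda>f. if f \<in> test_functions then \<Sum>\<^sub>\<infinity>k. tcoef f k * b k else 0)"
  have add: "v (\<lambda>x. f x + h x) = v f + v h" if "f \<in> test_functions" "h \<in> test_functions" for f h
    using that by (simp add: v_def test_add tcoef_add distrib_right infsum_add summ)
  have cmult: "v (\<lambda>x. z * f x) = z * v f" if "f \<in> test_functions" for z f
    using that by (simp add: v_def test_cmult tcoef_cmult mult.assoc infsum_cmult_right')
  have lim: "(\<lambda>j. v (F j)) \<longlonglongrightarrow> v f"
    if F: "\<And>j. F j \<in> test_functions" "f \<in> test_functions" "test_tendsto F f" for F f
  proof (rule tendstoI)
    fix e :: real assume e: "0 < e"
    define \<Sigma> where "\<Sigma> = (\<Sum>\<^sub>\<infinity>k::int. 1 / (?w k)\<^sup>2)"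
    have \<Sigma>: "0 \<le> \<Sigma>" unfolding \<Sigma>_def by (intro infsum_nonneg) auto
    define B where "B = 2 * pi * C * 2 ^ (m + 2) * \<Sigma>"
    have B: "0 \<le> B" using C0 \<Sigma> by (simp add: B_def)
    define d where "d = e / (B + 1)"
    have d: "0 < d" "B * d < e" using e B by (auto simp: d_def field_simps)
    \<comment> \<open>Closeness of the functions and of their derivatives of order
      \<open>m + 2\<close> is all that is used: \<open>m\<close> powers of the weight balance the
      growth of \<open>c\<close>, two more make the sum finite.\<close>
    have "uniform_limit UNIV F f sequentially"
      "uniform_limit UNIV (\<lambda>j. (vderiv ^^ (m + 2)) (F j)) ((vderiv ^^ (m + 2)) f) sequentially"
      using F(3) test_tendsto_uniform unfolding test_tendsto_def by blast+
    from this[THEN uniform_limitD, OF d(1)] show "\<forall>\<^sub>F j in sequentially. dist (v (F j)) (v f) < e"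
    proof eventually_elim
      case (elim j)
      have w: "?w k ^ (m + 2) * cmod (tcoef (F j) k - tcoef f k) \<le> 2 ^ (m + 2) * d" for k
        using elim F by (intro tcoef_diff_weighted_le) (auto simp: dist_norm intro: less_imp_le)
      have "((\<lambda>k. tcoef (F j) k * b k - tcoef f k * b k) has_sum (v (F j) - v f)) UNIV"
        using F summ by (intro has_sum_minus) (auto simp: v_def)
      moreover have "((\<lambda>k. 2 * pi * C * (2 ^ (m + 2) * d * (1 / (?w k)\<^sup>2))) has_sum (2 * pi * C * (2 ^ (m + 2) * d * \<Sigma>))) UNIV"
        unfolding \<Sigma>_def by (intro has_sum_cmult_right has_sum_infsum summable_on_int_inverse_square)
      moreover have "cmod (tcoef (F j) k * b k - tcoef f k * b k) \<le> 2 * pi * C * (2 ^ (m + 2) * d * (1 / (?w k)\<^sup>2))" for k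
      proof -
        have "?w k ^ m * cmod (tcoef (F j) k - tcoef f k) \<le> 2 ^ (m + 2) * d * (1 / (?w k)\<^sup>2)"
          using w[of k] by (subst inverse_power_eq[symmetric]) auto
        from mult_left_mono[OF this, of "2 * pi * C"] b_le[of "tcoef (F j) k - tcoef f k" k] C0
        show ?thesis by (simp add: left_diff_distrib)
      qed
      ultimately have "cmod (v (F j) - v f) \<le> 2 * pi * C * (2 ^ (m + 2) * d * \<Sigma>)"
        by (rule norm_infsum_le)
      also have "\<dots> = B * d" by (simp add: B_def)
      finally show ?case using d by (simp add: dist_norm)
    qed
  qed
  have "is_pdist v"
    unfolding is_pdist_def using add cmult lim by (auto simp: v_def)
  then obtain u where u: "pairing u = v" using Abs_pdist_inverse by blast
  have "fourier u k = c k" for k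
  proof -
    have "((\<lambda>l. tcoef (\<lambda>x. cis (of_int (- k) * x)) l * b l) has_sum b (- k)) UNIV"
      by (rule has_sum_finite_neutralI[of "{- k}"]) (simp_all only: tcoef_cis, auto)
    then have "v (\<lambda>x. cis (of_int (- k) * x)) = b (- k)"
      using test_cis[of "- k"] by (simp only: v_def if_True infsumI)
    then show ?thesis using u by (simp add: fourier_def exp_conv_cis b_def)
  qed
  then show ?thesis by blast
qed

section \<open>Sobolev spaces as weighted sequence spaces\<close>

text \<open>The factor \<open>sqrt (2 * pi)\<close> makes the passage to sequences an isometry for
  the norm of \<open>Hs s\<close>.\<close>

definition wt :: "real \<Rightarrow> int \<Rightarrow> real" where
  "wt s k = sqrt (2 * pi) * (1 + \<bar>real_of_int k\<bar>) powr s"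

lemma wt_pos: "0 < wt s k"
  by (simp add: wt_def)

lemma wt_nonzero [simp]: "wt s k \<noteq> 0"
  using wt_pos[of s k] by simp

definition to_ell2 :: "real \<Rightarrow> pdist \<Rightarrow> ell2" where
  "to_ell2 s v = Abs_ell2 (\<lambda>k. complex_of_real (wt s k) * fourier v k)"

lemma cmod_wt_fourier_squared:
  "(cmod (complex_of_real (wt s k) * fourier v k))\<^sup>2 =
    2 * pi * ((1 + \<bar>real_of_int k\<bar>) powr (2 * s) * (cmod (fourier v k))\<^sup>2)"
proof -
  have "((1 + \<bar>real_of_int k\<bar>) powr s)\<^sup>2 = (1 + \<bar>real_of_int k\<bar>) powr (2 * s)"
    by (simp add: power2_eq_square flip: powr_add)
  then show ?thesis by (simp add: wt_def norm_mult power_mult_distrib)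
qed

lemma Hs_iff: "v \<in> Hs s \<longleftrightarrow> (\<lambda>k. (cmod (complex_of_real (wt s k) * fourier v k))\<^sup>2) summable_on UNIV"
  unfolding cmod_wt_fourier_squared Hs_def
  using summable_on_cmult_right'[of "2 * pi" "\<lambda>k. (1 + \<bar>real_of_int k\<bar>) powr (2 * s) * (cmod (fourier v k))\<^sup>2" UNIV]
  by simp

lemma entry_to_ell2: "v \<in> Hs s \<Longrightarrow> entry (to_ell2 s v) k = wt s k * fourier v k"
  unfolding Hs_iff to_ell2_def by (simp add: Abs_ell2_inverse)

lemma Hs_norm_eq: "v \<in> Hs s \<Longrightarrow> Hs_norm s v = norm (to_ell2 s v)"
  unfolding Hs_norm_def norm_ell2_eq
  by (simp add: entry_to_ell2 cmod_wt_fourier_squared infsum_cmult_right' flip: of_real_mult)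

lemma HsI: "(\<And>k. entry x k = wt s k * fourier v k) \<Longrightarrow> v \<in> Hs s \<and> to_ell2 s v = x"
proof -
  assume eq: "\<And>k. entry x k = wt s k * fourier v k"
  then have "v \<in> Hs s" using summable_entry[of x UNIV] by (simp add: Hs_iff)
  then show ?thesis by (auto intro!: ell2_eqI simp: entry_to_ell2 eq)
qed

lemma fourier_add: "fourier (v + w) k = fourier v k + fourier w k"
  by (simp add: fourier_def plus_pdist.rep_eq add_divide_distrib)

lemma fourier_diff: "fourier (v - w) k = fourier v k - fourier w k"
  by (simp add: fourier_def minus_pdist.rep_eq diff_divide_distrib)

lemma fourier_minus: "fourier (- v) k = - fourier v k"
  by (simp add: fourier_def uminus_pdist.rep_eq)

lemma fourier_scaleC: "fourier (scaleC_pdist c v) k = c * fourier v k"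
  by (simp add: fourier_def scaleC_pdist.rep_eq)

lemma fourier_scaleR: "fourier (r *\<^sub>R v) k = r *\<^sub>R fourier v k"
  by (simp add: scaleR_pdist_def fourier_scaleC scaleR_conv_of_real)

lemma fourier_zero: "fourier 0 k = 0"
  by (simp add: fourier_def zero_pdist.rep_eq)

lemma Hs_add: "v \<in> Hs s \<Longrightarrow> w \<in> Hs s \<Longrightarrow> v + w \<in> Hs s \<and> to_ell2 s (v + w) = to_ell2 s v + to_ell2 s w"
  by (rule HsI) (simp add: entry_to_ell2 fourier_add algebra_simps)

lemma Hs_diff: "v \<in> Hs s \<Longrightarrow> w \<in> Hs s \<Longrightarrow> v - w \<in> Hs s \<and> to_ell2 s (v - w) = to_ell2 s v - to_ell2 s w"
  by (rule HsI) (simp add: entry_to_ell2 fourier_diff algebra_simps)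

lemma Hs_minus: "v \<in> Hs s \<Longrightarrow> - v \<in> Hs s \<and> to_ell2 s (- v) = - to_ell2 s v"
  by (rule HsI) (simp add: entry_to_ell2 fourier_minus)

lemma Hs_scaleR: "v \<in> Hs s \<Longrightarrow> r *\<^sub>R v \<in> Hs s \<and> to_ell2 s (r *\<^sub>R v) = r *\<^sub>R to_ell2 s v"
  by (rule HsI) (simp add: entry_to_ell2 fourier_scaleR)

lemma Hs_zero: "0 \<in> Hs s \<and> to_ell2 s 0 = 0"
  by (rule HsI) (simp add: fourier_zero)

lemma Hs_sum:
  "finite A \<Longrightarrow> (\<And>a. a \<in> A \<Longrightarrow> f a \<in> Hs s) \<Longrightarrow> sum f A \<in> Hs s \<and> to_ell2 s (sum f A) = (\<Sum>a\<in>A. to_ell2 s (f a))"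
  by (induction A rule: finite_induct) (auto simp: Hs_zero Hs_add)

lemma to_ell2_inject: "v \<in> Hs s \<Longrightarrow> w \<in> Hs s \<Longrightarrow> to_ell2 s v = to_ell2 s w \<Longrightarrow> v = w"
proof (rule fourier_inject)
  fix k assume "v \<in> Hs s" "w \<in> Hs s" "to_ell2 s v = to_ell2 s w"
  then show "fourier v k = fourier w k" using entry_to_ell2[of v s k] entry_to_ell2[of w s k] by simp
qed

text \<open>Removing the weight lets the coefficients grow at most like a power of order
  \<open>\<bar>s\<bar>\<close>, which still defines a distribution. Surjectivity is what transfers
  completeness to \<open>Hs s\<close>.\<close>

lemma ex_to_ell2: "\<exists>v. v \<in> Hs s \<and> to_ell2 s v = x"
proof -
  define m where "m = nat \<lceil>\<bar>s\<bar>\<rceil>"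
  have m: "\<bar>s\<bar> \<le> real m" unfolding m_def by linarith
  have "cmod (entry x k / wt s k) \<le> norm x / sqrt (2 * pi) * (1 + \<bar>real_of_int k\<bar>) ^ m" for k
  proof -
    have "1 / (1 + \<bar>real_of_int k\<bar>) powr s = (1 + \<bar>real_of_int k\<bar>) powr (- s)"
      by (simp add: powr_minus_divide)
    also have "\<dots> \<le> (1 + \<bar>real_of_int k\<bar>) powr (real m)" using m by (intro powr_mono) auto
    also have "\<dots> = (1 + \<bar>real_of_int k\<bar>) ^ m" by (simp add: powr_realpow)
    finally have "1 / (1 + \<bar>real_of_int k\<bar>) powr s \<le> (1 + \<bar>real_of_int k\<bar>) ^ m" .
    from mult_mono[OF divide_right_mono[OF entry_le_norm[of x k], of "sqrt (2 * pi)"] this]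
    show ?thesis by (simp add: wt_def norm_divide norm_mult)
  qed
  then have "\<exists>v. fourier v = (\<lambda>k. entry x k / wt s k)" by (rule ex_fourier)
  then obtain v where "fourier v = (\<lambda>k. entry x k / wt s k)" by blast
  then have "entry x k = wt s k * fourier v k" for k by simp
  then show ?thesis using HsI by blast
qed

definition of_ell2 :: "real \<Rightarrow> ell2 \<Rightarrow> pdist" where
  "of_ell2 s x = (SOME v. v \<in> Hs s \<and> to_ell2 s v = x)"

lemma of_ell2: "of_ell2 s x \<in> Hs s" "to_ell2 s (of_ell2 s x) = x"
  using someI_ex[OF ex_to_ell2, of s x] by (auto simp: of_ell2_def)

lemma Hs_norm_diff: "v \<in> Hs s \<Longrightarrow> w \<in> Hs s \<Longrightarrow> Hs_norm s (v - w) = norm (to_ell2 s v - to_ell2 s w)"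
  by (simp add: Hs_diff Hs_norm_eq)

lemma continuous_Hs_iff:
  "continuous_Hs s I u \<longleftrightarrow> (\<forall>t\<in>I. u t \<in> Hs s) \<and> continuous_on I (\<lambda>t. to_ell2 s (u t))"
proof -
  have "((\<lambda>t. Hs_norm s (u t - u t0)) \<longlongrightarrow> 0) (at t0 within I) \<longleftrightarrow>
      ((\<lambda>t. to_ell2 s (u t)) \<longlongrightarrow> to_ell2 s (u t0)) (at t0 within I)"
    if "\<forall>t\<in>I. u t \<in> Hs s" "t0 \<in> I" for t0
  proof -
    have "((\<lambda>t. Hs_norm s (u t - u t0)) \<longlongrightarrow> 0) (at t0 within I) \<longleftrightarrow>
        ((\<lambda>t. norm (to_ell2 s (u t) - to_ell2 s (u t0))) \<longlongrightarrow> 0) (at t0 within I)"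
      using that by (intro tendsto_cong) (auto simp: eventually_at_filter Hs_norm_diff intro!: always_eventually)
    then show ?thesis by (simp add: tendsto_norm_zero_iff LIM_zero_iff)
  qed
  then show ?thesis by (auto simp: continuous_Hs_def continuous_on_def)
qed

subsection \<open>The free evolution\<close>

definition flow :: "(int \<Rightarrow> real) \<Rightarrow> real \<Rightarrow> ell2 \<Rightarrow> ell2" where
  "flow lam t = mult_ell2 (\<lambda>k. cis (lam k * t))"

lemma bounded_cis: "bounded (range (\<lambda>k. cis (f k)))"
  by (rule bounded_rangeI[where C = 1]) simp

lemma entry_flow: "entry (flow lam t x) k = cis (lam k * t) * entry x k"
  by (simp add: flow_def entry_mult_ell2 bounded_cis)

lemma norm_flow: "norm (flow lam t x) = norm x"
  by (simp add: norm_ell2_eq entry_flow norm_mult)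

lemma flow_flow: "flow lam s (flow lam t x) = flow lam (s + t) x"
  by (rule ell2_eqI) (simp add: entry_flow cis_mult distrib_left flip: mult.assoc)

lemma flow_0 [simp]: "flow lam 0 x = x"
  by (rule ell2_eqI) (simp add: entry_flow)

lemma bounded_linear_flow: "bounded_linear (flow lam t)"
  unfolding flow_def by (intro bounded_linear_mult_ell2 bounded_cis)

lemmas flow_linear = bounded_linear_flow[THEN bounded_linear.linear]
lemmas flow_add = linear_add[OF flow_linear] and flow_diff = linear_diff[OF flow_linear]
  and flow_scale = linear_scale[OF flow_linear] and flow_minus = linear_neg[OF flow_linear]

lemma flow_uminus: "flow (\<lambda>k. - lam k) t = flow lam (- t)"
  by (simp add: flow_def)

lemma inner_flow: "inner (flow lam t x) y = inner x (flow lam (- t) y)"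
proof -
  have "inner (cis (lam k * t) * z) w = inner z (cis (- (lam k * t)) * w)" for k z w
    by (simp add: inner_complex_def algebra_simps)
  then show ?thesis by (simp add: inner_ell2_def entry_flow)
qed

lemma continuous_on_flow [continuous_intros]:
  assumes "continuous_on S f" "continuous_on S x"
  shows "continuous_on S (\<lambda>t. flow lam (f t) (x t))"
  unfolding flow_def using assms by (intro continuous_mult_ell2[where C = 1] continuous_intros) auto

abbreviation phase :: "(int \<Rightarrow> real) \<Rightarrow> int \<Rightarrow> real" where "phase a k \<equiv> of_int k * a k"

text \<open>The multiplier is defined by a description. The sequence space supplies a distribution
  with the required coefficients, and coefficients determine it uniquely.\<close>

lemma to_ell2_evol:
  assumes v: "v \<in> Hs s" shows "evol a t v \<in> Hs s \<and> to_ell2 s (evol a t v) = flow (phase a) t (to_ell2 s v)"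
proof -
  let ?m = "\<lambda>k. exp (\<i> * of_int k * complex_of_real (a k) * complex_of_real t)"
  have m: "?m k = cis (phase a k * t)" for k by (simp add: cis_conv_exp mult.assoc)
  obtain w where w: "w \<in> Hs s" "to_ell2 s w = flow (phase a) t (to_ell2 s v)" using ex_to_ell2 by blast
  have fw: "fourier w k = ?m k * fourier v k" for k
  proof -
    have "complex_of_real (wt s k) * fourier w k = complex_of_real (wt s k) * (cis (phase a k * t) * fourier v k)"
      using arg_cong[OF w(2), of "\<lambda>x. entry x k"]
      by (simp only: entry_to_ell2 w(1) v entry_flow mult.left_commute)
    then show ?thesis unfolding m by simp
  qed
  have "evol a t v = w"
    unfolding evol_def fourier_multiplier_def
    by (rule the_equality) (use fw in \<open>auto intro!: fourier_inject\<close>)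
  then show ?thesis using w by simp
qed

subsection \<open>Bochner integrals of continuous functions\<close>

lemma simple_bochner_integrable_finite:
  "simple_function (lebesgue_on {0..t}) f \<Longrightarrow> Bochner_Integration.simple_bochner_integrable (lebesgue_on {0..t::real}) f"
proof (rule simple_bochner_integrable.intros)
  assume f: "simple_function (lebesgue_on {0..t}) f"
  have "emeasure (lebesgue_on {0..t}) {y \<in> space (lebesgue_on {0..t}). f y \<noteq> 0} \<le> emeasure (lebesgue_on {0..t}) (space (lebesgue_on {0..t}))"
    by (rule emeasure_space)
  also have "\<dots> < \<infinity>" by (simp add: emeasure_restrict_space emeasure_lborel_Icc_eq)
  finally show "emeasure (lebesgue_on {0..t}) {y \<in> space (lebesgue_on {0..t}). f y \<noteq> 0} \<noteq> \<infinity>" by simp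
qed

text \<open>Integrals of distribution-valued simple functions are tested by linear functionals with
  values in a separable Banach space. Single entries and inner products with a fixed sequence are
  the two uses.\<close>

lemma simple_bochner_integral_transfer:
  fixes \<phi> :: "pdist \<Rightarrow> 'b::{real_normed_vector, second_countable_topology, banach}" and t :: real
  assumes \<sigma>: "simple_Hs s (lebesgue_on {0..t}) \<sigma>" and \<psi>: "linear \<psi>" and eq: "\<And>v. v \<in> Hs s \<Longrightarrow> \<phi> v = \<psi> (to_ell2 s v)"
  shows "\<phi> (Bochner_Integration.simple_bochner_integral (lebesgue_on {0..t}) \<sigma>)
      = integral\<^sup>L (lebesgue_on {0..t}) (\<lambda>x. \<phi> (\<sigma> x))"
    and "simple_function (lebesgue_on {0..t}) (\<lambda>x. \<phi> (\<sigma> x))"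
    and "integrable (lebesgue_on {0..t}) (\<lambda>x. \<phi> (\<sigma> x))"
    and "Bochner_Integration.simple_bochner_integral (lebesgue_on {0..t}) \<sigma> \<in> Hs s"
proof -
  let ?M = "lebesgue_on {0..t}"
  have sf: "simple_function ?M \<sigma>" and Hs: "\<And>x. x \<in> space ?M \<Longrightarrow> \<sigma> x \<in> Hs s"
    using \<sigma> by (auto simp: simple_Hs_def elim: simple_bochner_integrable.cases)
  have fin: "finite (\<sigma> ` space ?M)" using sf by (rule simple_functionD)
  have H: "Bochner_Integration.simple_bochner_integral ?M \<sigma> \<in> Hs s \<and>
      to_ell2 s (Bochner_Integration.simple_bochner_integral ?M \<sigma>) =
      (\<Sum>y\<in>\<sigma> ` space ?M. measure ?M {x \<in> space ?M. \<sigma> x = y} *\<^sub>R to_ell2 s y)"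
  proof -
    have "(\<Sum>y\<in>\<sigma> ` space ?M. to_ell2 s (measure ?M {x \<in> space ?M. \<sigma> x = y} *\<^sub>R y))
        = (\<Sum>y\<in>\<sigma> ` space ?M. measure ?M {x \<in> space ?M. \<sigma> x = y} *\<^sub>R to_ell2 s y)"
      using Hs by (intro sum.cong refl) (auto simp only: Hs_scaleR)
    then show ?thesis
      using Hs_sum[OF fin, of "\<lambda>y. measure ?M {x \<in> space ?M. \<sigma> x = y} *\<^sub>R y" s] Hs
      unfolding simple_bochner_integral_def by (metis (no_types, lifting) Hs_scaleR imageE)
  qed
  show "simple_function ?M (\<lambda>x. \<phi> (\<sigma> x))" using sf by (rule simple_function_compose1)
  then have int: "Bochner_Integration.simple_bochner_integrable ?M (\<lambda>x. \<phi> (\<sigma> x))" by (rule simple_bochner_integrable_finite)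
  have "Bochner_Integration.simple_bochner_integral ?M (\<lambda>x. \<phi> (\<sigma> x)) =
      (\<Sum>y\<in>\<sigma> ` space ?M. measure ?M {x \<in> space ?M. \<sigma> x = y} *\<^sub>R \<phi> y)"
    by (rule simple_bochner_integral_partition[OF int sf]) auto
  also have "\<dots> = \<psi> (to_ell2 s (Bochner_Integration.simple_bochner_integral ?M \<sigma>))"
    using H Hs by (auto simp: linear_sum[OF \<psi>] linear_scale[OF \<psi>] eq intro!: sum.cong)
  also have "\<dots> = \<phi> (Bochner_Integration.simple_bochner_integral ?M \<sigma>)" using H eq by simp
  finally show "\<phi> (Bochner_Integration.simple_bochner_integral ?M \<sigma>) = integral\<^sup>L ?M (\<lambda>x. \<phi> (\<sigma> x))"
    using simple_bochner_integrable_eq_integral[OF int] by simp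
  show "integrable ?M (\<lambda>x. \<phi> (\<sigma> x))"
    using has_bochner_integral_simple_bochner_integrable[OF int] by (rule integrable.intros)
  show "Bochner_Integration.simple_bochner_integral ?M \<sigma> \<in> Hs s" using H ..
qed

context
  fixes f :: "real \<Rightarrow> pdist" and F :: "real \<Rightarrow> ell2" and s t :: real
  assumes f: "\<And>x. x \<in> {0..t} \<Longrightarrow> f x \<in> Hs s" and F: "\<And>x. x \<in> {0..t} \<Longrightarrow> to_ell2 s (f x) = F x"
    and cont: "continuous_on {0..t} F" and t: "0 \<le> t"
begin

lemma integrable_transfer:
  fixes \<psi> :: "ell2 \<Rightarrow> 'b::euclidean_space"
  assumes "bounded_linear \<psi>"
  shows "integrable (lebesgue_on {0..t}) (\<lambda>x. \<psi> (F x))"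
    and "integral\<^sup>L (lebesgue_on {0..t}) (\<lambda>x. \<psi> (F x)) = \<psi> (integral {0..t} F)"
proof -
  have c: "continuous_on {0..t} (\<lambda>x. \<psi> (F x))" by (rule bounded_linear.continuous_on[OF assms cont])
  then show *: "integrable (lebesgue_on {0..t}) (\<lambda>x. \<psi> (F x))" by (rule continuous_imp_integrable_real)
  have "integral\<^sup>L (lebesgue_on {0..t}) (\<lambda>x. \<psi> (F x)) = integral {0..t} (\<lambda>x. \<psi> (F x))"
    by (rule lebesgue_integral_eq_integral[OF *]) simp
  also have "\<dots> = \<psi> (integral {0..t} F)"
    using integral_linear[OF integrable_continuous_interval[OF cont] assms] by (simp add: comp_def)
  finally show "integral\<^sup>L (lebesgue_on {0..t}) (\<lambda>x. \<psi> (F x)) = \<psi> (integral {0..t} F)" .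
qed

text \<open>Fix an entry: along the integrals of the simple functions it converges to that of
  \<open>y\<close>, and by the approximation in the mean also to that of the integral of
  \<open>F\<close>.\<close>

lemma has_bochner_integral_Hs_unique:
  assumes "has_bochner_integral_Hs s (lebesgue_on {0..t}) f y"
  shows "y \<in> Hs s" "to_ell2 s y = integral {0..t} F"
proof -
  let ?M = "lebesgue_on {0..t}"
  let ?I = "Bochner_Integration.simple_bochner_integral ?M"
  obtain \<sigma> where y: "y \<in> Hs s" and \<sigma>: "\<And>i. simple_Hs s ?M (\<sigma> i)"
    and 1: "(\<lambda>i. \<integral>\<^sup>+x. ennreal (Hs_norm s (f x - \<sigma> i x)) \<partial>?M) \<longlonglongrightarrow> 0"
    and 2: "(\<lambda>i. Hs_norm s (?I (\<sigma> i) - y)) \<longlonglongrightarrow> 0"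
    using assms by (auto simp: has_bochner_integral_Hs_def)
  show "y \<in> Hs s" by fact
  show "to_ell2 s y = integral {0..t} F"
  proof (rule ell2_eqI)
    fix k
    let ?\<phi> = "\<lambda>v. complex_of_real (wt s k) * fourier v k"
    let ?\<psi> = "\<lambda>x. entry x k"
    note lin = bounded_linear.linear[OF bounded_linear_entry[of k]]
    note T = simple_bochner_integral_transfer[OF \<sigma> lin, of ?\<phi>]
    have \<phi>: "?\<phi> v = ?\<psi> (to_ell2 s v)" if "v \<in> Hs s" for v using that by (simp add: entry_to_ell2)
    have "(\<lambda>i. ?\<phi> (?I (\<sigma> i)) - entry (to_ell2 s y) k) \<longlonglongrightarrow> 0"
    proof (rule tendsto_0_le[OF 2, where K = 1], intro always_eventually allI)
      fix i
      have "norm (?\<phi> (?I (\<sigma> i)) - entry (to_ell2 s y) k) = cmod (entry (to_ell2 s (?I (\<sigma> i)) - to_ell2 s y) k)"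
        using T(4)[OF \<phi>] by (simp add: entry_to_ell2)
      also have "\<dots> \<le> norm (to_ell2 s (?I (\<sigma> i)) - to_ell2 s y)" by (rule entry_le_norm)
      also have "\<dots> = Hs_norm s (?I (\<sigma> i) - y)" using T(4)[OF \<phi>] y by (simp add: Hs_norm_diff)
      finally show "norm (?\<phi> (?I (\<sigma> i)) - entry (to_ell2 s y) k) \<le> norm (Hs_norm s (?I (\<sigma> i) - y)) * 1"
        by simp
    qed
    moreover have "(\<lambda>i. ?\<phi> (?I (\<sigma> i)) - entry (integral {0..t} F) k) \<longlonglongrightarrow> 0"
    proof -
      have "ennreal (norm (?\<phi> (?I (\<sigma> i)) - entry (integral {0..t} F) k)) \<le> (\<integral>\<^sup>+x. ennreal (Hs_norm s (f x - \<sigma> i x)) \<partial>?M)" for i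
      proof -
        note tr = integrable_transfer[OF bounded_linear_entry[of k]]
        have int: "integrable ?M (\<lambda>x. ?\<phi> (\<sigma> i x) - entry (F x) k)"
          by (intro Bochner_Integration.integrable_diff T(3)[OF \<phi>] tr(1))
        have "?\<phi> (?I (\<sigma> i)) - entry (integral {0..t} F) k = integral\<^sup>L ?M (\<lambda>x. ?\<phi> (\<sigma> i x) - entry (F x) k)"
          using T(1)[OF \<phi>] tr T(3)[OF \<phi>] by (simp add: Bochner_Integration.integral_diff)
        then have "ennreal (norm (?\<phi> (?I (\<sigma> i)) - entry (integral {0..t} F) k)) \<le> (\<integral>\<^sup>+x. ennreal (norm (?\<phi> (\<sigma> i x) - entry (F x) k)) \<partial>?M)"
          using integral_norm_bound_ennreal[OF int] by simp
        also have "\<dots> \<le> (\<integral>\<^sup>+x. ennreal (Hs_norm s (f x - \<sigma> i x)) \<partial>?M)"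
        proof (rule nn_integral_mono)
          fix x assume x: "x \<in> space ?M"
          then have x': "x \<in> {0..t}" "\<sigma> i x \<in> Hs s" using \<sigma>[of i] by (auto simp: simple_Hs_def)
          have "norm (?\<phi> (\<sigma> i x) - entry (F x) k) = cmod (entry (to_ell2 s (f x) - to_ell2 s (\<sigma> i x)) k)"
            using x' by (simp add: F entry_to_ell2 norm_minus_commute)
          also have "\<dots> \<le> Hs_norm s (f x - \<sigma> i x)"
            using x' f entry_le_norm[of "to_ell2 s (f x) - to_ell2 s (\<sigma> i x)" k] by (simp add: Hs_norm_diff)
          finally show "ennreal (norm (?\<phi> (\<sigma> i x) - entry (F x) k)) \<le> ennreal (Hs_norm s (f x - \<sigma> i x))"
            by (rule ennreal_leI)
        qed
        finally show ?thesis .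
      qed
      then have "(\<lambda>i. ennreal (norm (?\<phi> (?I (\<sigma> i)) - entry (integral {0..t} F) k))) \<longlonglongrightarrow> 0"
        by (intro tendsto_sandwich[OF _ _ tendsto_const 1]) auto
      then have "(\<lambda>i. norm (?\<phi> (?I (\<sigma> i)) - entry (integral {0..t} F) k)) \<longlonglongrightarrow> 0"
        by (simp flip: ennreal_0)
      then show ?thesis by (rule tendsto_norm_zero_cancel)
    qed
    ultimately show "entry (to_ell2 s y) k = entry (integral {0..t} F) k"
      by (metis LIM_zero_cancel LIMSEQ_unique)
  qed
qed

text \<open>Rounding down to a multiple of \<open>1 / Suc n\<close>: the rounded point stays in
  \<open>{0..t}\<close>, where \<open>f\<close> is controlled, and takes finitely many values
  there.\<close>

definition grid :: "nat \<Rightarrow> real \<Rightarrow> real" where "grid n x = real_of_int \<lfloor>real (Suc n) * x\<rfloor> / real (Suc n)"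

lemma grid_bounds: "x \<in> {0..t} \<Longrightarrow> grid n x \<in> {0..t}" "\<bar>grid n x - x\<bar> \<le> 1 / real (Suc n)"
proof -
  have 1: "real_of_int \<lfloor>real (Suc n) * x\<rfloor> \<le> real (Suc n) * x" "real (Suc n) * x < real_of_int \<lfloor>real (Suc n) * x\<rfloor> + 1"
    by linarith+
  have le1: "grid n x \<le> x" using 1(1) by (simp add: grid_def pos_divide_le_eq mult.commute del: of_nat_Suc)
  have "(real (Suc n) * x - 1) / real (Suc n) \<le> grid n x"
    unfolding grid_def using 1(2) by (intro divide_right_mono) linarith+
  then have le: "grid n x \<le> x" "x - 1 / real (Suc n) \<le> grid n x"
    using le1 by (simp_all add: diff_divide_distrib del: of_nat_Suc)
  then show "\<bar>grid n x - x\<bar> \<le> 1 / real (Suc n)" by auto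
  assume x: "x \<in> {0..t}"
  then have "0 \<le> \<lfloor>real (Suc n) * x\<rfloor>" by simp
  then have "0 \<le> grid n x" by (simp add: grid_def)
  then show "grid n x \<in> {0..t}" using le x by auto
qed

lemma simple_function_grid: "simple_function (lebesgue_on {0..t}) (grid n)"
proof (rule simple_function_borel_measurable)
  have "grid n \<in> borel_measurable borel" unfolding grid_def[abs_def] by measurable
  then have "grid n \<in> borel_measurable lebesgue" by (simp add: measurable_completion)
  then show "grid n \<in> borel_measurable (lebesgue_on {0..t})" by (rule measurable_restrict_space1)
  have "grid n ` {0..t} \<subseteq> (\<lambda>m. real_of_int m / real (Suc n)) ` {0..\<lceil>real (Suc n) * t\<rceil>}"
  proof
    fix y assume "y \<in> grid n ` {0..t}"
    then obtain x where x: "x \<in> {0..t}" "y = grid n x" by auto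
    have "real (Suc n) * x \<le> real (Suc n) * t" using x by (intro mult_left_mono) auto
    then have "\<lfloor>real (Suc n) * x\<rfloor> \<le> \<lceil>real (Suc n) * t\<rceil>" by linarith
    moreover have "0 \<le> \<lfloor>real (Suc n) * x\<rfloor>" using x by simp
    ultimately show "y \<in> (\<lambda>m. real_of_int m / real (Suc n)) ` {0..\<lceil>real (Suc n) * t\<rceil>}"
      using x by (auto simp: grid_def)
  qed
  then have "finite (grid n ` {0..t})" by (rule finite_subset) simp
  then show "finite (grid n ` space (lebesgue_on {0..t}))" by simp
qed

lemma step_approximation:
  obtains b where "b \<longlonglongrightarrow> 0" "\<And>n x. x \<in> {0..t} \<Longrightarrow> norm (F x - F (grid n x)) \<le> b n"
proof -
  have "uniformly_continuous_on {0..t} F" by (intro compact_uniformly_continuous cont) simp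
  then have ev: "\<forall>\<^sub>F n in sequentially. \<forall>x\<in>{0..t}. norm (F x - F (grid n x)) \<le> e" if "0 < e" for e
  proof -
    have "\<exists>d>0. \<forall>x\<in>{0..t}. \<forall>y\<in>{0..t}. dist y x < d \<longrightarrow> dist (F y) (F x) < e"
      using \<open>uniformly_continuous_on {0..t} F\<close> that unfolding uniformly_continuous_on_def by blast
    then obtain d where d: "0 < d" "\<forall>x\<in>{0..t}. \<forall>y\<in>{0..t}. dist y x < d \<longrightarrow> dist (F y) (F x) < e"
      by blast
    obtain N where N: "inverse (real (Suc N)) < d" using reals_Archimedean[OF d(1)] by blast
    have "norm (F x - F (grid n x)) \<le> e" if "N \<le> n" "x \<in> {0..t}" for n x
    proof -
      have "1 / real (Suc n) \<le> 1 / real (Suc N)" using that by (intro divide_left_mono) auto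
      then have "dist x (grid n x) < d"
        using grid_bounds(2)[of n x] N by (simp add: dist_real_def inverse_eq_divide)
      then have "dist (F x) (F (grid n x)) < e" using d(2) grid_bounds(1)[OF that(2)] that(2) by blast
      then show ?thesis by (simp add: dist_norm)
    qed
    then show ?thesis unfolding eventually_sequentially by blast
  qed
  obtain C where C: "\<And>x. x \<in> {0..t} \<Longrightarrow> norm (F x) \<le> C"
    using compact_imp_bounded[OF compact_continuous_image[OF cont]] unfolding bounded_iff by blast
  define b where "b = (\<lambda>n. SUP x\<in>{0..t}. norm (F x - F (grid n x)))"
  have bdd: "bdd_above ((\<lambda>x. norm (F x - F (grid n x))) ` {0..t})" for n
  proof (rule bdd_aboveI2)
    fix x assume x: "x \<in> {0..t}"
    show "norm (F x - F (grid n x)) \<le> C + C"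
      using norm_triangle_ineq4[of "F x" "F (grid n x)"] C[OF x] C[OF grid_bounds(1)[OF x, of n]] by linarith
  qed
  have le: "norm (F x - F (grid n x)) \<le> b n" if "x \<in> {0..t}" for n x
    unfolding b_def by (rule cSUP_upper[OF that bdd])
  have "b \<longlonglongrightarrow> 0"
  proof (rule tendstoI)
    fix e :: real assume "0 < e"
    then have "0 < e / 2" by simp
    from ev[OF this] show "\<forall>\<^sub>F n in sequentially. dist (b n) 0 < e"
    proof eventually_elim
      case (elim n)
      have "b n \<le> e / 2" unfolding b_def by (rule cSUP_least) (use t elim in auto)
      moreover have "0 \<le> b n" using order_trans[OF norm_ge_zero le[of 0 n]] t by simp
      ultimately show ?case using \<open>0 < e\<close> by (simp add: dist_real_def)
    qed
  qed
  then show ?thesis using le that by blast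
qed

lemma step_function_properties:
  shows "simple_Hs s (lebesgue_on {0..t}) (\<lambda>x. f (grid n x))"
    and "x \<in> {0..t} \<Longrightarrow> Hs_norm s (f x - f (grid n x)) = norm (F x - F (grid n x))"
  using simple_function_compose1[OF simple_function_grid] grid_bounds(1) f F
  by (auto simp: simple_Hs_def Hs_norm_diff intro!: simple_bochner_integrable_finite)

lemma strongly_measurable_Hs_continuous: "strongly_measurable_Hs s (lebesgue_on {0..t}) f"
proof -
  obtain b where b: "b \<longlonglongrightarrow> 0" "\<And>n x. x \<in> {0..t} \<Longrightarrow> norm (F x - F (grid n x)) \<le> b n"
    using step_approximation by blast
  have "(\<lambda>i. Hs_norm s (f x - f (grid i x))) \<longlonglongrightarrow> 0" if "x \<in> {0..t}" for x
    using b that by (intro tendsto_0_le[OF b(1), where K = 1])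
      (auto simp: step_function_properties intro!: always_eventually order_trans[OF b(2)])
  then show ?thesis
    unfolding strongly_measurable_Hs_def using f step_function_properties(1)
    by (auto intro!: AE_I2 exI[of _ "\<lambda>n x. f (grid n x)"])
qed

lemma has_bochner_integral_Hs_continuous:
  "has_bochner_integral_Hs s (lebesgue_on {0..t}) f (of_ell2 s (integral {0..t} F))"
proof -
  let ?M = "lebesgue_on {0..t}"
  let ?\<sigma> = "\<lambda>n x. f (grid n x)"
  let ?I = "Bochner_Integration.simple_bochner_integral ?M"
  obtain b where b: "b \<longlonglongrightarrow> 0" "\<And>n x. x \<in> {0..t} \<Longrightarrow> norm (F x - F (grid n x)) \<le> b n"
    using step_approximation by blast
  have b0: "0 \<le> b n" for n using order_trans[OF norm_ge_zero b(2)[of 0 n]] t by simp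
  have le1: "(\<integral>\<^sup>+x. ennreal (Hs_norm s (f x - ?\<sigma> n x)) \<partial>?M) \<le> ennreal (b n * t)" for n
  proof -
    have "(\<integral>\<^sup>+x. ennreal (Hs_norm s (f x - ?\<sigma> n x)) \<partial>?M) \<le> (\<integral>\<^sup>+x. ennreal (b n) \<partial>?M)"
      by (intro nn_integral_mono ennreal_leI) (simp add: step_function_properties b)
    also have "\<dots> = ennreal (b n * t)"
      using t b0 by (simp add: emeasure_restrict_space ennreal_mult)
    finally show ?thesis .
  qed
  have lim1: "(\<lambda>n. ennreal (b n * t)) \<longlonglongrightarrow> 0"
    using tendsto_ennrealI[OF tendsto_mult_left_zero[OF b(1), of t]] by simp
  have 1: "(\<lambda>n. \<integral>\<^sup>+x. ennreal (Hs_norm s (f x - ?\<sigma> n x)) \<partial>?M) \<longlonglongrightarrow> 0"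
    by (rule tendsto_sandwich[OF _ _ tendsto_const lim1]) (use le1 in auto)
  have le: "Hs_norm s (?I (?\<sigma> n) - of_ell2 s (integral {0..t} F)) \<le> b n * t" for n
  proof -
    \<comment> \<open>The error is tested against itself: a scalar integral bounds
      \<open>inner e e\<close> by \<open>b n * t * norm e\<close>, and one factor
      \<open>norm e\<close> cancels.\<close>
    define e where "e = to_ell2 s (?I (?\<sigma> n)) - integral {0..t} F"
    note sp = step_function_properties(1)[of n]
    have F_grid: "to_ell2 s (f (grid n x)) = F (grid n x)" if "0 \<le> x" "x \<le> t" for x
      using F[OF grid_bounds(1)] that by simp
    let ?\<phi> = "\<lambda>v. inner (to_ell2 s v) e"
    note T = simple_bochner_integral_transfer[OF sp bounded_linear.linear[OF bounded_linear_inner_left], of ?\<phi> e, OF refl]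
    note tr = integrable_transfer[OF bounded_linear_inner_left[of e]]
    have "inner e e = integral\<^sup>L ?M (\<lambda>x. ?\<phi> (?\<sigma> n x) - inner (F x) e)"
      using T(1,3) tr by (simp add: e_def inner_diff_left)
    also have "\<dots> = integral\<^sup>L ?M (\<lambda>x. inner (F (grid n x) - F x) e)"
      by (rule Bochner_Integration.integral_cong) (auto simp: inner_diff_left F F_grid)
    also have "norm \<dots> \<le> integral\<^sup>L ?M (\<lambda>x. b n * norm e)"
    proof (rule order_trans[OF integral_norm_bound Bochner_Integration.integral_mono[OF integrable_norm]])
      show "integrable ?M (\<lambda>x. inner (F (grid n x) - F x) e)"
      proof (rule Bochner_Integration.integrable_cong[THEN iffD1, OF refl])
        show "integrable ?M (\<lambda>x. ?\<phi> (?\<sigma> n x) - inner (F x) e)"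
          using T(3) tr by (intro Bochner_Integration.integrable_diff)
      qed (auto simp: inner_diff_left F F_grid)
      show "integrable ?M (\<lambda>x. b n * norm e)" by (intro continuous_imp_integrable_real continuous_intros)
      fix x assume "x \<in> space ?M"
      then have "norm (F (grid n x) - F x) \<le> b n" using b(2)[of x n] by (simp add: norm_minus_commute)
      then show "norm (inner (F (grid n x) - F x) e) \<le> b n * norm e"
        using Cauchy_Schwarz_ineq2[of "F (grid n x) - F x" e] mult_right_mono[of "norm (F (grid n x) - F x)" "b n" "norm e"]
        by simp
    qed
    also have "\<dots> = b n * t * norm e"
      using t by (simp add: measure_restrict_space)
    finally have "norm e * norm e \<le> b n * t * norm e"
      by (simp add: power2_norm_eq_inner[symmetric] power2_eq_square)
    then have "norm e \<le> b n * t" using b0 t by (cases "norm e = 0") auto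
    then show ?thesis using T(4) by (simp add: Hs_norm_diff of_ell2 e_def)
  qed
  have "(\<lambda>n. Hs_norm s (?I (?\<sigma> n) - of_ell2 s (integral {0..t} F))) \<longlonglongrightarrow> 0"
  proof (rule tendsto_sandwich[OF _ _ tendsto_const])
    show "(\<lambda>n. b n * t) \<longlonglongrightarrow> 0" using tendsto_mult_left_zero[OF b(1)] .
    show "\<forall>\<^sub>F n in sequentially. 0 \<le> Hs_norm s (?I (?\<sigma> n) - of_ell2 s (integral {0..t} F))"
      by (simp add: Hs_norm_def infsum_nonneg)
  qed (use le in auto)
  with 1 strongly_measurable_Hs_continuous step_function_properties(1) of_ell2(1) show ?thesis
    unfolding has_bochner_integral_Hs_def by (intro conjI exI[of _ ?\<sigma>] allI) auto
qed

end

subsection \<open>Mild solutions as integral equations in the sequence space\<close>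

lemma continuous_on_integral_upper:
  fixes f :: "real \<Rightarrow> 'a::banach"
  assumes "continuous_on {0..} f" shows "continuous_on {0..} (\<lambda>t. integral {0..t} f)"
  unfolding continuous_on_eq_continuous_within
proof
  fix t :: real assume t: "t \<in> {0..}"
  have "continuous_on {0..t + 1} (\<lambda>t. integral {0..t} f)"
    by (intro indefinite_integral_continuous_1 integrable_continuous_interval continuous_on_subset[OF assms]) auto
  then have "continuous (at t within {0..t + 1}) (\<lambda>t. integral {0..t} f)"
    using t by (simp add: continuous_on_eq_continuous_within)
  moreover have "at t within {0..t + 1} = at t within {0..}"
    using t by (intro at_within_nhd[of _ "{..<t + 1}"]) auto
  ultimately show "continuous (at t within {0..}) (\<lambda>t. integral {0..t} f)" by simp
qed

text \<open>The factor \<open>flow (phase a) t\<close> is pulled out of the Duhamel integral by the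
  group law. For a continuous source the Bochner integral is that of a continuous function of
  sequences, and the formula itself makes \<open>u\<close> continuous.\<close>

theorem mild_solution_iff:
  assumes I: "I = {0..T} \<or> I = {0..}" and u0: "u0 \<in> Hs s" and f: "continuous_Hs s I f"
  shows "mild_solution a s I u0 f u \<longleftrightarrow>
    (\<forall>t\<in>I. u t \<in> Hs s \<and> to_ell2 s (u t) =
      flow (phase a) t (to_ell2 s u0 + integral {0..t} (\<lambda>\<tau>. flow (phase a) (- \<tau>) (to_ell2 s (f \<tau>)))))"
    (is "_ \<longleftrightarrow> ?R")
proof -
  let ?U = "flow (phase a)"
  define F where "F = (\<lambda>\<tau>. to_ell2 s (f \<tau>))"
  have sub: "{0..t} \<subseteq> I" "0 \<le> t" if "t \<in> I" for t using I that by auto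
  have fH: "f \<tau> \<in> Hs s" if "\<tau> \<in> I" for \<tau>
    using f that by (auto simp: continuous_Hs_iff)
  have F: "continuous_on I F"
    using f by (auto simp: continuous_Hs_iff F_def)
  have H: "evol a (t - \<tau>) (f \<tau>) \<in> Hs s" "to_ell2 s (evol a (t - \<tau>) (f \<tau>)) = ?U (t - \<tau>) (F \<tau>)"
    if "\<tau> \<in> {0..t}" "t \<in> I" for t \<tau>
  proof -
    have "\<tau> \<in> I" using sub(1)[OF that(2)] that(1) by blast
    from to_ell2_evol[OF fH[OF this], of a "t - \<tau>"]
    show "evol a (t - \<tau>) (f \<tau>) \<in> Hs s" "to_ell2 s (evol a (t - \<tau>) (f \<tau>)) = ?U (t - \<tau>) (F \<tau>)"
      by (auto simp: F_def)
  qed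
  have cont: "continuous_on {0..t} (\<lambda>\<tau>. ?U (t - \<tau>) (F \<tau>))" if "t \<in> I" for t
    by (intro continuous_intros continuous_on_subset[OF F sub(1)[OF that]])
  have cont': "continuous_on {0..t} (\<lambda>\<tau>. ?U (- \<tau>) (F \<tau>))" if "t \<in> I" for t
    by (intro continuous_intros continuous_on_subset[OF F sub(1)[OF that]])
  have int: "integral {0..t} (\<lambda>\<tau>. ?U (t - \<tau>) (F \<tau>)) = ?U t (integral {0..t} (\<lambda>\<tau>. ?U (- \<tau>) (F \<tau>)))" if "t \<in> I" for t
    using integral_linear[OF integrable_continuous_interval[OF cont'[OF that]] bounded_linear_flow, of "phase a" t]
    by (simp add: comp_def flow_flow)
  note u0' = to_ell2_evol[OF u0]
  have step: "(\<exists>w. has_bochner_integral_Hs s (lebesgue_on {0..t}) (\<lambda>\<tau>. evol a (t - \<tau>) (f \<tau>)) w \<and> u t = evol a t u0 + w)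
      \<longleftrightarrow> u t \<in> Hs s \<and> to_ell2 s (u t) = ?U t (to_ell2 s u0 + integral {0..t} (\<lambda>\<tau>. ?U (- \<tau>) (F \<tau>)))" (is "?A \<longleftrightarrow> ?B")
    if t: "t \<in> I" for t
  proof
    assume ?A
    then obtain w where w: "has_bochner_integral_Hs s (lebesgue_on {0..t}) (\<lambda>\<tau>. evol a (t - \<tau>) (f \<tau>)) w" "u t = evol a t u0 + w"
      by blast
    have "w \<in> Hs s" "to_ell2 s w = integral {0..t} (\<lambda>\<tau>. ?U (t - \<tau>) (F \<tau>))"
      using has_bochner_integral_Hs_unique[OF H cont sub(2) w(1)] t by auto
    then show ?B using w(2) u0' by (simp add: Hs_add flow_add int[OF t])
  next
    assume B: ?B
    let ?w = "of_ell2 s (integral {0..t} (\<lambda>\<tau>. ?U (t - \<tau>) (F \<tau>)))"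
    have "has_bochner_integral_Hs s (lebesgue_on {0..t}) (\<lambda>\<tau>. evol a (t - \<tau>) (f \<tau>)) ?w"
      using has_bochner_integral_Hs_continuous[OF H cont sub(2)] t by auto
    moreover have "u t = evol a t u0 + ?w"
      using B u0' of_ell2 by (intro to_ell2_inject[of _ s]) (auto simp: Hs_add flow_add int[OF t])
    ultimately show ?A by blast
  qed
  have "continuous_Hs s I u" if R: ?R
  proof -
    have "continuous_on I (\<lambda>t. integral {0..t} (\<lambda>\<tau>. ?U (- \<tau>) (F \<tau>)))"
      using I
    proof
      assume "I = {0..T}"
      then show ?thesis
        using cont'[of T] by (cases "0 \<le> T") (auto intro!: indefinite_integral_continuous_1 integrable_continuous_interval)
    next
      assume I: "I = {0..}"
      have "continuous_on {0..} (\<lambda>\<tau>. ?U (- \<tau>) (F \<tau>))"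
        using F unfolding I by (intro continuous_intros)
      then show ?thesis unfolding I by (rule continuous_on_integral_upper)
    qed
    then have "continuous_on I (\<lambda>t. ?U t (to_ell2 s u0 + integral {0..t} (\<lambda>\<tau>. ?U (- \<tau>) (F \<tau>))))"
      by (intro continuous_intros)
    then have "continuous_on I (\<lambda>t. to_ell2 s (u t))"
      by (rule continuous_on_eq) (use R in \<open>simp add: F_def\<close>)
    then show ?thesis using R by (simp add: continuous_Hs_iff)
  qed
  then show ?thesis using step unfolding mild_solution_def F_def by blast
qed

section \<open>The control operator in the sequence space\<close>

text \<open>The embedding of \<open>Hs s\<close> into \<open>Hs (s - \<theta>)\<close> as seen on
  sequences; equally, a smoothing operator of order \<theta> at fixed regularity.\<close>

definition lower_weight :: "real \<Rightarrow> ell2 \<Rightarrow> ell2" where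
  "lower_weight \<theta> = mult_ell2 (\<lambda>k. complex_of_real ((1 + \<bar>real_of_int k\<bar>) powr - \<theta>))"

context
  fixes \<theta> :: real assumes \<theta>: "0 \<le> \<theta>"
begin

lemma lower_weight_le_1: "cmod (complex_of_real ((1 + \<bar>real_of_int k\<bar>) powr - \<theta>)) \<le> 1"
proof -
  have "(1 + \<bar>real_of_int k\<bar>) powr - \<theta> \<le> (1 + \<bar>real_of_int k\<bar>) powr 0"
    using \<theta> by (intro powr_mono) auto
  moreover have "1 + \<bar>real_of_int k\<bar> \<noteq> 0" by linarith
  ultimately show ?thesis by simp
qed

lemma entry_lower_weight: "entry (lower_weight \<theta> x) k = (1 + \<bar>real_of_int k\<bar>) powr - \<theta> * entry x k"
  unfolding lower_weight_def by (rule entry_mult_ell2[OF bounded_rangeI[OF lower_weight_le_1]])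

lemma bounded_linear_lower_weight: "bounded_linear (lower_weight \<theta>)"
  unfolding lower_weight_def by (rule bounded_linear_mult_ell2[OF bounded_rangeI[OF lower_weight_le_1]])

lemma norm_lower_weight_le: "norm (lower_weight \<theta> x) \<le> norm x"
  unfolding lower_weight_def using norm_mult_ell2_le[OF lower_weight_le_1] by simp

lemma lower_weight_flow: "lower_weight \<theta> (flow lam t x) = flow lam t (lower_weight \<theta> x)"
  by (rule ell2_eqI) (simp add: entry_lower_weight entry_flow)

end

lemma norm_lower_weight_antimono:
  assumes "0 \<le> \<theta>" "\<theta> \<le> \<eta>" shows "norm (lower_weight \<eta> x) \<le> norm (lower_weight \<theta> x)"
proof -
  have "cmod (entry (lower_weight \<eta> x) k) \<le> 1 * cmod (entry (lower_weight \<theta> x) k)" for k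
    using assms by (simp add: entry_lower_weight norm_mult mult_right_mono powr_mono)
  then show ?thesis using norm_ell2_mono[of "lower_weight \<eta> x" 1] by simp
qed

text \<open>Peetre's inequality, for every \<open>z\<close> between 1 and the ratio of the weights
  and not only for the ratio itself: the mean value theorem below evaluates a power at such an
  intermediate point.\<close>

lemma peetre:
  fixes k l :: int and z :: real
  assumes "z \<in> {min 1 ((1 + \<bar>real_of_int k\<bar>) / (1 + \<bar>real_of_int l\<bar>))..max 1 ((1 + \<bar>real_of_int k\<bar>) / (1 + \<bar>real_of_int l\<bar>))}"
  shows "0 < z" "z powr a \<le> (1 + \<bar>real_of_int (k - l)\<bar>) powr \<bar>a\<bar>"
proof -
  let ?P = "1 + \<bar>real_of_int (k - l)\<bar>"
  have le: "1 + \<bar>real_of_int i\<bar> \<le> (1 + \<bar>real_of_int (i - j)\<bar>) * (1 + \<bar>real_of_int j\<bar>)" for i j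
  proof -
    have "\<bar>real_of_int i\<bar> \<le> \<bar>real_of_int (i - j)\<bar> + \<bar>real_of_int j\<bar>" by simp
    moreover have "0 \<le> \<bar>real_of_int (i - j)\<bar> * \<bar>real_of_int j\<bar>" by simp
    ultimately have "1 + \<bar>real_of_int i\<bar> \<le> 1 + \<bar>real_of_int j\<bar> + \<bar>real_of_int (i - j)\<bar> + \<bar>real_of_int (i - j)\<bar> * \<bar>real_of_int j\<bar>"
      by linarith
    then show ?thesis by (simp add: distrib_left distrib_right add_ac)
  qed
  have "(1 + \<bar>real_of_int k\<bar>) / (1 + \<bar>real_of_int l\<bar>) \<le> ?P"
    using le[of k l] by (simp add: pos_divide_le_eq)
  moreover have "1 / ?P \<le> (1 + \<bar>real_of_int k\<bar>) / (1 + \<bar>real_of_int l\<bar>)"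
  proof -
    have L: "1 + \<bar>real_of_int l\<bar> \<le> (1 + \<bar>real_of_int k\<bar>) * ?P"
      using le[of l k] by (simp add: abs_minus_commute mult.commute)
    have pos: "0 < 1 + \<bar>real_of_int l\<bar>" "0 < ?P" by linarith+
    have "1 / ?P * (1 + \<bar>real_of_int l\<bar>) \<le> 1 + \<bar>real_of_int k\<bar>"
      using L pos_divide_le_eq[OF pos(2)] by simp
    then show ?thesis using pos_le_divide_eq[OF pos(1)] by blast
  qed
  moreover have "1 / ?P \<le> 1" "1 \<le> ?P" by auto
  moreover have "min 1 ((1 + \<bar>real_of_int k\<bar>) / (1 + \<bar>real_of_int l\<bar>)) \<le> z"
      "z \<le> max 1 ((1 + \<bar>real_of_int k\<bar>) / (1 + \<bar>real_of_int l\<bar>))"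
    using assms by auto
  ultimately have z: "z \<le> ?P" "1 / ?P \<le> z" by (smt (verit))+
  have P: "0 < 1 / ?P" by simp
  show z0: "0 < z" using z P by linarith
  show "z powr a \<le> ?P powr \<bar>a\<bar>"
  proof (cases "0 \<le> a")
    case True
    then show ?thesis using z z0 by (simp add: powr_mono2)
  next
    case False
    have "z powr a \<le> (1 / ?P) powr a" using z P False by (intro powr_mono2') auto
    also have "\<dots> = ?P powr \<bar>a\<bar>" using False by (simp add: powr_divide powr_minus_divide)
    finally show ?thesis .
  qed
qed

lemma powr_le_power: "1 \<le> (P::real) \<Longrightarrow> P powr \<bar>a\<bar> \<le> P ^ nat \<lceil>\<bar>a\<bar>\<rceil>"
proof -
  assume "1 \<le> P"
  then have "P powr \<bar>a\<bar> \<le> P powr real (nat \<lceil>\<bar>a\<bar>\<rceil>)" by (intro powr_mono) linarith+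
  moreover have "0 < P" using \<open>1 \<le> P\<close> by linarith
  ultimately show ?thesis by (simp only: powr_realpow)
qed

lemma weight_ratio_le:
  "((1 + \<bar>real_of_int k\<bar>) / (1 + \<bar>real_of_int l\<bar>)) powr a \<le> (1 + \<bar>real_of_int (k - l)\<bar>) ^ nat \<lceil>\<bar>a\<bar>\<rceil>"
  using peetre(2)[of "(1 + \<bar>real_of_int k\<bar>) / (1 + \<bar>real_of_int l\<bar>)" k l a]
    powr_le_power[of "1 + \<bar>real_of_int (k - l)\<bar>" a] by force

text \<open>The origin of the gain of one order. By the mean value theorem the difference contains
  \<open>r - 1\<close>, and multiplied by the weight of \<open>l\<close> this becomes
  \<open>\<bar>k\<bar> - \<bar>l\<bar>\<close>, which is at most \<open>\<bar>k - l\<bar>\<close> in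
  modulus; the intermediate power is handled by Peetre's inequality.\<close>

lemma weight_ratio_diff_le:
  "\<bar>((1 + \<bar>real_of_int k\<bar>) / (1 + \<bar>real_of_int l\<bar>)) powr s - 1\<bar> * (1 + \<bar>real_of_int l\<bar>)
    \<le> \<bar>s\<bar> * (1 + \<bar>real_of_int (k - l)\<bar>) ^ Suc (nat \<lceil>\<bar>s - 1\<bar>\<rceil>)"
proof -
  define r where "r = (1 + \<bar>real_of_int k\<bar>) / (1 + \<bar>real_of_int l\<bar>)"
  let ?P = "1 + \<bar>real_of_int (k - l)\<bar>"
  have r0: "0 < r" by (simp add: r_def)
  have "\<exists>z\<in>{min 1 r..max 1 r}. r powr s - 1 = (r - 1) * (s * z powr (s - 1))"
  proof (cases "r = 1")
    case False
    have D: "((\<lambda>z. z powr s) has_real_derivative s * z powr (s - 1)) (at z)" if "0 < z" for z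
      using that by (auto intro!: derivative_eq_intros)
    show ?thesis
    proof (cases "1 < r")
      case True
      obtain z where "1 < z" "z < r" "r powr s - 1 powr s = (r - 1) * (s * z powr (s - 1))"
        using MVT2[OF True, of "\<lambda>z. z powr s" "\<lambda>z. s * z powr (s - 1)"] D by auto
      then show ?thesis by (intro bexI[of _ z]) auto
    next
      case r: False
      obtain z where "r < z" "z < 1" "1 powr s - r powr s = (1 - r) * (s * z powr (s - 1))"
        using MVT2[of r 1 "\<lambda>z. z powr s" "\<lambda>z. s * z powr (s - 1)"] D r0 r False by auto
      then show ?thesis by (intro bexI[of _ z]) (auto simp: algebra_simps)
    qed
  qed auto
  then obtain z where z: "z \<in> {min 1 r..max 1 r}" "r powr s - 1 = (r - 1) * (s * z powr (s - 1))" by blast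
  have zP: "z powr (s - 1) \<le> ?P ^ nat \<lceil>\<bar>s - 1\<bar>\<rceil>"
    using peetre(2)[OF z(1)[unfolded r_def], of "s - 1"] powr_le_power[of ?P "s - 1"] by simp
  have "(r - 1) * (1 + \<bar>real_of_int l\<bar>) = \<bar>real_of_int k\<bar> - \<bar>real_of_int l\<bar>"
    by (simp add: r_def field_simps)
  then have "\<bar>r - 1\<bar> * (1 + \<bar>real_of_int l\<bar>) = \<bar>\<bar>real_of_int k\<bar> - \<bar>real_of_int l\<bar>\<bar>"
    by (metis abs_mult abs_of_nonneg abs_ge_zero add_nonneg_nonneg zero_le_one)
  then have d: "\<bar>r - 1\<bar> * (1 + \<bar>real_of_int l\<bar>) \<le> ?P" by simp
  have "\<bar>r powr s - 1\<bar> * (1 + \<bar>real_of_int l\<bar>) = \<bar>s\<bar> * ((\<bar>r - 1\<bar> * (1 + \<bar>real_of_int l\<bar>)) * z powr (s - 1))"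
    unfolding z(2) by (simp add: abs_mult)
  also have "\<dots> \<le> \<bar>s\<bar> * (?P * ?P ^ nat \<lceil>\<bar>s - 1\<bar>\<rceil>)"
    by (intro mult_left_mono mult_mono d zP) auto
  finally show ?thesis by (simp add: r_def)
qed

section \<open>The matrix of the control operator and its conjugates by Sobolev weights\<close>

locale control_weight =
  fixes g :: "real \<Rightarrow> real"
  assumes g_smooth: "(\<lambda>x. complex_of_real (g x)) \<in> test_functions"
    and g_nonneg: "\<And>x. g x \<ge> 0"
    and g_integral: "(g has_integral 1) {0..2 * pi}"
begin

definition ghat :: "int \<Rightarrow> complex" where "ghat = tcoef (\<lambda>x. complex_of_real (g x))"

text \<open>The matrix of \<open>G\<close> on Fourier coefficients: multiplication by
  \<open>g\<close> is a convolution, and the product of two coefficients comes from the rank-one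
  term.\<close>

definition gmat :: "int \<Rightarrow> int \<Rightarrow> complex" where "gmat k l = ghat (k - l) - 2 * pi * ghat k * ghat (- l)"

text \<open>Conjugation by the weights, so that \<open>Gs s\<close> is \<open>G\<close> seen through
  \<open>to_ell2 s\<close>.\<close>

definition weighted_gmat :: "real \<Rightarrow> int \<Rightarrow> int \<Rightarrow> complex" where
  "weighted_gmat s k l = complex_of_real (wt s k / wt s l) * gmat k l"

definition Gs :: "real \<Rightarrow> ell2 \<Rightarrow> ell2" where "Gs s = mat_ell2 (weighted_gmat s)"

lemma wt_ratio: "wt s k / wt s l = ((1 + \<bar>real_of_int k\<bar>) / (1 + \<bar>real_of_int l\<bar>)) powr s"
  by (simp add: wt_def powr_divide)

lemma continuous_g: "continuous_on S g"
  using continuous_on_Re[OF test_continuous[OF g_smooth]] by simp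

lemma cnj_ghat: "cnj (ghat k) = ghat (- k)"
  by (simp add: ghat_def tcoef_def integral_cnj cis_cnj)

lemma ghat_0: "2 * pi * ghat 0 = 1"
proof -
  have "((\<lambda>x. complex_of_real (g x)) has_integral of_real 1) {0..2 * pi}"
    by (rule has_integral_of_real[OF g_integral])
  from integral_unique[OF this] show ?thesis by (simp add: ghat_def tcoef_def)
qed

lemma gmat_hermitian: "cnj (gmat l k) = gmat k l"
  by (simp add: gmat_def cnj_ghat mult_ac)

text \<open>Both facts rest on the integral of \<open>g\<close> being 1: \<open>G\<close>
  annihilates constants, and everything in its range has mean zero.\<close>

lemma gmat_0: "gmat k 0 = 0" "gmat 0 l = 0"
proof -
  have "gmat k 0 = ghat k * (1 - 2 * pi * ghat 0)" "gmat 0 l = ghat (- l) * (1 - 2 * pi * ghat 0)"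
    by (simp_all add: gmat_def algebra_simps)
  then show "gmat k 0 = 0" "gmat 0 l = 0" by (simp_all only: ghat_0) simp_all
qed

text \<open>The rank-one part decays in \<open>k\<close> and in \<open>l\<close> separately; this
  controls decay in \<open>k - l\<close>, the weight being submultiplicative.\<close>

lemma gmat_decay:
  obtains C where "0 \<le> C" "\<And>k l. (1 + \<bar>real_of_int (k - l)\<bar>) ^ n * cmod (gmat k l) \<le> C"
proof -
  let ?w = "\<lambda>k::int. (1 + \<bar>real_of_int k\<bar>) ^ n"
  obtain C where C: "0 \<le> C" "\<And>k. ?w k * cmod (ghat k) \<le> C"
    using tcoef_decay[OF g_smooth] unfolding ghat_def by blast
  have "?w (k - l) * cmod (gmat k l) \<le> C + 2 * pi * (C * C)" for k l
  proof -
    have "\<bar>real_of_int (k - l)\<bar> \<le> \<bar>real_of_int k\<bar> + \<bar>real_of_int l\<bar>" by simp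
    moreover have "0 \<le> \<bar>real_of_int k\<bar> * \<bar>real_of_int l\<bar>" by simp
    ultimately have "1 + \<bar>real_of_int (k - l)\<bar> \<le> 1 + \<bar>real_of_int k\<bar> + \<bar>real_of_int l\<bar> + \<bar>real_of_int k\<bar> * \<bar>real_of_int l\<bar>"
      by linarith
    then have "1 + \<bar>real_of_int (k - l)\<bar> \<le> (1 + \<bar>real_of_int k\<bar>) * (1 + \<bar>real_of_int l\<bar>)"
      by (simp add: distrib_left distrib_right add_ac)
    then have "?w (k - l) \<le> ?w k * ?w (- l)"
      unfolding power_mult_distrib[symmetric] by (intro power_mono) auto
    then have "?w (k - l) * cmod (ghat k * ghat (- l)) \<le> (?w k * ?w (- l)) * cmod (ghat k * ghat (- l))"
      by (rule mult_right_mono) simp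
    also have "\<dots> = (?w k * cmod (ghat k)) * (?w (- l) * cmod (ghat (- l)))" by (simp add: norm_mult)
    also have "\<dots> \<le> C * C" using C(1) C(2)[of k] C(2)[of "- l"] by (intro mult_mono) simp_all
    finally have 2: "?w (k - l) * cmod (2 * pi * ghat k * ghat (- l)) \<le> 2 * pi * (C * C)"
      by (simp add: norm_mult mult.left_commute)
    have "?w (k - l) * cmod (gmat k l) \<le> ?w (k - l) * (cmod (ghat (k - l)) + cmod (2 * pi * ghat k * ghat (- l)))"
      unfolding gmat_def by (intro mult_left_mono norm_triangle_ineq4) auto
    then show ?thesis using C(2)[of "k - l"] 2 by (simp add: distrib_left)
  qed
  then show ?thesis using that[of "C + 2 * pi * (C * C)"] C by auto
qed

lemma ex_off_diagonal_bound:
  assumes "\<And>k l. cmod (a k l) \<le> A * ((1 + \<bar>real_of_int (k - l)\<bar>) ^ m * cmod (gmat k l))" "0 \<le> A"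
  shows "\<exists>c. off_diagonal_bound a c"
proof -
  obtain C where C: "0 \<le> C" "\<And>k l. (1 + \<bar>real_of_int (k - l)\<bar>) ^ (m + 2) * cmod (gmat k l) \<le> C"
    using gmat_decay by blast
  have "cmod (a k l) \<le> A * (C * (1 / (1 + \<bar>real_of_int (k - l)\<bar>)\<^sup>2))" for k l
  proof -
    have "(1 + \<bar>real_of_int (k - l)\<bar>) ^ m * cmod (gmat k l) \<le> C * (1 / (1 + \<bar>real_of_int (k - l)\<bar>)\<^sup>2)"
      using C(2)[of k l] by (subst inverse_power_eq[symmetric]) auto
    from mult_left_mono[OF this assms(2)] assms(1)[of k l] show ?thesis by linarith
  qed
  then have "off_diagonal_bound a (\<lambda>j. A * (C * (1 / (1 + \<bar>real_of_int j\<bar>)\<^sup>2)))"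
    unfolding off_diagonal_bound_def
    by (intro conjI allI summable_on_cmult_right summable_on_int_inverse_square) blast
  then show ?thesis by blast
qed

lemma ex_bound_weighted_gmat: "\<exists>c. off_diagonal_bound (weighted_gmat s) c"
proof (rule ex_off_diagonal_bound)
  show "cmod (weighted_gmat s k l) \<le> 1 * ((1 + \<bar>real_of_int (k - l)\<bar>) ^ nat \<lceil>\<bar>s\<bar>\<rceil> * cmod (gmat k l))" for k l
    unfolding weighted_gmat_def wt_ratio norm_mult mult_1
    by (intro mult_right_mono) (simp_all add: weight_ratio_le[simplified])
qed simp

text \<open>The factor in \<open>l\<close> is undone by \<open>lower_weight 1\<close>, so a bound on
  this matrix says that \<open>Gs s - Gs 0\<close> has order -1.\<close>

definition commutator_mat :: "real \<Rightarrow> int \<Rightarrow> int \<Rightarrow> complex" where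
  "commutator_mat s k l = (weighted_gmat s k l - weighted_gmat 0 k l) * (1 + \<bar>real_of_int l\<bar>)"

lemma ex_bound_commutator_mat: "\<exists>c. off_diagonal_bound (commutator_mat s) c"
proof (rule ex_off_diagonal_bound)
  show "cmod (commutator_mat s k l) \<le> \<bar>s\<bar> * ((1 + \<bar>real_of_int (k - l)\<bar>) ^ Suc (nat \<lceil>\<bar>s - 1\<bar>\<rceil>) * cmod (gmat k l))" for k l
  proof -
    let ?r = "(1 + \<bar>real_of_int k\<bar>) / (1 + \<bar>real_of_int l\<bar>)"
    have "0 < ?r" by (intro divide_pos_pos) linarith+
    then have r: "?r powr 0 = 1" by (metis powr_zero_eq_one less_irrefl)
    have "commutator_mat s k l = complex_of_real ((?r powr s - 1) * (1 + \<bar>real_of_int l\<bar>)) * gmat k l"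
      unfolding commutator_mat_def weighted_gmat_def wt_ratio r by (simp add: algebra_simps)
    then have "cmod (commutator_mat s k l) = \<bar>?r powr s - 1\<bar> * (1 + \<bar>real_of_int l\<bar>) * cmod (gmat k l)"
      by (simp only: norm_mult norm_of_real abs_mult)
    also have "\<dots> \<le> \<bar>s\<bar> * (1 + \<bar>real_of_int (k - l)\<bar>) ^ Suc (nat \<lceil>\<bar>s - 1\<bar>\<rceil>) * cmod (gmat k l)"
      by (intro mult_right_mono weight_ratio_diff_le) simp
    finally show ?thesis by (simp only: mult.assoc)
  qed
qed simp

lemma bounded_linear_Gs: "bounded_linear (Gs s)"
  using ex_bound_weighted_gmat[of s] bounded_linear_mat_ell2 unfolding Gs_def by blast

lemma entry_Gs_single: "entry (Gs s (single l z)) k = weighted_gmat s k l * z"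
  using ex_bound_weighted_gmat[of s] entry_mat_ell2_single unfolding Gs_def by blast

lemma entry_Gs_has_sum: "((\<lambda>l. weighted_gmat s k l * entry x l) has_sum entry (Gs s x) k) UNIV"
  using ex_bound_weighted_gmat[of s] entry_mat_ell2_has_sum unfolding Gs_def by blast

lemma Gs_single_0: "Gs s (single 0 z) = 0"
  by (rule ell2_eqI) (simp add: entry_Gs_single weighted_gmat_def gmat_0)

lemma entry_Gs_0: "entry (Gs s x) 0 = 0"
  by (rule has_sum_unique[OF entry_Gs_has_sum]) (auto simp: weighted_gmat_def gmat_0 intro!: has_sum_0)

text \<open>\<open>gmat\<close> is Hermitian, and transposition exchanges the two weights, which
  amounts to replacing \<open>s\<close> by \<open>- s\<close>. In particular \<open>Gs 0\<close> is
  self-adjoint.\<close>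

lemma Gs_adjoint: "inner (Gs s x) y = inner x (Gs (- s) y)"
proof -
  obtain c where "off_diagonal_bound (weighted_gmat s) c" using ex_bound_weighted_gmat by blast
  from mat_ell2_adjoint[OF this, of x y]
  have "inner (Gs s x) y = inner x (mat_ell2 (\<lambda>k l. cnj (weighted_gmat s l k)) y)" by (simp add: Gs_def)
  moreover have "cnj (weighted_gmat s l k) = weighted_gmat (- s) k l" for k l
  proof -
    have "wt s l / wt s k = wt (- s) k / wt (- s) l" by (simp add: wt_def powr_minus divide_simps)
    then show ?thesis by (simp add: weighted_gmat_def gmat_hermitian)
  qed
  ultimately show ?thesis by (simp add: Gs_def)
qed

lemma lower_weight_Gs:
  assumes "0 \<le> \<theta>" shows "lower_weight \<theta> (Gs s x) = Gs (s - \<theta>) (lower_weight \<theta> x)"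
proof (rule bounded_linear_eq_on_singles[where f = "\<lambda>x. lower_weight \<theta> (Gs s x)" and g = "\<lambda>x. Gs (s - \<theta>) (lower_weight \<theta> x)"])
  show "bounded_linear (\<lambda>x. lower_weight \<theta> (Gs s x))" "bounded_linear (\<lambda>x. Gs (s - \<theta>) (lower_weight \<theta> x))"
    by (intro bounded_linear_compose[OF bounded_linear_lower_weight bounded_linear_Gs]
        bounded_linear_compose[OF bounded_linear_Gs bounded_linear_lower_weight] assms)+
  fix l and z :: complex
  have "lower_weight \<theta> (single l z) = single l ((1 + \<bar>real_of_int l\<bar>) powr - \<theta> * z)"
    using assms by (intro ell2_eqI) (simp add: entry_lower_weight entry_single)
  moreover have "(1 + \<bar>real_of_int k\<bar>) powr - \<theta> * (wt s k / wt s l) = wt (s - \<theta>) k / wt (s - \<theta>) l * (1 + \<bar>real_of_int l\<bar>) powr - \<theta>" for k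
    by (simp add: wt_def powr_diff powr_minus divide_simps)
  then have "complex_of_real ((1 + \<bar>real_of_int k\<bar>) powr - \<theta>) * complex_of_real (wt s k / wt s l)
      = complex_of_real (wt (s - \<theta>) k / wt (s - \<theta>) l) * complex_of_real ((1 + \<bar>real_of_int l\<bar>) powr - \<theta>)" for k
    by (simp only: of_real_mult[symmetric])
  then have "complex_of_real ((1 + \<bar>real_of_int k\<bar>) powr - \<theta>) * (weighted_gmat s k l * z)
      = weighted_gmat (s - \<theta>) k l * (complex_of_real ((1 + \<bar>real_of_int l\<bar>) powr - \<theta>) * z)" for k
    unfolding weighted_gmat_def by (simp only: mult.assoc[symmetric]) (simp only: mult_ac)
  ultimately show "lower_weight \<theta> (Gs s (single l z)) = Gs (s - \<theta>) (lower_weight \<theta> (single l z))"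
    using assms by (intro ell2_eqI) (simp only: entry_lower_weight entry_Gs_single)
qed

text \<open>Conjugating \<open>G * G\<close> by the weight \<open>s\<close> changes it only by an operator of order \<open>- 1\<close>.\<close>

lemma Gs_squared_diff_le:
  "\<exists>C\<ge>0. \<forall>x. norm (Gs s (Gs s x) - Gs 0 (Gs 0 x)) \<le> C * norm (lower_weight 1 x)"
proof -
  let ?K = "mat_ell2 (commutator_mat s)"
  obtain c where c: "off_diagonal_bound (commutator_mat s) c" using ex_bound_commutator_mat by blast
  note lin = bounded_linear_mat_ell2[OF c]
  have diff: "Gs s x - Gs 0 x = ?K (lower_weight 1 x)" for x
  proof (rule bounded_linear_eq_on_singles[where f = "\<lambda>x. Gs s x - Gs 0 x" and g = "\<lambda>x. ?K (lower_weight 1 x)"])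
    show "bounded_linear (\<lambda>x. Gs s x - Gs 0 x)" by (intro bounded_linear_sub bounded_linear_Gs)
    show "bounded_linear (\<lambda>x. ?K (lower_weight 1 x))"
      by (rule bounded_linear_compose[OF lin bounded_linear_lower_weight]) simp
    fix l and z :: complex
    define w where "w = complex_of_real (1 + \<bar>real_of_int l\<bar>)"
    have "lower_weight 1 (single l z) = single l (z / w)"
      by (intro ell2_eqI) (simp add: entry_lower_weight entry_single powr_minus_divide w_def)
    moreover
    have "1 + \<bar>real_of_int l\<bar> \<noteq> 0" by linarith
    then have "w \<noteq> 0" unfolding w_def of_real_eq_0_iff .
    moreover have "commutator_mat s k l = (weighted_gmat s k l - weighted_gmat 0 k l) * w" for k
      by (simp add: commutator_mat_def w_def)
    ultimately show "Gs s (single l z) - Gs 0 (single l z) = ?K (lower_weight 1 (single l z))"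
      by (intro ell2_eqI) (simp add: entry_Gs_single entry_mat_ell2_single[OF c] left_diff_distrib diff_divide_distrib)
  qed
  obtain A where A: "0 \<le> A" "\<And>x. norm (Gs s x) \<le> norm x * A" using bounded_linear.nonneg_bounded[OF bounded_linear_Gs] by blast
  obtain B where B: "0 \<le> B" "\<And>x. norm (?K x) \<le> norm x * B" using bounded_linear.nonneg_bounded[OF lin] by blast
  obtain D where D: "0 \<le> D" "\<And>x. norm (Gs (- 1) x) \<le> norm x * D" using bounded_linear.nonneg_bounded[OF bounded_linear_Gs] by blast
  have "norm (Gs s (Gs s x) - Gs 0 (Gs 0 x)) \<le> (B * A + D * B) * norm (lower_weight 1 x)" for x
  proof -
    let ?y = "lower_weight 1 x"
    \<comment> \<open>One factor is exchanged at a time. In the second difference the smoothing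
      stands to the left of \<open>Gs 0\<close>; moving it to the right turns \<open>Gs 0\<close>
      into \<open>Gs (- 1)\<close>.\<close>
    have "Gs s (Gs s x) - Gs 0 (Gs 0 x) = Gs s (Gs s x - Gs 0 x) + (Gs s (Gs 0 x) - Gs 0 (Gs 0 x))"
      by (simp add: linear_diff[OF bounded_linear.linear[OF bounded_linear_Gs]])
    also have "\<dots> = Gs s (?K ?y) + ?K (Gs (- 1) ?y)" by (simp add: diff lower_weight_Gs)
    finally have "norm (Gs s (Gs s x) - Gs 0 (Gs 0 x)) \<le> norm (Gs s (?K ?y)) + norm (?K (Gs (- 1) ?y))"
      using norm_triangle_ineq by metis
    also have "norm (Gs s (?K ?y)) \<le> norm ?y * B * A"
      using A(2)[of "?K ?y"] mult_right_mono[OF B(2)[of ?y] A(1)] by linarith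
    also have "norm (?K (Gs (- 1) ?y)) \<le> norm ?y * D * B"
      using B(2)[of "Gs (- 1) ?y"] mult_right_mono[OF D(2)[of ?y] B(1)] by linarith
    finally show ?thesis by (simp add: algebra_simps)
  qed
  then show ?thesis using A B D by (intro exI[of _ "B * A + D * B"]) auto
qed

subsection \<open>The diagonal of the control matrix\<close>

text \<open>The strict triangle inequality. Equality would force the phase of the exponential to be
  constant wherever \<open>g > 0\<close>, but by continuity this set contains points with different
  phases.\<close>

lemma norm_ghat_less: assumes "k \<noteq> 0" shows "cmod (2 * pi * ghat k) < 1"
proof (rule ccontr)
  assume "\<not> cmod (2 * pi * ghat k) < 1"
  then have z1: "1 \<le> cmod (2 * pi * ghat k)" by simp
  let ?z = "2 * pi * ghat k"
  \<comment> \<open>The unit factor that rotates \<open>?z\<close> onto the positive real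
    axis.\<close>
  define u where "u = cnj ?z / cmod ?z"
  have "cmod u = cmod ?z / cmod ?z" by (simp only: u_def norm_divide norm_of_real abs_norm_cancel complex_mod_cnj)
  moreover have "cmod ?z \<noteq> 0" using z1 by linarith
  ultimately have "cmod u = 1" by (metis divide_self)
  then obtain \<theta> where \<theta>: "u = cis \<theta>" using complex_norm_eq_1_exp by (metis cis_conv_exp)
  have uz: "Re (u * ?z) = cmod ?z"
  proof -
    have "u * ?z = complex_of_real ((cmod ?z)\<^sup>2) / cmod ?z"
      unfolding u_def complex_norm_square by (simp add: mult.commute)
    then show ?thesis using z1 by (simp add: power2_eq_square del: norm_mult)
  qed
  have "((\<lambda>x. complex_of_real (g x) * cis (- (of_int k * x))) has_integral ?z) {0..2 * pi}"
    using integrable_integral[OF tcoef_integrable[OF g_smooth, of k]] by (simp add: ghat_def tcoef_def)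
  from has_integral_Re[OF has_integral_mult_right[OF this, of u]]
  have "((\<lambda>x. g x * cos (\<theta> - of_int k * x)) has_integral cmod ?z) {0..2 * pi}"
    unfolding uz unfolding \<theta>
    by (rule has_integral_eq[rotated]) (simp add: mult.left_commute[of "cis \<theta>"] cis_mult)
  from has_integral_diff[OF g_integral this]
  have i: "((\<lambda>x. g x * (1 - cos (\<theta> - of_int k * x))) has_integral (1 - cmod ?z)) {0..2 * pi}"
    by (simp add: right_diff_distrib)
  have nn: "0 \<le> g x * (1 - cos (\<theta> - of_int k * x))" for x by (simp add: g_nonneg)
  have "1 - cmod ?z = 0" using has_integral_nonneg[OF i] nn z1 by simp
  moreover have "continuous_on {0..2 * pi} (\<lambda>x. g x * (1 - cos (\<theta> - of_int k * x)))"
    by (intro continuous_intros continuous_g)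
  ultimately have zero: "g x * (1 - cos (\<theta> - of_int k * x)) = 0" if "x \<in> {0..2 * pi}" for x
    using has_integral_0_cbox_imp_0[of 0 "2 * pi" "\<lambda>x. g x * (1 - cos (\<theta> - of_int k * x))" x] i nn that
    by (simp add: not_le)
  have "\<exists>x0\<in>{0..2 * pi}. g x0 \<noteq> 0"
  proof (rule ccontr)
    assume "\<not> (\<exists>x0\<in>{0..2 * pi}. g x0 \<noteq> 0)"
    then have "(g has_integral 0) {0..2 * pi}" by (intro has_integral_is_0) auto
    then show False using has_integral_unique[OF g_integral] by force
  qed
  then obtain x0 where x0: "x0 \<in> {0..2 * pi}" "0 < g x0" using g_nonneg by (metis less_eq_real_def)
  have "isCont g x0" using continuous_g[of UNIV] by (simp add: continuous_on_eq_continuous_at)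
  then obtain d where d: "0 < d" "\<And>x. \<bar>x - x0\<bar> < d \<Longrightarrow> 0 < g x"
    using x0(2) unfolding continuous_at_eps_delta dist_real_def
    by (metis abs_diff_less_iff diff_self less_add_same_cancel2 diff_gt_0_iff_gt add.commute diff_add_cancel)
  \<comment> \<open>A step of this length stays where \<open>g\<close> is positive and changes the
    phase \<open>k * x\<close> by at most \<open>pi / 2\<close>, hence not by a multiple of
    \<open>2 * pi\<close>.\<close>
  define e where "e = min (d / 2) (pi / (2 * \<bar>of_int k\<bar>))"
  have k: "1 \<le> \<bar>real_of_int k\<bar>" using assms by linarith
  have e: "0 < e" "e < d" "e \<le> pi / (2 * \<bar>of_int k\<bar>)" using d k by (auto simp: e_def)
  have "pi / (2 * \<bar>real_of_int k\<bar>) \<le> pi / 1" using k by (intro divide_left_mono) auto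
  then have e_pi: "e \<le> pi" using e by linarith
  \<comment> \<open>The direction is chosen so that the second point remains in the period
    interval.\<close>
  define x1 where "x1 = (if x0 \<le> pi then x0 + e else x0 - e)"
  have x1: "x1 \<in> {0..2 * pi}" "\<bar>x1 - x0\<bar> = e" using x0 e e_pi by (auto simp: x1_def)
  have "cos (\<theta> - of_int k * x0) = 1" "cos (\<theta> - of_int k * x1) = 1"
    using zero[OF x0(1)] zero[OF x1(1)] x0(2) d(2)[of x1] x1 e by auto
  then obtain m n :: int where "\<theta> - of_int k * x0 = of_int m * 2 * pi" "\<theta> - of_int k * x1 = of_int n * 2 * pi"
    using cos_one_2pi_int by metis
  then have "of_int k * (x1 - x0) = of_int (m - n) * (2 * pi)" by (simp add: algebra_simps)
  then obtain j :: int where eq: "of_int k * (x1 - x0) = of_int j * (2 * pi)" by blast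
  then have "\<bar>real_of_int k\<bar> * e = \<bar>of_int j\<bar> * (2 * pi)" using x1(2) by (metis abs_mult abs_of_pos pi_gt_zero mult_pos_pos zero_less_numeral)
  moreover have "\<bar>real_of_int k\<bar> * e \<le> pi / 2" using mult_left_mono[OF e(3), of "\<bar>of_int k\<bar>"] k by simp
  moreover have "0 < \<bar>real_of_int k\<bar> * e" using k e by simp
  ultimately have "\<bar>real_of_int j\<bar> * (2 * pi) < 1 * (2 * pi)" "0 < \<bar>real_of_int j\<bar>"
    by (auto simp: zero_less_mult_iff)
  then have "\<bar>real_of_int j\<bar> < 1" "j \<noteq> 0" by auto
  then show False by linarith
qed

text \<open>The diagonal entry of the control matrix. The weights cancel there, so it is the same
  for every \<open>s\<close>.\<close>

definition gdiag :: "int \<Rightarrow> real" where "gdiag k = (1 - (cmod (2 * pi * ghat k))\<^sup>2) / (2 * pi)"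

lemma weighted_gmat_diag: "weighted_gmat s k k = gdiag k"
proof -
  have "2 * pi * (ghat 0 - 2 * pi * ghat k * ghat (- k)) = 1 - (2 * pi * ghat k) * cnj (2 * pi * ghat k)"
    using ghat_0 by (simp add: right_diff_distrib cnj_ghat[symmetric] mult_ac)
  then have "2 * pi * gmat k k = complex_of_real (1 - (cmod (2 * pi * ghat k))\<^sup>2)"
    unfolding gmat_def of_real_diff complex_norm_square by simp
  then have "gmat k k = gdiag k" by (simp add: gdiag_def field_simps)
  then show ?thesis by (simp add: weighted_gmat_def)
qed

lemma gdiag_le: "cmod (complex_of_real (gdiag k)) \<le> 1"
proof -
  have "cmod (2 * pi * ghat k) \<le> 1" 
    using norm_ghat_less[of k] ghat_0 by (cases "k = 0") (auto simp del: norm_mult)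
  then have "(cmod (2 * pi * ghat k))\<^sup>2 \<le> 1" by (simp only: abs_square_le_1 abs_norm_cancel)
  then have "0 \<le> gdiag k" "gdiag k \<le> 1 / (2 * pi)" by (auto simp: gdiag_def divide_right_mono simp del: norm_mult)
  moreover have "1 / (2 * pi) \<le> 1" using pi_ge_two by simp
  ultimately show ?thesis unfolding norm_of_real by linarith
qed

text \<open>For large \<open>k\<close> the coefficients of \<open>g\<close> are small; the remaining
  finitely many are strictly below the critical value, so a maximum does. The choice of
  \<open>N\<close> makes \<open>2 * pi * ghat k\<close> at most 1/2 in modulus beyond it.\<close>

lemma gdiag_bounded_below: "\<exists>\<delta>>0. \<forall>k. k \<noteq> 0 \<longrightarrow> \<delta> \<le> gdiag k"
proof -
  obtain C where C: "0 \<le> C" "\<And>k. (1 + \<bar>real_of_int k\<bar>) ^ 1 * cmod (ghat k) \<le> C"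
    using tcoef_decay[OF g_smooth] unfolding ghat_def by blast
  define b where "b = (\<lambda>k. cmod (2 * pi * ghat k))"
  obtain N :: nat where N: "4 * pi * C \<le> real N" using real_arch_simple by blast
  define S where "S = {k::int. k \<noteq> 0 \<and> \<bar>k\<bar> \<le> int N}"
  have "S \<subseteq> {- int N..int N}" by (auto simp: S_def)
  then have S: "finite S" by (rule finite_subset) simp
  define \<beta> where "\<beta> = Max (insert (1 / 2) (b ` S))"
  have \<beta>1: "\<beta> < 1" unfolding \<beta>_def using S norm_ghat_less by (subst Max_less_iff) (auto simp: S_def b_def simp del: norm_mult)
  have \<beta>0: "1 / 2 \<le> \<beta>" unfolding \<beta>_def using S by (intro Max_ge) auto
  have b: "b k \<le> \<beta>" if "k \<noteq> 0" for k
  proof (cases "k \<in> S")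
    case True
    then show ?thesis unfolding \<beta>_def using S by (intro Max_ge) auto
  next
    case False
    then have "real N \<le> 1 + \<bar>real_of_int k\<bar>" using that by (simp add: S_def)
    then have "real N * cmod (ghat k) \<le> (1 + \<bar>real_of_int k\<bar>) * cmod (ghat k)" by (rule mult_right_mono) simp
    also have "\<dots> \<le> C" using C(2)[of k] by simp
    finally have "real N * cmod (ghat k) \<le> C" .
    then have "4 * pi * C * cmod (ghat k) \<le> C" using mult_right_mono[OF N, of "cmod (ghat k)"] by simp
    then have "C = 0 \<or> 4 * pi * cmod (ghat k) \<le> 1" using C(1) by (metis mult.assoc mult.commute mult_le_cancel_left_pos mult.right_neutral order_le_less)
    moreover have "cmod (ghat k) = 0" if "C = 0" using C(2)[of k] that
      by (auto simp: mult_le_0_iff)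
    ultimately have "b k \<le> 1 / 2" by (auto simp: b_def norm_mult)
    then show ?thesis using \<beta>0 by simp
  qed
  have "(1 - \<beta>\<^sup>2) / (2 * pi) \<le> gdiag k" if "k \<noteq> 0" for k
    using power_mono[OF b[OF that], of 2] by (simp add: gdiag_def b_def divide_right_mono del: norm_mult)
  moreover have "0 < (1 - \<beta>\<^sup>2) / (2 * pi)"
    using \<beta>0 \<beta>1 power_strict_mono[of \<beta> 1 2] by simp
  ultimately show ?thesis by blast
qed

subsection \<open>Action on periodic distributions\<close>

text \<open>The pairings in \<open>G\<close> are limits of symmetric Fourier sums, which a
  reflection of the index turns into symmetric partial sums of the matrix product. The latter is
  summable, so the limits agree.\<close>

lemma to_ell2_G_op:
  assumes v: "v \<in> Hs s" shows "G_op g v \<in> Hs s \<and> to_ell2 s (G_op g v) = Gs s (to_ell2 s v)"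
proof (rule HsI)
  fix k
  let ?g = "\<lambda>x. complex_of_real (g x)"
  let ?e = "\<lambda>x. cis (of_int (- k) * x)"
  have coef: "tcoef (\<lambda>x. ?g x * ?e x) l = ghat (l + k)" for l
  proof -
    have "?e x * cis (- (of_int l * x)) = cis (- (of_int (l + k) * x))" for x
      by (simp add: cis_mult algebra_simps)
    then show ?thesis by (simp only: tcoef_def ghat_def mult.assoc)
  qed
  have "fourier (G_op g v) k = pairing v (\<lambda>x. ?g x * ?e x) / (2 * pi) - pairing v ?g * ghat k"
  proof -
    have "pairing (mult_pdist ?g v) ?e = pairing v (\<lambda>x. ?g x * ?e x)"
      using g_smooth test_cis by (simp only: mult_pdist.rep_eq) auto
    moreover have "pairing (dist_of ?g) ?e = 2 * pi * ghat k"
      using g_smooth test_cis[of "- k"] by (simp add: dist_of.rep_eq ghat_def tcoef_def)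
    moreover have "fourier (G_op g v) k = (pairing (mult_pdist ?g v) ?e - pairing v ?g * pairing (dist_of ?g) ?e) / (2 * pi)"
      unfolding fourier_def exp_conv_cis G_op_def by (simp add: minus_pdist.rep_eq scaleC_pdist.rep_eq)
    ultimately show ?thesis by (simp add: diff_divide_distrib)
  qed
  moreover have "(\<lambda>n. (\<Sum>l\<in>{- int n..int n}. 2 * pi * tcoef (\<lambda>x. ?g x * ?e x) l * fourier v (- l)) / (2 * pi)
      - (\<Sum>l\<in>{- int n..int n}. 2 * pi * tcoef ?g l * fourier v (- l)) * ghat k)
      \<longlonglongrightarrow> pairing v (\<lambda>x. ?g x * ?e x) / (2 * pi) - pairing v ?g * ghat k"
    by (intro tendsto_intros pairing_fourier_series test_mult g_smooth test_cis) simp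
  moreover have "(\<Sum>l\<in>{- int n..int n}. 2 * pi * tcoef (\<lambda>x. ?g x * ?e x) l * fourier v (- l)) / (2 * pi)
      - (\<Sum>l\<in>{- int n..int n}. 2 * pi * tcoef ?g l * fourier v (- l)) * ghat k
      = (\<Sum>l\<in>{- int n..int n}. gmat k l * fourier v l)" for n
  proof -
    have "(\<Sum>l\<in>{- int n..int n}. gmat k l * fourier v l) = (\<Sum>l\<in>{- int n..int n}. gmat k (- l) * fourier v (- l))"
      by (rule sum.reindex_bij_witness[of _ uminus uminus]) auto
    also have "\<dots> = (\<Sum>l\<in>{- int n..int n}. 2 * pi * ghat (l + k) * fourier v (- l) / (2 * pi) - 2 * pi * ghat l * fourier v (- l) * ghat k)"
      by (rule sum.cong) (simp_all add: gmat_def algebra_simps)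
    also have "\<dots> = (\<Sum>l\<in>{- int n..int n}. 2 * pi * ghat (l + k) * fourier v (- l)) / (2 * pi)
      - (\<Sum>l\<in>{- int n..int n}. 2 * pi * ghat l * fourier v (- l)) * ghat k"
      by (simp only: sum_subtractf sum_divide_distrib sum_distrib_right)
    finally show ?thesis unfolding coef ghat_def[symmetric] by (rule sym)
  qed
  ultimately have "(\<lambda>n. \<Sum>l\<in>{- int n..int n}. gmat k l * fourier v l) \<longlonglongrightarrow> fourier (G_op g v) k" by simp
  then have 1: "(\<lambda>n. wt s k * (\<Sum>l\<in>{- int n..int n}. gmat k l * fourier v l)) \<longlonglongrightarrow> wt s k * fourier (G_op g v) k"
    by (intro tendsto_intros)
  have "weighted_gmat s k l * entry (to_ell2 s v) l = wt s k * (gmat k l * fourier v l)" for l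
    by (simp add: weighted_gmat_def entry_to_ell2 v)
  with has_sum_int_LIMSEQ[OF entry_Gs_has_sum[of s k "to_ell2 s v"]]
  have "(\<lambda>n. wt s k * (\<Sum>l\<in>{- int n..int n}. gmat k l * fourier v l)) \<longlonglongrightarrow> entry (Gs s (to_ell2 s v)) k"
    by (simp add: sum_distrib_left)
  from LIMSEQ_unique[OF this 1] show "entry (Gs s (to_ell2 s v)) k = wt s k * fourier (G_op g v) k" .
qed

text \<open>The weight is real, so the conjugations cancel.\<close>

lemma G_adj_eq_G_op: "G_adj g v = G_op g v"
proof -
  let ?g = "\<lambda>x. complex_of_real (g x)"
  have "pairing (G_adj g v) f = pairing (G_op g v) f" for f
  proof (cases "f \<in> test_functions")
    case True
    let ?c = "integral {0..2 * pi} (\<lambda>x. ?g x * f x)"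
    have gf: "(\<lambda>x. ?g x * f x) \<in> test_functions" by (intro test_mult g_smooth True)
    have "cnj (integral {0..2 * pi} (\<lambda>y. cnj (f y) * ?g y)) = ?c"
      by (simp add: integral_cnj mult.commute)
    then have "(\<lambda>x. cnj (G_test g (\<lambda>y. cnj (f y)) x)) = (\<lambda>x. ?g x * f x + (- ?c) * ?g x)"
      by (simp add: G_test_def mult.commute)
    then have "pairing (G_adj g v) f = pairing v (\<lambda>x. ?g x * f x) - ?c * pairing v ?g"
      using g_smooth True pairing_add[OF gf test_cmult[OF g_smooth, of "- ?c"], of v] pairing_cmult[OF g_smooth, of v "- ?c"]
      by (simp add: G_adj.rep_eq)
    then show ?thesis
      using g_smooth True by (simp add: G_op_def minus_pdist.rep_eq scaleC_pdist.rep_eq mult_pdist.rep_eq dist_of.rep_eq)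
  qed (simp add: pairing_outside)
  then show ?thesis by (simp add: pairing_inject[symmetric] ext)
qed

end

lemma to_ell2_const:
  fixes c :: complex
  shows "dist_of (\<lambda>_. c) \<in> Hs s \<and> to_ell2 s (dist_of (\<lambda>_. c)) = single 0 (wt s 0 * c)"
proof (rule HsI)
  fix k
  have "pairing (dist_of (\<lambda>_. c)) (\<lambda>x. exp (- (\<i> * of_int k * complex_of_real x))) = 2 * pi * tcoef (\<lambda>x. c * cis (of_int 0 * x)) k"
    using test_const[of c] test_exp[of k] by (simp only: dist_of.rep_eq) (simp add: tcoef_def exp_conv_cis)
  also have "\<dots> = 2 * pi * (c * of_bool (0 = k))" by (simp only: tcoef_cmult tcoef_cis)
  finally show "entry (single 0 (wt s 0 * c)) k = wt s k * fourier (dist_of (\<lambda>_. c)) k"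
    by (simp add: fourier_def entry_single)
qed

section \<open>Linear evolution equations in the interaction picture\<close>

lemma has_vector_derivative_integral_upper:
  fixes f :: "real \<Rightarrow> 'a::banach"
  assumes "continuous_on {0..} f" "0 \<le> t"
  shows "((\<lambda>t. integral {0..t} f) has_vector_derivative f t) (at t within {0..})"
proof -
  have "((\<lambda>t. integral {0..t} f) has_vector_derivative f t) (at t within {0..t + 1})"
    using assms by (intro integral_has_vector_derivative continuous_on_subset[OF assms(1)]) auto
  moreover have "at t within {0..t + 1} = at t within {0..}"
    using assms by (intro at_within_nhd[of _ "{..<t + 1}"]) auto
  ultimately show ?thesis by simp
qed

lemma norm_integral_exp_le:
  fixes f :: "real \<Rightarrow> 'a::banach"
  assumes "continuous_on {0..t} f" "\<And>\<tau>. \<tau> \<in> {0..t} \<Longrightarrow> norm (f \<tau>) \<le> B * exp (c * \<tau>)" "0 < c" "0 \<le> t" "0 \<le> B"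
  shows "exp (- c * t) * norm (integral {0..t} f) \<le> B / c"
proof -
  have "((\<lambda>\<tau>. B * exp (c * \<tau>) / c) has_vector_derivative B * exp (c * \<tau>)) (at \<tau> within {0..t})" for \<tau>
    unfolding has_real_derivative_iff_has_vector_derivative[symmetric]
    using assms(3) by (auto intro!: derivative_eq_intros)
  from fundamental_theorem_of_calculus[OF assms(4) this]
  have "((\<lambda>\<tau>. B * exp (c * \<tau>)) has_integral (B * exp (c * t) / c - B * exp (c * 0) / c)) {0..t}" by blast
  then have "integral {0..t} (\<lambda>\<tau>. B * exp (c * \<tau>)) = B * exp (c * t) / c - B * exp (c * 0) / c"
    by (rule integral_unique)
  moreover have "norm (integral {0..t} f) \<le> integral {0..t} (\<lambda>\<tau>. B * exp (c * \<tau>))"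
    by (rule integral_norm_bound_integral)
      (use assms in \<open>auto intro!: integrable_continuous_interval continuous_intros\<close>)
  ultimately have "norm (integral {0..t} f) \<le> B * exp (c * t) / c - B * exp (c * 0) / c" by simp
  also have "\<dots> \<le> B * exp (c * t) / c" using assms by simp
  finally have "exp (- c * t) * norm (integral {0..t} f) \<le> exp (- c * t) * (B * exp (c * t) / c)"
    by (intro mult_left_mono) auto
  also have "\<dots> = B / c" by (simp add: exp_minus)
  finally show ?thesis .
qed

text \<open>Picard iteration converges globally in the weighted norm \<open>sup\<^sub>t exp (- 2 * b * t) * norm (v t)\<close>.\<close>

lemma linear_integral_equation:
  fixes A :: "real \<Rightarrow> 'a::banach \<Rightarrow> 'a"
  assumes lin: "\<And>t. linear (A t)" and bound: "\<And>t x. norm (A t x) \<le> b * norm x" and b: "0 < b"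
    and cont: "\<And>S x. continuous_on S x \<Longrightarrow> continuous_on S (\<lambda>t. A t (x t))"
  shows "\<exists>v. continuous_on {0..} v \<and> (\<forall>t\<ge>0. v t = v0 + integral {0..t} (\<lambda>\<tau>. A \<tau> (v \<tau>)))"
proof -
  \<comment> \<open>The exponential weight divides the Lipschitz constant \<open>b\<close> by
    \<open>c\<close>, so twice \<open>b\<close> gives contraction factor 1/2.\<close>
  define c where "c = 2 * b"
  have c: "0 < c" using b by (simp add: c_def)
  \<comment> \<open>Times are clamped at 0 in order to iterate among bounded continuous functions on
    the whole line; the unknown there is \<open>z t\<close>, standing for
    \<open>exp (- c * t) *\<^sub>R v t\<close>.\<close>
  define m :: "real \<Rightarrow> real" where "m = (\<lambda>t. max t 0)"
  define I where "I = (\<lambda>(z :: real \<Rightarrow>\<^sub>C 'a) t. integral {0..t} (\<lambda>\<tau>. A \<tau> (exp (c * \<tau>) *\<^sub>R z \<tau>)))"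
  have cz: "continuous_on S (\<lambda>\<tau>. A \<tau> (exp (c * \<tau>) *\<^sub>R z \<tau>))" for S and z :: "real \<Rightarrow>\<^sub>C 'a"
    by (intro cont continuous_intros continuous_on_apply_bcontfun)
  have I_cont: "continuous_on {0..} (I z)" for z unfolding I_def by (rule continuous_on_integral_upper[OF cz])
  have nz: "norm (A \<tau> (exp (c * \<tau>) *\<^sub>R z \<tau>)) \<le> (b * norm z) * exp (c * \<tau>)" for \<tau> and z :: "real \<Rightarrow>\<^sub>C 'a"
  proof -
    have "norm (A \<tau> (exp (c * \<tau>) *\<^sub>R z \<tau>)) \<le> b * (exp (c * \<tau>) * norm (z \<tau>))" using bound[of \<tau> "exp (c * \<tau>) *\<^sub>R z \<tau>"] by simp
    also have "\<dots> \<le> b * (exp (c * \<tau>) * norm z)" using b by (intro mult_left_mono norm_bounded) auto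
    finally show ?thesis by (simp add: mult_ac)
  qed
  have I_le: "exp (- c * t) * norm (I z t) \<le> norm z / 2" if "0 \<le> t" for z t
    unfolding I_def using norm_integral_exp_le[OF cz nz c that] b by (simp add: c_def)
  define \<phi> where "\<phi> = (\<lambda>z t. exp (- c * m t) *\<^sub>R (v0 + I z (m t)))"
  have \<phi>: "\<phi> z \<in> bcontfun" for z
  proof (rule bcontfun_normI)
    show "continuous_on UNIV (\<phi> z)"
      unfolding \<phi>_def m_def by (intro continuous_intros continuous_on_compose2[OF I_cont]) auto
    fix t
    have m0: "0 \<le> m t" by (simp add: m_def)
    have "norm (\<phi> z t) = exp (- c * m t) * norm (v0 + I z (m t))" by (simp add: \<phi>_def)
    also have "\<dots> \<le> exp (- c * m t) * norm v0 + exp (- c * m t) * norm (I z (m t))"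
      unfolding distrib_left[symmetric] by (intro mult_left_mono norm_triangle_ineq) auto
    also have "\<dots> \<le> 1 * norm v0 + norm z / 2"
      using I_le[OF m0] m0 c by (intro add_mono mult_right_mono) auto
    finally show "norm (\<phi> z t) \<le> norm v0 + norm z / 2" by simp
  qed
  define \<Phi> where "\<Phi> = (\<lambda>z. Bcontfun (\<phi> z))"
  have ap: "apply_bcontfun (\<Phi> z) = \<phi> z" for z unfolding \<Phi>_def by (rule Bcontfun_inverse[OF \<phi>])
  have "dist (\<Phi> z) (\<Phi> y) \<le> 1 / 2 * dist z y" for z y
  proof (rule dist_bound)
    fix t
    have m0: "0 \<le> m t" by (simp add: m_def)
    have "I z (m t) - I y (m t) = I (z - y) (m t)"
    proof -
      have "A \<tau> (exp (c * \<tau>) *\<^sub>R (z - y) \<tau>) = A \<tau> (exp (c * \<tau>) *\<^sub>R z \<tau>) - A \<tau> (exp (c * \<tau>) *\<^sub>R y \<tau>)" for \<tau>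
        by (simp add: scaleR_diff_right linear_diff[OF lin])
      then show ?thesis
        unfolding I_def by (simp add: integral_diff integrable_continuous_interval cz)
    qed
    then have "\<phi> z t - \<phi> y t = exp (- c * m t) *\<^sub>R I (z - y) (m t)"
      unfolding \<phi>_def scaleR_diff_right[symmetric] by simp
    then have "dist (\<phi> z t) (\<phi> y t) = exp (- c * m t) * norm (I (z - y) (m t))"
      by (simp add: dist_norm)
    then show "dist (\<Phi> z t) (\<Phi> y t) \<le> 1 / 2 * dist z y"
      unfolding ap using I_le[OF m0, of "z - y"] by (simp add: dist_norm)
  qed
  then obtain z where z: "\<Phi> z = z" using banach_fix_type[of "1 / 2" \<Phi>] by auto
  define v where "v = (\<lambda>t. exp (c * t) *\<^sub>R z t)"
  have "v t = v0 + integral {0..t} (\<lambda>\<tau>. A \<tau> (v \<tau>))" if "0 \<le> t" for t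
  proof -
    have "z t = exp (- c * t) *\<^sub>R (v0 + I z t)"
      using ap[of z] that unfolding z by (simp add: \<phi>_def m_def)
    then have "v t = (exp (c * t) * exp (- c * t)) *\<^sub>R (v0 + I z t)" by (simp add: v_def)
    also have "exp (c * t) * exp (- c * t) = 1" by (simp flip: exp_add)
    finally show ?thesis by (simp add: I_def v_def)
  qed
  moreover have "continuous_on {0..} v" unfolding v_def by (intro continuous_intros continuous_on_apply_bcontfun)
  ultimately show ?thesis by blast
qed

text \<open>The interaction picture: \<open>flow lam t (v t)\<close> is the solution of the free
  equation damped by \<open>B\<close>. The unbounded generator has disappeared, so derivatives exist
  in the classical sense, one-sided at 0.\<close>

definition solves :: "(int \<Rightarrow> real) \<Rightarrow> (ell2 \<Rightarrow> ell2) \<Rightarrow> (real \<Rightarrow> ell2) \<Rightarrow> bool" where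
  "solves lam B v \<longleftrightarrow>
    (\<forall>t\<ge>0. (v has_vector_derivative - flow lam (- t) (B (flow lam t (v t)))) (at t within {0..}))"

lemma solves_continuous: "solves lam B v \<Longrightarrow> continuous_on {0..} v"
  unfolding solves_def continuous_on_eq_continuous_within
  by (auto intro: has_vector_derivative_continuous)

lemma solves_derivative_within:
  "solves lam B v \<Longrightarrow> t \<in> {0..T} \<Longrightarrow>
    (v has_vector_derivative - flow lam (- t) (B (flow lam t (v t)))) (at t within {0..T})"
  by (rule has_vector_derivative_within_subset[where S = "{0..}"]) (auto simp: solves_def)

context
  fixes lam :: "int \<Rightarrow> real" and B :: "ell2 \<Rightarrow> ell2"
  assumes B: "bounded_linear B"
begin

lemma continuous_interaction:
  "continuous_on S x \<Longrightarrow> continuous_on S (\<lambda>t. flow lam (- t) (B (flow lam t (x t))))"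
  by (intro continuous_intros bounded_linear.continuous_on[OF B])

lemma linear_interaction: "linear (\<lambda>x. - flow lam (- t) (B (flow lam t x)))"
  by (rule linearI)
     (simp_all add: flow_add flow_scale linear_add[OF bounded_linear.linear[OF B]] linear_scale[OF bounded_linear.linear[OF B]])

lemma solves_iff:
  assumes "continuous_on {0..} v"
  shows "solves lam B v \<longleftrightarrow> (\<forall>t\<ge>0. v t = v 0 + integral {0..t} (\<lambda>\<tau>. - flow lam (- \<tau>) (B (flow lam \<tau> (v \<tau>)))))"
    (is "_ \<longleftrightarrow> (\<forall>t\<ge>0. v t = v 0 + integral {0..t} ?F)")
proof
  assume *: "solves lam B v"
  show "\<forall>t\<ge>0. v t = v 0 + integral {0..t} ?F"
  proof (intro allI impI)
    fix t :: real assume t: "0 \<le> t"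
    have "(?F has_integral (v t - v 0)) {0..t}"
      by (intro fundamental_theorem_of_calculus t solves_derivative_within[OF *])
    from integral_unique[OF this] show "v t = v 0 + integral {0..t} ?F" by (simp del: integral_neg)
  qed
next
  assume *: "\<forall>t\<ge>0. v t = v 0 + integral {0..t} ?F"
  show "solves lam B v"
    unfolding solves_def
  proof (intro allI impI)
    fix t :: real assume t: "0 \<le> t"
    have "continuous_on {0..} ?F" using assms by (intro continuous_on_minus continuous_interaction)
    then have "((\<lambda>t. v 0 + integral {0..t} ?F) has_vector_derivative (0 + ?F t)) (at t within {0..})"
      using t by (intro has_vector_derivative_add has_vector_derivative_const has_vector_derivative_integral_upper)
    then have D: "((\<lambda>t. v 0 + integral {0..t} ?F) has_vector_derivative ?F t) (at t within {0..})"
      unfolding add_0_left .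
    show "(v has_vector_derivative ?F t) (at t within {0..})"
      by (rule has_vector_derivative_transform[OF _ _ D]) (use t in simp, rule *[rule_format], simp)
  qed
qed

lemma ex_solves: "\<exists>v. solves lam B v \<and> v 0 = v0"
proof -
  obtain b where b: "0 < b" "\<And>x. norm (B x) \<le> norm x * b" using bounded_linear.pos_bounded[OF B] by blast
  have "\<exists>v. continuous_on {0..} v \<and> (\<forall>t\<ge>0. v t = v0 + integral {0..t} (\<lambda>\<tau>. - flow lam (- \<tau>) (B (flow lam \<tau> (v \<tau>)))))"
  proof (rule linear_integral_equation[where A = "\<lambda>t x. - flow lam (- t) (B (flow lam t x))" and b = b])
    show "linear (\<lambda>x. - flow lam (- t) (B (flow lam t x)))" for t by (rule linear_interaction)
    show "norm (- flow lam (- t) (B (flow lam t x))) \<le> b * norm x" for t x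
      using b(2)[of "flow lam t x"] by (simp add: norm_flow mult.commute)
    show "continuous_on S (\<lambda>t. - flow lam (- t) (B (flow lam t (x t))))" if "continuous_on S x" for S x
      by (intro continuous_on_minus continuous_interaction that)
  qed (rule b(1))
  then obtain v where v: "continuous_on {0..} v" "\<forall>t\<ge>0. v t = v0 + integral {0..t} (\<lambda>\<tau>. - flow lam (- \<tau>) (B (flow lam \<tau> (v \<tau>))))"
    by blast
  then have v0: "v 0 = v0" by simp
  have "solves lam B v" unfolding solves_iff[OF v(1)] v0 by (rule v(2))
  then show ?thesis using v0 by blast
qed

lemma solves_diff: "solves lam B v \<Longrightarrow> solves lam B w \<Longrightarrow> solves lam B (\<lambda>t. v t - w t)"
  unfolding solves_def
proof (intro allI impI)
  fix t :: real
  assume *: "\<forall>t\<ge>0. (v has_vector_derivative - flow lam (- t) (B (flow lam t (v t)))) (at t within {0..})"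
    "\<forall>t\<ge>0. (w has_vector_derivative - flow lam (- t) (B (flow lam t (w t)))) (at t within {0..})" "0 \<le> t"
  have "((\<lambda>t. v t - w t) has_vector_derivative
      (- flow lam (- t) (B (flow lam t (v t)))) - (- flow lam (- t) (B (flow lam t (w t))))) (at t within {0..})"
    using * by (intro has_vector_derivative_diff) auto
  then show "((\<lambda>t. v t - w t) has_vector_derivative - flow lam (- t) (B (flow lam t (v t - w t)))) (at t within {0..})"
    by (simp add: linear_diff[OF linear_interaction])
qed

text \<open>The pulled-back equation depends on time although the original one does not; restarting
  at \<open>T\<close> therefore requires transporting the solution by
  \<open>flow lam T\<close>.\<close>

lemma solves_shift:
  assumes v: "solves lam B v" and T: "0 \<le> T"
  shows "solves lam B (\<lambda>\<tau>. flow lam T (v (T + \<tau>)))"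
  unfolding solves_def
proof (intro allI impI)
  fix t :: real assume t: "0 \<le> t"
  have "(v has_vector_derivative - flow lam (- (T + t)) (B (flow lam (T + t) (v (T + t))))) (at (T + t) within {0..})"
    by (rule v[unfolded solves_def, rule_format]) (use T t in simp)
  then have "(v has_vector_derivative - flow lam (- (T + t)) (B (flow lam (T + t) (v (T + t))))) (at (T + t) within (\<lambda>\<tau>. T + \<tau>) ` {0..})"
    by (rule has_vector_derivative_within_subset) (use T in auto)
  moreover have "((\<lambda>\<tau>. T + \<tau>) has_vector_derivative 1) (at t within {0..})"
    unfolding has_real_derivative_iff_has_vector_derivative[symmetric] by (auto intro!: derivative_eq_intros)
  ultimately have "((v \<circ> (\<lambda>\<tau>. T + \<tau>)) has_vector_derivative 1 *\<^sub>R (- flow lam (- (T + t)) (B (flow lam (T + t) (v (T + t)))))) (at t within {0..})"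
    by (intro vector_diff_chain_within)
  then have "((\<lambda>\<tau>. v (T + \<tau>)) has_vector_derivative - flow lam (- (T + t)) (B (flow lam (T + t) (v (T + t))))) (at t within {0..})"
    by (simp only: comp_def scaleR_one)
  from bounded_linear.has_vector_derivative[OF bounded_linear_flow this, of lam T]
  show "((\<lambda>\<tau>. flow lam T (v (T + \<tau>))) has_vector_derivative - flow lam (- t) (B (flow lam t (flow lam T (v (T + t)))))) (at t within {0..})"
    by (simp add: flow_minus flow_flow add.commute)
qed

end

section \<open>Energy estimates, uniqueness and mild solutions under feedback\<close>

lemma has_derivative_norm_squared:
  assumes "(v has_vector_derivative v') (at t within S)"
  shows "((\<lambda>t. (norm (v t :: 'a::real_inner))\<^sup>2) has_vector_derivative 2 * inner (v t) v') (at t within S)"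
  using bounded_bilinear.has_vector_derivative[OF bounded_bilinear_inner assms assms]
  by (simp add: power2_norm_eq_inner inner_commute[of v'])

text \<open>Gronwall's argument with the integrating factor \<open>exp (- a * t)\<close>. With
  \<open>F = 0\<close> it bounds the growth of solutions; with \<open>a = 1\<close> it compares two
  equations.\<close>

lemma energy_inequality:
  fixes v :: "real \<Rightarrow> 'a::real_inner"
  assumes d: "\<And>t. t \<in> {0..T} \<Longrightarrow> (v has_vector_derivative v' t) (at t within {0..T})"
    and le: "\<And>t. t \<in> {0..T} \<Longrightarrow> 2 * inner (v t) (v' t) \<le> a * (norm (v t))\<^sup>2 + F"
    and a: "0 \<le> a" and F: "0 \<le> F" and T: "0 \<le> T"
  shows "(norm (v T))\<^sup>2 \<le> exp (a * T) * ((norm (v 0))\<^sup>2 + F * T)"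
proof -
  let ?\<phi> = "\<lambda>t. exp (- a * t) * (norm (v t))\<^sup>2"
  let ?d = "\<lambda>t. exp (- a * t) * (2 * inner (v t) (v' t)) + (- a * exp (- a * t)) * (norm (v t))\<^sup>2"
  have "(?\<phi> has_vector_derivative ?d t) (at t within {0..T})" if "t \<in> {0..T}" for t
  proof (rule has_vector_derivative_mult)
    show "((\<lambda>t. exp (- a * t)) has_vector_derivative - a * exp (- a * t)) (at t within {0..T})"
      unfolding has_real_derivative_iff_has_vector_derivative[symmetric]
      by (auto intro!: derivative_eq_intros)
    show "((\<lambda>t. (norm (v t))\<^sup>2) has_vector_derivative 2 * inner (v t) (v' t)) (at t within {0..T})"
      by (rule has_derivative_norm_squared[OF d[OF that]])
  qed
  then have "(?d has_integral (?\<phi> T - ?\<phi> 0)) {0..T}"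
    by (intro fundamental_theorem_of_calculus T)
  moreover have "((\<lambda>t. F) has_integral (F * T)) {0..T}"
    using has_integral_const_real[of F 0 T] T by (simp add: mult.commute)
  moreover have "?d t \<le> F" if "t \<in> {0..T}" for t
  proof -
    have "?d t = exp (- a * t) * (2 * inner (v t) (v' t) - a * (norm (v t))\<^sup>2)" by (simp add: algebra_simps)
    also have "\<dots> \<le> exp (- a * t) * F" using le[OF that] by (intro mult_left_mono) auto
    also have "\<dots> \<le> 1 * F" using F a that by (intro mult_right_mono) auto
    finally show ?thesis by simp
  qed
  ultimately have "?\<phi> T - ?\<phi> 0 \<le> F * T" by (rule has_integral_le)
  then have "exp (a * T) * (exp (- a * T) * (norm (v T))\<^sup>2) \<le> exp (a * T) * ((norm (v 0))\<^sup>2 + F * T)"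
    by (intro mult_left_mono) auto
  moreover have "exp (a * T) * exp (- a * T) = 1" by (simp flip: exp_add)
  ultimately show ?thesis by (metis mult.assoc mult_1)
qed

lemma inner_interaction:
  "inner x (- flow lam (- t) y) = - inner (flow lam t x) y"
  by (simp add: inner_flow)

lemma solves_growth:
  assumes v: "solves lam B v" and b: "\<And>x. norm (B x) \<le> b * norm x" "0 \<le> b" and t: "0 \<le> t"
  shows "norm (v t) \<le> exp (b * t) * norm (v 0)"
proof -
  have "(norm (v t))\<^sup>2 \<le> exp (2 * b * t) * ((norm (v 0))\<^sup>2 + 0 * t)"
  proof (rule energy_inequality[OF solves_derivative_within[OF v]])
    fix \<tau>
    have "\<bar>inner (flow lam \<tau> (v \<tau>)) (B (flow lam \<tau> (v \<tau>)))\<bar> \<le> norm (v \<tau>) * (b * norm (v \<tau>))"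
      by (rule order_trans[OF Cauchy_Schwarz_ineq2 mult_mono]) (use b norm_flow in \<open>auto simp: norm_flow intro: order_trans[OF b(1)]\<close>)
    then show "2 * inner (v \<tau>) (- flow lam (- \<tau>) (B (flow lam \<tau> (v \<tau>)))) \<le> 2 * b * (norm (v \<tau>))\<^sup>2 + 0"
      unfolding inner_interaction by (simp add: power2_eq_square mult.left_commute[of _ b])
  qed (use b t in auto)
  also have "\<dots> = (exp (b * t) * norm (v 0))\<^sup>2"
    by (simp add: power_mult_distrib flip: exp_double mult.assoc)
  finally show ?thesis by (rule power2_le_imp_le) simp
qed

lemma solves_unique:
  assumes B: "bounded_linear B" and v: "solves lam B v" "solves lam B w" "v 0 = w 0" and t: "0 \<le> t"
  shows "v t = w t"
proof -
  obtain b where b: "0 \<le> b" "\<And>x. norm (B x) \<le> norm x * b" using bounded_linear.nonneg_bounded[OF B] by blast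
  have "norm (v t - w t) \<le> exp (b * t) * norm (v 0 - w 0)"
    using solves_growth[OF solves_diff[OF B v(1,2)], of b t] b t by (simp add: mult.commute)
  then show ?thesis using v(3) by simp
qed

text \<open>Existence is Picard iteration carried back by the flow. Conversely any mild solution,
  pulled back, satisfies the same differential equation with the same initial value, so the growth
  bound gives uniqueness. The witness \<open>v\<close> is returned since the decay estimates are
  proved for it.\<close>

theorem mild_solution_feedback:
  assumes B: "bounded_linear B"
    and K: "\<And>v. v \<in> Hs s \<Longrightarrow> K v \<in> Hs s \<and> to_ell2 s (K v) = - B (to_ell2 s v)" and u0: "u0 \<in> Hs s"
  shows "\<exists>u v. mild_solution a s {0..} u0 (\<lambda>t. K (u t)) u \<and>
    (\<forall>w. mild_solution a s {0..} u0 (\<lambda>t. K (w t)) w \<longrightarrow> (\<forall>t\<ge>0. w t = u t)) \<and>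
    solves (phase a) B v \<and> v 0 = to_ell2 s u0 \<and>
    (\<forall>t\<ge>0. u t \<in> Hs s \<and> to_ell2 s (u t) = flow (phase a) t (v t))"
proof -
  let ?U = "flow (phase a)"
  obtain v where v: "solves (phase a) B v" "v 0 = to_ell2 s u0" using ex_solves[OF B] by blast
  define u where "u = (\<lambda>t. of_ell2 s (?U t (v t)))"
  have u: "u t \<in> Hs s" "to_ell2 s (u t) = ?U t (v t)" for t by (simp_all add: u_def of_ell2)
  have contK: "continuous_Hs s {0..} (\<lambda>t. K (w t))" if "continuous_Hs s {0..} w" for w
  proof -
    have w: "\<And>t. t \<in> {0..} \<Longrightarrow> w t \<in> Hs s" "continuous_on {0..} (\<lambda>t. to_ell2 s (w t))"
      using that by (auto simp: continuous_Hs_iff)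
    have "continuous_on {0..} (\<lambda>t. - B (to_ell2 s (w t)))"
      by (intro continuous_on_minus bounded_linear.continuous_on[OF B] w)
    then have "continuous_on {0..} (\<lambda>t. to_ell2 s (K (w t)))"
      by (rule continuous_on_eq) (use K w in auto)
    then show ?thesis using K w by (auto simp: continuous_Hs_iff)
  qed
  have F: "?U (- \<tau>) (to_ell2 s (K (w \<tau>))) = - ?U (- \<tau>) (B (to_ell2 s (w \<tau>)))" if "w \<tau> \<in> Hs s" for w \<tau>
    using K[OF that] by (simp add: flow_minus)
  have "continuous_on {0..} (\<lambda>t. ?U t (v t))"
    by (intro continuous_intros solves_continuous[OF v(1)])
  then have "continuous_Hs s {0..} u" using u by (simp add: continuous_Hs_iff)
  note iff = mild_solution_iff[OF disjI2[OF refl] u0 contK, where a = a]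
  have m1: "mild_solution a s {0..} u0 (\<lambda>t. K (u t)) u"
  proof -
    have "v t = v 0 + integral {0..t} (\<lambda>\<tau>. - ?U (- \<tau>) (B (?U \<tau> (v \<tau>))))" if "0 \<le> t" for t
      using solves_iff[OF B solves_continuous[OF v(1)], THEN iffD1, OF v(1)] that by blast
    moreover have "(\<lambda>\<tau>. ?U (- \<tau>) (to_ell2 s (K (u \<tau>)))) = (\<lambda>\<tau>. - ?U (- \<tau>) (B (?U \<tau> (v \<tau>))))"
      using F u by simp
    ultimately show ?thesis unfolding iff[OF \<open>continuous_Hs s {0..} u\<close>] using u v(2) by (metis atLeast_iff)
  qed
  have m2: "w t = u t" if w: "mild_solution a s {0..} u0 (\<lambda>t. K (w t)) w" and t: "0 \<le> t" for w t
  proof -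
    have cw: "continuous_Hs s {0..} w" using w by (simp add: mild_solution_def)
    then have wH: "w t \<in> Hs s" if "0 \<le> t" for t using that by (simp add: continuous_Hs_iff)
    define y where "y = (\<lambda>t. ?U (- t) (to_ell2 s (w t)))"
    have yw: "to_ell2 s (w t) = ?U t (y t)" for t by (simp add: y_def flow_flow)
    have y_cont: "continuous_on {0..} y"
      unfolding y_def using cw by (intro continuous_intros) (simp add: continuous_Hs_iff)
    have eq: "y t = to_ell2 s u0 + integral {0..t} (\<lambda>\<tau>. - ?U (- \<tau>) (B (?U \<tau> (y \<tau>))))" if "0 \<le> t" for t
    proof -
      have "y t = to_ell2 s u0 + integral {0..t} (\<lambda>\<tau>. ?U (- \<tau>) (to_ell2 s (K (w \<tau>))))"
        using w that unfolding iff[OF cw] by (simp add: y_def flow_flow)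
      also have "integral {0..t} (\<lambda>\<tau>. ?U (- \<tau>) (to_ell2 s (K (w \<tau>)))) = integral {0..t} (\<lambda>\<tau>. - ?U (- \<tau>) (B (?U \<tau> (y \<tau>))))"
        by (rule integral_cong) (simp add: F wH yw)
      finally show ?thesis .
    qed
    have y0: "y 0 = to_ell2 s u0" using eq[of 0] by simp
    have "solves (phase a) B y" unfolding solves_iff[OF B y_cont] y0 using eq by blast
    then have "y t = v t" using solves_unique[OF B _ v(1) _ t] y0 v(2) by simp
    then show ?thesis using yw[of t] u[of t] wH[OF t] by (intro to_ell2_inject[of _ s]) auto
  qed
  show ?thesis
    by (rule exI[of _ u], rule exI[of _ v]) (use m1 m2 u v in \<open>simp only: simp_thms\<close>, blast)
qed

section \<open>Observability and exponential decay\<close>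

text \<open>A solution at regularity \<open>s\<close> is also one at lower regularity: the smoothing
  commutes with the flow and intertwines the two feedbacks.\<close>

lemma solves_lower_weight:
  assumes v: "solves lam B v" and \<theta>: "0 \<le> \<theta>" and B: "\<And>x. lower_weight \<theta> (B x) = B' (lower_weight \<theta> x)"
  shows "solves lam B' (\<lambda>t. lower_weight \<theta> (v t))"
  unfolding solves_def
proof (intro allI impI)
  fix t :: real assume t: "0 \<le> t"
  then have "(v has_vector_derivative - flow lam (- t) (B (flow lam t (v t)))) (at t within {0..})"
    using v by (simp add: solves_def)
  from bounded_linear.has_vector_derivative[OF bounded_linear_lower_weight[OF \<theta>] this]
  show "((\<lambda>t. lower_weight \<theta> (v t)) has_vector_derivative - flow lam (- t) (B' (flow lam t (lower_weight \<theta> (v t))))) (at t within {0..})"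
    by (simp add: linear_neg[OF bounded_linear.linear[OF bounded_linear_lower_weight[OF \<theta>]]] lower_weight_flow[OF \<theta>] B)
qed

context control_weight
begin

definition GG :: "real \<Rightarrow> ell2 \<Rightarrow> ell2" where "GG s x = Gs s (Gs s x)"

lemma bounded_linear_GG: "bounded_linear (GG s)"
  unfolding GG_def[abs_def] by (rule bounded_linear_compose[OF bounded_linear_Gs bounded_linear_Gs])

lemma GG_adjoint: "inner (GG s x) y = inner x (GG (- s) y)"
  by (simp add: GG_def Gs_adjoint)

lemma lower_weight_GG: "0 \<le> \<theta> \<Longrightarrow> lower_weight \<theta> (GG s x) = GG (s - \<theta>) (lower_weight \<theta> x)"
  by (simp add: GG_def lower_weight_Gs)

text \<open>Conservation of the mean, from the vanishing row 0 of the control matrix.\<close>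

lemma solves_entry_0:
  assumes v: "solves lam (GG s) v" and t: "0 \<le> t" shows "entry (v t) 0 = entry (v 0) 0"
proof -
  have "((\<lambda>t. entry (v t) 0) has_vector_derivative 0) (at \<tau> within {0..t})" if "\<tau> \<in> {0..t}" for \<tau>
    using bounded_linear.has_vector_derivative[OF bounded_linear_entry solves_derivative_within[OF v that], of 0]
    by (simp add: entry_flow GG_def entry_Gs_0)
  from fundamental_theorem_of_calculus[OF t this] have "((\<lambda>_. 0) has_integral (entry (v t) 0 - entry (v 0) 0)) {0..t}" .
  then show ?thesis by simp
qed

text \<open>Since the functions \<open>q j\<close> are biorthogonal to the phases, only the diagonal of \<open>G\<close> survives the time integral.\<close>

lemma integral_control:
  assumes q: "biorthogonal_family L lam L UNIV q Q" and L: "0 \<le> L"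
  shows "integral {0..L} (\<lambda>\<tau>. flow lam (- \<tau>) (Gs s (mult_ell2 (\<lambda>j. q j \<tau>) x))) = mult_ell2 (\<lambda>k. complex_of_real (gdiag k)) x"
proof -
  have q_cont: "continuous_on S (q j)" for S j
    using q continuous_on_subset[of UNIV "q j" S] by (auto simp: biorthogonal_family_def)
  have q_le: "cmod (q j t) \<le> Q" for j t using q by (auto simp: biorthogonal_family_def)
  have q_b: "bounded (range (\<lambda>j. q j t))" for t using q_le by (rule bounded_rangeI)
  have q_lin: "linear (mult_ell2 (\<lambda>j. q j t))" for t
    using bounded_linear_mult_ell2[OF q_b] by (rule bounded_linear.linear)
  have Q0: "0 \<le> Q" using order_trans[OF norm_ge_zero q_le] .
  have G_lin: "linear (Gs s)" using bounded_linear_Gs by (rule bounded_linear.linear)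
  let ?f = "\<lambda>x \<tau>. flow lam (- \<tau>) (Gs s (mult_ell2 (\<lambda>j. q j \<tau>) x))"
  have cont: "continuous_on {0..L} (?f x)" for x
    by (intro continuous_intros bounded_linear.continuous_on[OF bounded_linear_Gs] continuous_mult_ell2[where C = Q] q_cont q_le)
  have int: "?f x integrable_on {0..L}" for x using cont by (rule integrable_continuous_interval)
  obtain A where A: "0 \<le> A" "\<And>x. norm (Gs s x) \<le> norm x * A" using bounded_linear.nonneg_bounded[OF bounded_linear_Gs] by blast
  \<comment> \<open>Boundedness carries the identity from single modes, where it is a matrix
    computation, to all sequences.\<close>
  have "bounded_linear (\<lambda>x. integral {0..L} (?f x))"
  proof (rule bounded_linear_intro)
    show "integral {0..L} (?f (x + y)) = integral {0..L} (?f x) + integral {0..L} (?f y)" for x y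
      using integral_add[OF int int, of x y] by (simp add: linear_add[OF q_lin] linear_add[OF G_lin] flow_add)
    show "integral {0..L} (?f (r *\<^sub>R x)) = r *\<^sub>R integral {0..L} (?f x)" for r x
      by (simp add: linear_scale[OF q_lin] linear_scale[OF G_lin] flow_scale)
    show "norm (integral {0..L} (?f x)) \<le> norm x * (Q * A * L)" for x
    proof -
      have "norm (integral {0..L} (?f x)) \<le> (Q * norm x * A) * (L - 0)"
      proof (rule integral_bound[OF L cont])
        fix t
        show "norm (?f x t) \<le> Q * norm x * A"
          unfolding norm_flow using A(2)[of "mult_ell2 (\<lambda>j. q j t) x"] mult_right_mono[OF norm_mult_ell2_le[where d = "\<lambda>j. q j t" and x = x, OF q_le] A(1)]
          by linarith
      qed
      then show ?thesis by (simp add: mult_ac)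
    qed
  qed
  moreover have "bounded_linear (mult_ell2 (\<lambda>k. complex_of_real (gdiag k)))"
    by (intro bounded_linear_mult_ell2 bounded_rangeI[OF gdiag_le])
  moreover have "integral {0..L} (?f (single j z)) = mult_ell2 (\<lambda>k. complex_of_real (gdiag k)) (single j z)" for j z
  proof (rule ell2_eqI)
    fix k
    have "entry (integral {0..L} (?f (single j z))) k = integral {0..L} (\<lambda>\<tau>. entry (?f (single j z) \<tau>) k)"
      using integral_linear[OF int[of "single j z"] bounded_linear_entry[of k]] by (simp add: comp_def)
    also have "(\<lambda>\<tau>. entry (?f (single j z) \<tau>) k) = (\<lambda>\<tau>. (weighted_gmat s k j * z) * (cis (- (lam k * \<tau>)) * q j \<tau>))"
      by (simp add: entry_flow mult_ell2_single[OF q_b] entry_Gs_single mult_ac)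
    also have "integral {0..L} \<dots> = (weighted_gmat s k j * z) * exp_transform L (q j) (lam k)"
      by (simp add: exp_transform_def)
    also have "\<dots> = (weighted_gmat s k j * z) * of_bool (j = k)" using q by (simp add: biorthogonal_family_def)
    also have "\<dots> = entry (mult_ell2 (\<lambda>k. complex_of_real (gdiag k)) (single j z)) k"
      by (simp add: mult_ell2_single bounded_rangeI[OF gdiag_le] entry_single weighted_gmat_diag)
    finally show "entry (integral {0..L} (?f (single j z))) k = entry (mult_ell2 (\<lambda>k. complex_of_real (gdiag k)) (single j z)) k" .
  qed
  ultimately show ?thesis by (rule bounded_linear_eq_on_singles)
qed

text \<open>The diagonal is inverted mode by mode with a uniform bound; mode 0, where it vanishes,
  is left out.\<close>

lemma ex_gdiag_preimage:
  "\<exists>C\<ge>0. \<forall>y. entry y 0 = 0 \<longrightarrow> (\<exists>x. mult_ell2 (\<lambda>k. complex_of_real (gdiag k)) x = y \<and> norm x \<le> C * norm y)"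
proof -
  obtain \<delta> where \<delta>: "0 < \<delta>" "\<And>k. k \<noteq> 0 \<Longrightarrow> \<delta> \<le> gdiag k" using gdiag_bounded_below by blast
  let ?d = "\<lambda>k. if k = 0 then 0 else 1 / complex_of_real (gdiag k)"
  have d: "cmod (?d k) \<le> 1 / \<delta>" for k
  proof (cases "k = 0")
    case False
    then have "0 < gdiag k" "\<delta> \<le> gdiag k" using \<delta>(1) \<delta>(2)[of k] by auto
    then show ?thesis using False \<delta>(1) by (simp add: norm_divide frac_le)
  qed (use \<delta> in simp)
  have d_b: "bounded (range ?d)" by (rule bounded_rangeI[where C = "1 / \<delta>"]) (rule d)
  have "mult_ell2 (\<lambda>k. complex_of_real (gdiag k)) (mult_ell2 ?d y) = y" if "entry y 0 = 0" for y
  proof (rule ell2_eqI)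
    fix k
    have "gdiag k \<noteq> 0" if "k \<noteq> 0" using \<delta>(1) \<delta>(2)[OF that] by auto
    then show "entry (mult_ell2 (\<lambda>k. complex_of_real (gdiag k)) (mult_ell2 ?d y)) k = entry y k"
      using that by (cases "k = 0") (simp_all add: entry_mult_ell2 bounded_rangeI[OF gdiag_le] entry_mult_ell2[OF d_b])
  qed
  moreover have "norm (mult_ell2 ?d y) \<le> 1 / \<delta> * norm y" for y by (rule norm_mult_ell2_le[OF d])
  ultimately have "\<forall>y. entry y 0 = 0 \<longrightarrow> (\<exists>x. mult_ell2 (\<lambda>k. complex_of_real (gdiag k)) x = y \<and> norm x \<le> 1 / \<delta> * norm y)"
    by blast
  then show ?thesis using \<delta>(1) by (intro exI[of _ "1 / \<delta>"]) simp
qed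

text \<open>Controllability by duality: write \<open>y\<close> as the integral produced by a
  control, take the inner product with \<open>y\<close>, and move flow and \<open>G\<close> to the
  other side. The bounded controls yield a bound by the first power of the observation, not only by
  its square.\<close>

lemma observability:
  assumes gap: "gap_condition lam c"
  shows "\<exists>C>0. \<forall>y. entry y 0 = 0 \<longrightarrow> norm y \<le> C * integral {0..1} (\<lambda>\<tau>. norm (Gs 0 (flow lam \<tau> y)))"
proof -
  obtain q Q where q: "biorthogonal_family 1 lam 1 UNIV q Q" using biorthogonal_family_exists[OF gap, of 1] by auto
  obtain C where C: "0 \<le> C" "\<And>y. entry y 0 = 0 \<Longrightarrow> \<exists>x. mult_ell2 (\<lambda>k. complex_of_real (gdiag k)) x = y \<and> norm x \<le> C * norm y"
    using ex_gdiag_preimage by blast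
  have q_cont: "continuous_on S (q j)" for S j
    using q continuous_on_subset[of UNIV "q j" S] by (auto simp: biorthogonal_family_def)
  have q_le: "cmod (q j t) \<le> Q" for j t using q by (auto simp: biorthogonal_family_def)
  have Q0: "0 \<le> Q" using order_trans[OF norm_ge_zero q_le] .
  have "norm y \<le> (Q * C + 1) * integral {0..1} (\<lambda>\<tau>. norm (Gs 0 (flow lam \<tau> y)))" if y0: "entry y 0 = 0" for y
  proof -
    obtain x where x: "mult_ell2 (\<lambda>k. complex_of_real (gdiag k)) x = y" "norm x \<le> C * norm y" using C(2)[OF y0] by blast
    let ?f = "\<lambda>\<tau>. flow lam (- \<tau>) (Gs 0 (mult_ell2 (\<lambda>j. q j \<tau>) x))"
    let ?e = "\<lambda>\<tau>. norm (Gs 0 (flow lam \<tau> y))"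
    have cont: "continuous_on {0..1} ?f"
      by (intro continuous_intros bounded_linear.continuous_on[OF bounded_linear_Gs] continuous_mult_ell2[where C = Q] q_cont q_le)
    have e_cont: "continuous_on {0..1} ?e"
      by (intro continuous_intros bounded_linear.continuous_on[OF bounded_linear_Gs])
    have e0: "0 \<le> integral {0..1} ?e" by (intro integral_nonneg integrable_continuous_interval e_cont) auto
    have "(norm y)\<^sup>2 = inner (integral {0..1} ?f) y"
      using integral_control[OF q, of 0 x] x(1) by (simp add: power2_norm_eq_inner)
    also have "\<dots> = integral {0..1} (\<lambda>\<tau>. inner (?f \<tau>) y)"
      using integral_linear[OF integrable_continuous_interval[OF cont] bounded_linear_inner_left[of y]] by (simp add: comp_def)
    also have "\<dots> \<le> integral {0..1} (\<lambda>\<tau>. (Q * norm x) * ?e \<tau>)"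
    proof (rule integral_le)
      show "(\<lambda>\<tau>. inner (?f \<tau>) y) integrable_on {0..1}" "(\<lambda>\<tau>. (Q * norm x) * ?e \<tau>) integrable_on {0..1}"
        by (intro integrable_continuous_interval continuous_intros cont e_cont)+
      fix \<tau>
      have "inner (?f \<tau>) y = inner (mult_ell2 (\<lambda>j. q j \<tau>) x) (Gs 0 (flow lam \<tau> y))"
        by (simp add: inner_flow Gs_adjoint)
      also have "\<dots> \<le> norm (mult_ell2 (\<lambda>j. q j \<tau>) x) * ?e \<tau>" by (rule norm_cauchy_schwarz)
      also have "\<dots> \<le> (Q * norm x) * ?e \<tau>" by (intro mult_right_mono norm_mult_ell2_le q_le) auto
      finally show "inner (?f \<tau>) y \<le> (Q * norm x) * ?e \<tau>" .
    qed
    also have "\<dots> = (Q * norm x) * integral {0..1} ?e" by simp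
    also have "\<dots> \<le> (Q * (C * norm y)) * integral {0..1} ?e"
      by (intro mult_right_mono mult_left_mono x e0 Q0)
    finally have "norm y * norm y \<le> norm y * (Q * C * integral {0..1} ?e)" by (simp add: power2_eq_square mult_ac)
    then have "norm y \<le> Q * C * integral {0..1} ?e" if "norm y \<noteq> 0" using that by simp
    then have "norm y \<le> Q * C * integral {0..1} ?e" using e0 Q0 C(1) by (cases "norm y = 0") auto
    then show ?thesis using e0 by (simp add: distrib_right)
  qed
  moreover have "0 < Q * C + 1" using Q0 C(1) by (simp add: add_nonneg_pos)
  ultimately show ?thesis by blast
qed

text \<open>Let \<open>E\<close> be the time integral of the observed norm along the damped
  solution. The pulled-back solution moves by at most \<open>A * E\<close>, so observability of the
  free flow through \<open>v 0\<close> bounds \<open>norm (v 0)\<close> by a multiple of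
  \<open>E\<close>. The dissipated energy is at least \<open>2 * E\<^sup>2\<close>, hence a fixed
  fraction of the initial energy.\<close>

lemma decay_one_step:
  assumes gap: "gap_condition lam c"
  shows "\<exists>\<rho>. 0 \<le> \<rho> \<and> \<rho> < 1 \<and> (\<forall>v. solves lam (GG 0) v \<longrightarrow> entry (v 0) 0 = 0 \<longrightarrow> norm (v 1) \<le> \<rho> * norm (v 0))"
proof -
  obtain C where C: "0 < C" "\<And>y. entry y 0 = 0 \<Longrightarrow> norm y \<le> C * integral {0..1} (\<lambda>\<tau>. norm (Gs 0 (flow lam \<tau> y)))"
    using observability[OF gap] by blast
  obtain A where A: "0 \<le> A" "\<And>x. norm (Gs 0 x) \<le> norm x * A" using bounded_linear.nonneg_bounded[OF bounded_linear_Gs] by blast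
  have G_lin: "linear (Gs 0)" using bounded_linear_Gs by (rule bounded_linear.linear)
  \<comment> \<open>The observability constant after the comparison; the lower bound 2 keeps
    \<open>1 - 2 / D\<^sup>2\<close> nonnegative under the root.\<close>
  define D where "D = max 2 (C * (1 + A\<^sup>2))"
  have D: "2 \<le> D" "C * (1 + A\<^sup>2) \<le> D" by (auto simp: D_def)
  have "2\<^sup>2 \<le> D\<^sup>2" using D(1) by (intro power_mono) auto
  then have D4: "4 \<le> D\<^sup>2" by simp
  then have D0: "0 < D\<^sup>2" by linarith
  have D2: "0 < D\<^sup>2" "2 / D\<^sup>2 \<le> 1" "0 < 2 / D\<^sup>2" using D0 D4 by (auto simp only: pos_divide_le_eq zero_less_divide_iff)
  have "norm (v 1) \<le> sqrt (1 - 2 / D\<^sup>2) * norm (v 0)" if v: "solves lam (GG 0) v" and v0: "entry (v 0) 0 = 0" for v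
  proof -
    have v_cont: "continuous_on {0..1} v" by (rule continuous_on_subset[OF solves_continuous[OF v]]) auto
    let ?e = "\<lambda>\<tau>. norm (Gs 0 (flow lam \<tau> (v \<tau>)))"
    have e_cont: "continuous_on {0..1} ?e"
      by (intro continuous_intros bounded_linear.continuous_on[OF bounded_linear_Gs] v_cont)
    define E where "E = integral {0..1} ?e"
    have e_int: "?e integrable_on {0..1}" "(\<lambda>\<tau>. (?e \<tau>)\<^sup>2) integrable_on {0..1}"
      by (intro integrable_continuous_interval continuous_intros e_cont)+
    have "((\<lambda>\<tau>. 2 * inner (v \<tau>) (- flow lam (- \<tau>) (GG 0 (flow lam \<tau> (v \<tau>))))) has_integral ((norm (v 1))\<^sup>2 - (norm (v 0))\<^sup>2)) {0..1}"
      by (intro fundamental_theorem_of_calculus has_derivative_norm_squared solves_derivative_within[OF v]) auto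
    moreover have "2 * inner (v \<tau>) (- flow lam (- \<tau>) (GG 0 (flow lam \<tau> (v \<tau>)))) = - 2 * (?e \<tau>)\<^sup>2" for \<tau>
      unfolding inner_interaction GG_def power2_norm_eq_inner Gs_adjoint by simp
    ultimately have h1: "((\<lambda>\<tau>. - 2 * (?e \<tau>)\<^sup>2) has_integral ((norm (v 1))\<^sup>2 - (norm (v 0))\<^sup>2)) {0..1}" by simp
    have h2: "((\<lambda>\<tau>. - 2 * (?e \<tau>)\<^sup>2) has_integral (- 2 * integral {0..1} (\<lambda>\<tau>. (?e \<tau>)\<^sup>2))) {0..1}"
      by (intro has_integral_mult_right integrable_integral e_int)
    have energy: "(norm (v 1))\<^sup>2 = (norm (v 0))\<^sup>2 - 2 * integral {0..1} (\<lambda>\<tau>. (?e \<tau>)\<^sup>2)"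
      using has_integral_unique[OF h1 h2] by linarith
    have drift: "norm (v \<tau> - v 0) \<le> A * E" if \<tau>: "\<tau> \<in> {0..1}" for \<tau>
    proof -
      let ?F = "\<lambda>\<sigma>. - flow lam (- \<sigma>) (GG 0 (flow lam \<sigma> (v \<sigma>)))"
      have sub: "{0..\<tau>} \<subseteq> {0..1}" using \<tau> by auto
      have "v \<tau> - v 0 = integral {0..\<tau>} ?F"
      proof -
        have "v \<tau> = v 0 + integral {0..\<tau>} ?F"
          by (rule solves_iff[OF bounded_linear_GG solves_continuous[OF v], THEN iffD1, OF v, rule_format])
             (use \<tau> in simp)
        then show ?thesis by (metis add_diff_cancel_left')
      qed
      also have "norm \<dots> \<le> integral {0..\<tau>} (\<lambda>\<sigma>. A * ?e \<sigma>)"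
      proof (rule integral_norm_bound_integral)
        show "?F integrable_on {0..\<tau>}"
          by (intro integrable_continuous_interval continuous_on_minus continuous_interaction[OF bounded_linear_GG]
              continuous_on_subset[OF v_cont sub])
        show "(\<lambda>\<sigma>. A * ?e \<sigma>) integrable_on {0..\<tau>}"
          by (intro integrable_continuous_interval continuous_intros continuous_on_subset[OF e_cont sub])
        show "norm (?F \<sigma>) \<le> A * ?e \<sigma>" for \<sigma>
          using A(2)[of "Gs 0 (flow lam \<sigma> (v \<sigma>))"] by (simp add: norm_flow GG_def mult.commute)
      qed
      also have "\<dots> \<le> integral {0..1} (\<lambda>\<sigma>. A * ?e \<sigma>)"
        using A(1) by (intro integral_subset_le[OF sub] integrable_continuous_interval continuous_intros
            continuous_on_subset[OF e_cont sub] e_cont) auto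
      finally show ?thesis by (simp add: E_def)
    qed
    have E0: "0 \<le> E" unfolding E_def by (intro integral_nonneg e_int) auto
    have "integral {0..1} (\<lambda>\<tau>. norm (Gs 0 (flow lam \<tau> (v 0)))) \<le> integral {0..1} (\<lambda>\<tau>. ?e \<tau> + A * E * A)"
    proof (rule integral_le)
      show "(\<lambda>\<tau>. norm (Gs 0 (flow lam \<tau> (v 0)))) integrable_on {0..1}" "(\<lambda>\<tau>. ?e \<tau> + A * E * A) integrable_on {0..1}"
        by (intro integrable_continuous_interval continuous_intros bounded_linear.continuous_on[OF bounded_linear_Gs] e_cont)+
      fix \<tau> assume \<tau>: "\<tau> \<in> {0..1::real}"
      have "Gs 0 (flow lam \<tau> (v 0)) = Gs 0 (flow lam \<tau> (v \<tau>)) - Gs 0 (flow lam \<tau> (v \<tau> - v 0))"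
        by (simp add: flow_diff linear_diff[OF G_lin])
      then have "norm (Gs 0 (flow lam \<tau> (v 0))) \<le> ?e \<tau> + norm (Gs 0 (flow lam \<tau> (v \<tau> - v 0)))"
        using norm_triangle_ineq4 by metis
      also have "norm (Gs 0 (flow lam \<tau> (v \<tau> - v 0))) \<le> A * E * A"
        using A(2)[of "flow lam \<tau> (v \<tau> - v 0)"] mult_right_mono[OF drift[OF \<tau>] A(1)] by (simp add: norm_flow)
      finally show "norm (Gs 0 (flow lam \<tau> (v 0))) \<le> ?e \<tau> + A * E * A" by simp
    qed
    also have "\<dots> = (1 + A\<^sup>2) * E"
      using integral_add[OF e_int(1) integrable_const_ivl[of "A * E * A" 0 1]]
      by (simp add: E_def algebra_simps power2_eq_square)
    finally have "norm (v 0) \<le> C * ((1 + A\<^sup>2) * E)"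
      using C(2)[OF v0] mult_left_mono[of _ _ C] C(1) by (meson less_imp_le order_trans)
    also have "\<dots> \<le> D * E" using mult_right_mono[OF D(2) E0] by (simp add: mult.assoc)
    finally have "(norm (v 0))\<^sup>2 \<le> (D * E)\<^sup>2" by (intro power_mono) auto
    \<comment> \<open>Cauchy-Schwarz on the unit interval, obtained from the nonnegative integral of
      the square of the observed norm minus \<open>E\<close>.\<close>
    moreover have "E\<^sup>2 \<le> integral {0..1} (\<lambda>\<tau>. (?e \<tau>)\<^sup>2)"
    proof -
      have "((\<lambda>\<tau>. (?e \<tau>)\<^sup>2 - (2 * E) * ?e \<tau> + E\<^sup>2) has_integral (integral {0..1} (\<lambda>\<tau>. (?e \<tau>)\<^sup>2) - (2 * E) * E + E\<^sup>2)) {0..1}"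
        using has_integral_const_real[of "E\<^sup>2" 0 1]
        by (intro has_integral_add has_integral_diff has_integral_mult_right)
           (auto simp: E_def intro!: integrable_integral e_int)
      moreover have "0 \<le> (?e \<tau>)\<^sup>2 - (2 * E) * ?e \<tau> + E\<^sup>2" for \<tau>
        using zero_le_power2[of "?e \<tau> - E"] by (simp add: power2_diff algebra_simps)
      ultimately have "0 \<le> integral {0..1} (\<lambda>\<tau>. (?e \<tau>)\<^sup>2) - (2 * E) * E + E\<^sup>2" by (rule has_integral_nonneg)
      then show ?thesis by (simp add: power2_eq_square)
    qed
    ultimately have "(norm (v 0))\<^sup>2 \<le> D\<^sup>2 * integral {0..1} (\<lambda>\<tau>. (?e \<tau>)\<^sup>2)"
      using mult_left_mono[of "E\<^sup>2" _ "D\<^sup>2"] by (simp add: power_mult_distrib) (smt (verit) zero_le_power2)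
    then have "(norm (v 0))\<^sup>2 / D\<^sup>2 \<le> integral {0..1} (\<lambda>\<tau>. (?e \<tau>)\<^sup>2)" using D2 by (simp add: pos_divide_le_eq mult.commute)
    then have "(norm (v 1))\<^sup>2 \<le> (1 - 2 / D\<^sup>2) * (norm (v 0))\<^sup>2" unfolding energy by (simp add: left_diff_distrib)
    from real_sqrt_le_mono[OF this] show ?thesis by (simp add: real_sqrt_mult)
  qed
  moreover have "0 \<le> sqrt (1 - 2 / D\<^sup>2)" "sqrt (1 - 2 / D\<^sup>2) < 1" using D2 by auto
  ultimately show ?thesis by blast
qed

text \<open>The rate is a parameter while the constant is quantified inside, so that one rate can be
  asserted for all \<open>s\<close>.\<close>

definition decays :: "(int \<Rightarrow> real) \<Rightarrow> real \<Rightarrow> real \<Rightarrow> bool" where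
  "decays lam s \<alpha> \<longleftrightarrow> (\<exists>M\<ge>0. \<forall>v. solves lam (GG s) v \<longrightarrow> entry (v 0) 0 = 0 \<longrightarrow>
     (\<forall>t\<ge>0. norm (v t) \<le> M * exp (- \<alpha> * t) * norm (v 0)))"

text \<open>Between integers a solution grows by at most \<open>exp b\<close>; replacing
  \<open>t\<close> by its integer part costs a further factor \<open>exp \<alpha>\<close>.\<close>

lemma decays_discrete:
  assumes M: "0 \<le> M" and \<alpha>: "0 \<le> \<alpha>"
    and d: "\<And>v n. solves lam (GG s) v \<Longrightarrow> entry (v 0) 0 = 0 \<Longrightarrow> norm (v (real n)) \<le> M * exp (- \<alpha>) ^ n * norm (v 0)"
  shows "decays lam s \<alpha>"
proof -
  obtain b where b: "0 \<le> b" "\<And>x. norm (GG s x) \<le> norm x * b" using bounded_linear.nonneg_bounded[OF bounded_linear_GG] by blast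
  have "norm (v t) \<le> (exp b * M * exp \<alpha>) * exp (- \<alpha> * t) * norm (v 0)"
    if v: "solves lam (GG s) v" "entry (v 0) 0 = 0" and t: "0 \<le> t" for v t
  proof -
    define n where "n = nat \<lfloor>t\<rfloor>"
    have n: "real n \<le> t" "t \<le> real n + 1" using t unfolding n_def by linarith+
    let ?w = "\<lambda>\<tau>. flow lam (real n) (v (real n + \<tau>))"
    have w: "solves lam (GG s) ?w" by (rule solves_shift[OF bounded_linear_GG v(1)]) simp
    have "norm (?w (t - real n)) \<le> exp (b * (t - real n)) * norm (?w 0)"
      using b n by (intro solves_growth[OF w]) (simp_all add: mult.commute)
    also have "\<dots> \<le> exp b * norm (?w 0)"
      using n b mult_left_mono[of "t - real n" 1 b] by (intro mult_right_mono) auto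
    finally have "norm (v t) \<le> exp b * norm (v (real n))" by (simp add: norm_flow)
    also have "\<dots> \<le> exp b * (M * exp (- \<alpha>) ^ n * norm (v 0))" by (intro mult_left_mono d v) auto
    also have "exp (- \<alpha>) ^ n = exp (- \<alpha> * real n)" by (simp add: exp_of_nat_mult[symmetric] mult.commute)
    also have "exp b * (M * exp (- \<alpha> * real n) * norm (v 0)) \<le> exp b * (M * (exp \<alpha> * exp (- \<alpha> * t)) * norm (v 0))"
    proof -
      have "\<alpha> * t \<le> \<alpha> * (real n + 1)" using n \<alpha> by (intro mult_left_mono) auto
      then have "exp (- \<alpha> * real n) \<le> exp (\<alpha> + - \<alpha> * t)" by (simp add: algebra_simps)
      then show ?thesis unfolding exp_add[symmetric] using M by (intro mult_left_mono mult_right_mono) auto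
    qed
    finally show ?thesis by (simp add: mult_ac)
  qed
  then show ?thesis unfolding decays_def using M by (intro exI[of _ "exp b * M * exp \<alpha>"]) auto
qed

text \<open>The solution is compared with the one at \<open>s = 0\<close> having the same initial
  value. Their difference satisfies the dissipative equation at \<open>s = 0\<close> with a forcing
  bounded by \<open>F\<close>.\<close>

lemma decays_perturbation_step:
  assumes \<rho>: "\<And>v. solves lam (GG 0) v \<Longrightarrow> entry (v 0) 0 = 0 \<Longrightarrow> norm (v 1) \<le> \<rho> * norm (v 0)"
    and v: "solves lam (GG s) v" "entry (v 0) 0 = 0"
    and F: "\<And>t. t \<in> {0..1} \<Longrightarrow> norm (GG s (flow lam t (v t)) - GG 0 (flow lam t (v t))) \<le> F" "0 \<le> F"
  shows "norm (v 1) \<le> \<rho> * norm (v 0) + 2 * F"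
proof -
  obtain w where w: "solves lam (GG 0) w" "w 0 = v 0" using ex_solves[OF bounded_linear_GG] by blast
  have G_lin: "linear (GG 0)" using bounded_linear_GG by (rule bounded_linear.linear)
  let ?d = "\<lambda>t. v t - w t"
  let ?R = "\<lambda>t. GG s (flow lam t (v t)) - GG 0 (flow lam t (v t))"
  have "(norm (?d 1))\<^sup>2 \<le> exp (1 * 1) * ((norm (?d 0))\<^sup>2 + F\<^sup>2 * 1)"
  proof (rule energy_inequality)
    fix t :: real assume t: "t \<in> {0..1}"
    have "(?d has_vector_derivative - flow lam (- t) (GG s (flow lam t (v t))) - - flow lam (- t) (GG 0 (flow lam t (w t)))) (at t within {0..1})"
      by (intro has_vector_derivative_diff solves_derivative_within v w t)
    also have "- flow lam (- t) (GG s (flow lam t (v t))) - - flow lam (- t) (GG 0 (flow lam t (w t)))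
        = - flow lam (- t) (GG 0 (flow lam t (?d t)) + ?R t)"
      by (simp add: flow_add flow_diff linear_diff[OF G_lin])
    finally show "(?d has_vector_derivative - flow lam (- t) (GG 0 (flow lam t (?d t)) + ?R t)) (at t within {0..1})" .
    have "inner (flow lam t (?d t)) (GG 0 (flow lam t (?d t))) = (norm (Gs 0 (flow lam t (?d t))))\<^sup>2"
      by (simp add: GG_def power2_norm_eq_inner Gs_adjoint)
    moreover have "- inner (flow lam t (?d t)) (?R t) \<le> norm (?d t) * F"
    proof -
      have "\<bar>inner (flow lam t (?d t)) (?R t)\<bar> \<le> norm (flow lam t (?d t)) * norm (?R t)" by (rule Cauchy_Schwarz_ineq2)
      also have "\<dots> \<le> norm (?d t) * F" unfolding norm_flow by (intro mult_left_mono F t) auto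
      finally show ?thesis by linarith
    qed
    moreover have "2 * (norm (?d t) * F) \<le> (norm (?d t))\<^sup>2 + F\<^sup>2"
      using sum_squares_bound[of "norm (?d t)" F] by simp
    moreover have "0 \<le> (norm (Gs 0 (flow lam t (?d t))))\<^sup>2" by simp
    ultimately have "2 * - (inner (flow lam t (?d t)) (GG 0 (flow lam t (?d t))) + inner (flow lam t (?d t)) (?R t)) \<le> (norm (?d t))\<^sup>2 + F\<^sup>2"
      by (smt (verit))
    then show "2 * inner (?d t) (- flow lam (- t) (GG 0 (flow lam t (?d t)) + ?R t)) \<le> 1 * (norm (?d t))\<^sup>2 + F\<^sup>2"
      unfolding inner_interaction inner_add_right mult_1 .
  qed (use F in auto)
  \<comment> \<open>The difference starts at 0, and e is below 4.\<close>
  also have "\<dots> \<le> 2\<^sup>2 * F\<^sup>2" using exp_le w(2) by (auto intro!: mult_right_mono)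
  also have "\<dots> = (2 * F)\<^sup>2" by (simp add: power_mult_distrib)
  finally have "norm (?d 1) \<le> 2 * F" by (rule power2_le_imp_le) (use F in auto)
  moreover have "norm (w 1) \<le> \<rho> * norm (v 0)" using \<rho>[OF w(1)] w(2) v(2) by simp
  moreover have "norm (v 1) \<le> norm (w 1) + norm (?d 1)" using norm_triangle_ineq[of "w 1" "?d 1"] by simp
  ultimately show ?thesis by linarith
qed

text \<open>The bound reproduces itself because
  \<open>\<rho> * M + M * (r - \<rho>) = M * r\<close>; it needs the forcing rate \<open>r\<close>
  to be strictly larger than the contraction factor \<rho>.\<close>

lemma recurrence_le:
  fixes a :: "nat \<Rightarrow> real"
  assumes "\<And>n. a (Suc n) \<le> \<rho> * a n + K * r ^ n" "0 \<le> \<rho>" "\<rho> < r" "0 \<le> K" "0 \<le> i" "a 0 \<le> i" "K \<le> M * (r - \<rho>)" "i \<le> M"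
  shows "a n \<le> M * r ^ n"
proof (induction n)
  case (Suc n)
  have "a (Suc n) \<le> \<rho> * (M * r ^ n) + M * (r - \<rho>) * r ^ n"
  proof -
    have "0 \<le> r ^ n" using assms(2,3) by simp
    from assms(1)[of n] mult_left_mono[OF Suc assms(2)] mult_right_mono[OF assms(7) this] show ?thesis by linarith
  qed
  also have "\<dots> = M * r ^ Suc n" by (simp add: algebra_simps)
  finally show ?case .
qed (use assms in simp)

text \<open>Bootstrap in the regularity. The forcing at level \<open>s\<close> is bounded by the
  solution at level \<open>s - min 1 s\<close>, known to decay like \<open>r ^ n\<close>; the
  one-step contraction \<rho> at \<open>s = 0\<close> is smaller than \<open>r\<close>, so level
  \<open>s\<close> inherits the same \<open>r\<close>.\<close>

theorem decays_nonneg: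
  assumes gap: "gap_condition lam c"
  shows "\<exists>\<alpha>>0. \<forall>s\<ge>0. decays lam s \<alpha>"
proof -
  obtain \<rho> where \<rho>: "0 \<le> \<rho>" "\<rho> < 1" "\<And>v. solves lam (GG 0) v \<Longrightarrow> entry (v 0) 0 = 0 \<Longrightarrow> norm (v 1) \<le> \<rho> * norm (v 0)"
    using decay_one_step[OF gap] by blast
  \<comment> \<open>Any value strictly between \<rho> and 1 would do; fixing it once makes the rate
    common to all levels.\<close>
  define r where "r = (\<rho> + 1) / 2"
  define \<alpha> where "\<alpha> = - ln r"
  have r: "\<rho> < r" "0 < r" "r < 1" using \<rho> by (auto simp: r_def)
  have \<alpha>: "0 < \<alpha>" "exp (- \<alpha>) = r" using r by (auto simp: \<alpha>_def)
  have shift: "solves lam (GG s) (\<lambda>\<tau>. flow lam (real n) (v (real n + \<tau>)))" "entry (flow lam (real n) (v (real n + 0))) 0 = 0"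
    if "solves lam (GG s) v" "entry (v 0) 0 = 0" for s v n
    using that solves_shift[OF bounded_linear_GG that(1)] solves_entry_0[OF that(1), of "real n"] by (auto simp: entry_flow)
  have 0: "decays lam 0 \<alpha>"
  proof (rule decays_discrete[where M = 1])
    fix v n assume v: "solves lam (GG 0) v" "entry (v 0) 0 = 0"
    have "norm (v (real n)) \<le> r ^ n * norm (v 0)"
    proof (induction n)
      case (Suc n)
      have "norm (v (real n + 1)) \<le> \<rho> * norm (v (real n))"
        using \<rho>(3)[OF shift(1)[OF v]] shift(2)[OF v] by (simp add: norm_flow)
      also have "\<dots> \<le> r * (r ^ n * norm (v 0))" using Suc r \<rho> by (intro mult_mono) auto
      finally show ?case by (simp add: add.commute)
    qed simp
    then show "norm (v (real n)) \<le> 1 * exp (- \<alpha>) ^ n * norm (v 0)" by (simp add: \<alpha>)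
  qed (use \<alpha> in auto)
  have step: "decays lam s \<alpha>" if s: "0 < s" and IH: "decays lam (s - min 1 s) \<alpha>" for s
  proof -
    \<comment> \<open>A full order is gained where possible; for \<open>s < 1\<close> the smaller
      step lands exactly on the base level 0.\<close>
    define \<theta> where "\<theta> = min 1 s"
    have \<theta>: "0 \<le> \<theta>" "\<theta> \<le> 1" using s by (auto simp: \<theta>_def)
    obtain M0 where M0: "0 \<le> M0" "\<And>v t. solves lam (GG (s - \<theta>)) v \<Longrightarrow> entry (v 0) 0 = 0 \<Longrightarrow> 0 \<le> t \<Longrightarrow>
        norm (v t) \<le> M0 * exp (- \<alpha> * t) * norm (v 0)"
      using IH unfolding decays_def \<theta>_def by blast
    obtain C where C: "0 \<le> C" "\<And>x. norm (Gs s (Gs s x) - Gs 0 (Gs 0 x)) \<le> C * norm (lower_weight 1 x)"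
      using Gs_squared_diff_le by blast
    define K where "K = 2 * (C * M0)"
    have K: "0 \<le> K" using C M0 by (simp add: K_def)
    define M where "M = 1 + K / (r - \<rho>)"
    have M: "0 \<le> M" using K r by (simp add: M_def)
    show ?thesis
    proof (rule decays_discrete[where M = M])
      fix v n assume v: "solves lam (GG s) v" "entry (v 0) 0 = 0"
      have low: "norm (lower_weight \<theta> (v t)) \<le> M0 * exp (- \<alpha> * t) * norm (v 0)" if "0 \<le> t" for t
      proof -
        have "norm (lower_weight \<theta> (v t)) \<le> M0 * exp (- \<alpha> * t) * norm (lower_weight \<theta> (v 0))"
          using M0(2)[OF solves_lower_weight[OF v(1) \<theta>(1) lower_weight_GG[OF \<theta>(1)]] _ that] v(2) \<theta>
          by (simp add: entry_lower_weight)
        also have "\<dots> \<le> M0 * exp (- \<alpha> * t) * norm (v 0)"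
          using M0(1) norm_lower_weight_le[OF \<theta>(1)] by (intro mult_left_mono) auto
        finally show ?thesis .
      qed
      have "norm (v (real (Suc n))) \<le> \<rho> * norm (v (real n)) + (K * norm (v 0)) * r ^ n" for n
      proof -
        let ?w = "\<lambda>\<tau>. flow lam (real n) (v (real n + \<tau>))"
        have "norm (?w 1) \<le> \<rho> * norm (?w 0) + 2 * (C * (M0 * r ^ n * norm (v 0)))"
        proof (rule decays_perturbation_step[OF \<rho>(3) shift[OF v]])
          fix t :: real assume t: "t \<in> {0..1}"
          have "norm (lower_weight 1 (flow lam t (?w t))) \<le> norm (lower_weight \<theta> (v (real n + t)))"
            using norm_lower_weight_antimono[OF \<theta>] by (simp add: lower_weight_flow norm_flow)
          also have "\<dots> \<le> M0 * exp (- \<alpha> * (real n + t)) * norm (v 0)" using t by (intro low) auto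
          also have "\<dots> \<le> M0 * r ^ n * norm (v 0)"
          proof -
            have "exp (- \<alpha> * (real n + t)) \<le> exp (- \<alpha> * real n)" using \<alpha> t by (simp add: algebra_simps)
            also have "\<dots> = r ^ n" unfolding \<alpha>(2)[symmetric] by (simp add: exp_of_nat_mult[symmetric] mult.commute)
            finally show ?thesis using M0(1) by (intro mult_left_mono mult_right_mono) auto
          qed
          finally have "C * norm (lower_weight 1 (flow lam t (?w t))) \<le> C * (M0 * r ^ n * norm (v 0))"
            by (intro mult_left_mono C)
          then show "norm (GG s (flow lam t (?w t)) - GG 0 (flow lam t (?w t))) \<le> C * (M0 * r ^ n * norm (v 0))"
            using C(2)[of "flow lam t (?w t)"] by (simp add: GG_def)
        qed (use C M0 r in auto)
        then show ?thesis by (simp add: norm_flow K_def mult_ac add.commute)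
      qed
      then have "norm (v (real n)) \<le> M * norm (v 0) * r ^ n"
      proof (rule recurrence_le[where i = "norm (v 0)"])
        have "K \<le> M * (r - \<rho>)" using r K by (simp add: M_def distrib_right)
        from mult_right_mono[OF this, of "norm (v 0)"]
        show "K * norm (v 0) \<le> M * norm (v 0) * (r - \<rho>)" by (simp add: mult_ac)
        have "1 \<le> M" using K r by (simp add: M_def)
        then show "norm (v 0) \<le> M * norm (v 0)" using mult_right_mono[of 1 M "norm (v 0)"] by simp
      qed (use \<rho> r K in auto)
      then show "norm (v (real n)) \<le> M * exp (- \<alpha>) ^ n * norm (v 0)" by (simp add: \<alpha> mult_ac)
    qed (use M \<alpha> in auto)
  qed
  \<comment> \<open>One unit strip of regularities after another, each reduced to the preceding one
    or to 0.\<close>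
  have "\<forall>s. 0 \<le> s \<and> s \<le> real N \<longrightarrow> decays lam s \<alpha>" for N
  proof (induction N)
    case 0
    show ?case
    proof (intro allI impI)
      fix s :: real assume "0 \<le> s \<and> s \<le> real 0"
      then have "s = 0" by simp
      then show "decays lam s \<alpha>" using \<open>decays lam 0 \<alpha>\<close> by simp
    qed
  next
    case (Suc N)
    show ?case
    proof (intro allI impI)
      fix s :: real assume s: "0 \<le> s \<and> s \<le> real (Suc N)"
      show "decays lam s \<alpha>"
      proof (cases "s = 0")
        case False
        with s have "0 < s" "0 \<le> s - min 1 s" "s - min 1 s \<le> real N" by auto
        then show ?thesis using Suc step by blast
      qed (use 0 in simp)
    qed
  qed
  then have "decays lam s \<alpha>" if "0 \<le> s" for s using that real_arch_simple[of s] by blast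
  then show ?thesis using \<alpha>(1) by blast
qed

lemma decays_mono: "decays lam s \<alpha> \<Longrightarrow> \<beta> \<le> \<alpha> \<Longrightarrow> decays lam s \<beta>"
  unfolding decays_def
proof (elim exE conjE, intro exI conjI allI impI)
  fix M v and t :: real
  assume *: "\<forall>v. solves lam (GG s) v \<longrightarrow> entry (v 0) 0 = 0 \<longrightarrow> (\<forall>t\<ge>0. norm (v t) \<le> M * exp (- \<alpha> * t) * norm (v 0))"
    "0 \<le> M" "\<beta> \<le> \<alpha>" "solves lam (GG s) v" "entry (v 0) 0 = 0" "0 \<le> t"
  then have "norm (v t) \<le> M * exp (- \<alpha> * t) * norm (v 0)" by blast
  also have "\<dots> \<le> M * exp (- \<beta> * t) * norm (v 0)" using * by (intro mult_right_mono mult_left_mono) (auto simp: mult_right_mono)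
  finally show "norm (v t) \<le> M * exp (- \<beta> * t) * norm (v 0)" .
qed

text \<open>The adjoint of the equation at regularity \<open>- s\<close> is the equation at regularity \<open>s\<close> with reversed phases.\<close>

lemma decays_dual:
  assumes d: "decays (\<lambda>k. - lam k) s \<alpha>" shows "decays lam (- s) \<alpha>"
proof -
  obtain M where M: "0 \<le> M" "\<And>v t. solves (\<lambda>k. - lam k) (GG s) v \<Longrightarrow> entry (v 0) 0 = 0 \<Longrightarrow> 0 \<le> t \<Longrightarrow>
      norm (v t) \<le> M * exp (- \<alpha> * t) * norm (v 0)"
    using d unfolding decays_def by blast
  have "norm (v t) \<le> M * exp (- \<alpha> * t) * norm (v 0)"
    if v: "solves lam (GG (- s)) v" "entry (v 0) 0 = 0" and t: "0 \<le> t" for v t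
  proof -
    \<comment> \<open>The dual solution is started from the final state, so its pairing with the
      solution is the squared norm of \<open>v t\<close> at the final time. The pairing is constant
      because \<open>GG s\<close> and \<open>GG (- s)\<close> are adjoint, and at time 0 it involves
      the decayed value of \<open>y\<close>.\<close>
    obtain y where y: "solves (\<lambda>k. - lam k) (GG s) y" "y 0 = flow lam t (v t)" using ex_solves[OF bounded_linear_GG] by blast
    let ?K = "\<lambda>\<tau>. inner (flow lam t (v \<tau>)) (y (t - \<tau>))"
    have "(?K has_vector_derivative 0) (at \<tau> within {0..t})" if \<tau>: "\<tau> \<in> {0..t}" for \<tau>
    proof -
      have dv: "((\<lambda>\<tau>. flow lam t (v \<tau>)) has_vector_derivative - flow lam (t - \<tau>) (GG (- s) (flow lam \<tau> (v \<tau>)))) (at \<tau> within {0..t})"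
        using bounded_linear.has_vector_derivative[OF bounded_linear_flow solves_derivative_within[OF v(1) \<tau>], of lam t]
        by (simp add: flow_minus flow_flow)
      let ?y' = "- flow lam (t - \<tau>) (GG s (flow lam (- (t - \<tau>)) (y (t - \<tau>))))"
      have "(y has_vector_derivative ?y') (at (t - \<tau>) within {0..t})"
        using solves_derivative_within[OF y(1), of "t - \<tau>" t] \<tau> by (simp add: flow_uminus)
      then have "(y has_vector_derivative ?y') (at (t - \<tau>) within (\<lambda>\<tau>. t - \<tau>) ` {0..t})"
        by (rule has_vector_derivative_within_subset) auto
      moreover have "((\<lambda>\<tau>. t - \<tau>) has_vector_derivative - 1) (at \<tau> within {0..t})"
        unfolding has_real_derivative_iff_has_vector_derivative[symmetric] by (auto intro!: derivative_eq_intros)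
      ultimately have "((y \<circ> (\<lambda>\<tau>. t - \<tau>)) has_vector_derivative (- 1) *\<^sub>R ?y') (at \<tau> within {0..t})"
        by (intro vector_diff_chain_within)
      then have dy: "((\<lambda>\<tau>. y (t - \<tau>)) has_vector_derivative - ?y') (at \<tau> within {0..t})"
        by (simp only: comp_def scaleR_minus1_left)
      have "inner (flow lam t (v \<tau>)) (- ?y') = inner (GG (- s) (flow lam \<tau> (v \<tau>))) (flow lam (- (t - \<tau>)) (y (t - \<tau>)))"
      proof -
        let ?Y = "flow lam (- (t - \<tau>)) (y (t - \<tau>))"
        have "inner (flow lam t (v \<tau>)) (- ?y') = inner (flow lam (t - \<tau>) (GG s ?Y)) (flow lam t (v \<tau>))"
          by (simp only: minus_minus inner_commute)
        also have "\<dots> = inner (GG s ?Y) (flow lam \<tau> (v \<tau>))" by (simp add: inner_flow[of lam "t - \<tau>"] flow_flow)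
        also have "\<dots> = inner (GG (- s) (flow lam \<tau> (v \<tau>))) ?Y" unfolding GG_adjoint[of s] by (rule inner_commute)
        finally show ?thesis .
      qed
      then have "inner (flow lam t (v \<tau>)) (- ?y') + inner (- flow lam (t - \<tau>) (GG (- s) (flow lam \<tau> (v \<tau>)))) (y (t - \<tau>)) = 0"
        by (simp add: inner_flow)
      with bounded_bilinear.has_vector_derivative[OF bounded_bilinear_inner dv dy] show ?thesis by simp
    qed
    from fundamental_theorem_of_calculus[OF t this] have "((\<lambda>_. 0) has_integral (?K t - ?K 0)) {0..t}" .
    then have "?K t = ?K 0" by simp
    then have "(norm (v t))\<^sup>2 = inner (flow lam t (v 0)) (y t)" by (simp add: y(2) norm_flow flip: power2_norm_eq_inner)
    also have "\<dots> \<le> norm (v 0) * norm (y t)" using norm_cauchy_schwarz[of "flow lam t (v 0)" "y t"] by (simp add: norm_flow)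
    finally have 1: "norm (v t) * norm (v t) \<le> norm (v 0) * norm (y t)" by (simp only: power2_eq_square)
    have "norm (y t) \<le> M * exp (- \<alpha> * t) * norm (v t)"
      using M(2)[OF y(1) _ t] solves_entry_0[OF v(1) t] v(2) by (simp add: y(2) norm_flow entry_flow)
    from order_trans[OF 1 mult_left_mono[OF this norm_ge_zero[of "v 0"]]]
    have "norm (v t) * norm (v t) \<le> norm (v t) * (M * exp (- \<alpha> * t) * norm (v 0))"
      by (simp only: mult_ac)
    then show ?thesis using M(1) by (cases "norm (v t) = 0") auto
  qed
  then show ?thesis unfolding decays_def using M(1) by blast
qed

text \<open>Reversing all phases preserves the gap condition, so negative \<open>s\<close> follow by
  duality from \<open>- s\<close>; the rates belonging to the two signs are merged by their
  minimum.\<close>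

theorem ex_decay_rate:
  assumes gap: "gap_condition lam c"
  shows "\<exists>\<alpha>>0. \<forall>s. decays lam s \<alpha>"
proof -
  have "gap_condition (\<lambda>k. - lam k) c" using gap by (auto simp: gap_condition_def abs_minus_commute)
  then obtain \<alpha> \<beta> where \<alpha>: "0 < \<alpha>" "\<And>s. 0 \<le> s \<Longrightarrow> decays lam s \<alpha>" and \<beta>: "0 < \<beta>" "\<And>s. 0 \<le> s \<Longrightarrow> decays (\<lambda>k. - lam k) s \<beta>"
    using decays_nonneg[OF gap] decays_nonneg[of "\<lambda>k. - lam k" c] by blast
  have "decays lam s (min \<alpha> \<beta>)" for s
  proof (cases "0 \<le> s")
    case True
    then show ?thesis using decays_mono[OF \<alpha>(2)] by simp
  next
    case False
    then show ?thesis using decays_mono[OF decays_dual[of lam "- s"]] \<beta>(2)[of "- s"] by simp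
  qed
  then show ?thesis using \<alpha>(1) \<beta>(1) by (intro exI[of _ "min \<alpha> \<beta>"]) auto
qed

end

section \<open>The linearized Smith equation\<close>

text \<open>The symbol is even, nondecreasing in \<open>\<bar>k\<bar>\<close> and at least
  \<open>\<bar>k\<bar>\<close>. These properties alone give the gap; the phases being odd, the
  larger index may be taken nonnegative.\<close>

lemma gap_condition_smith: "gap_condition (phase smith_symbol) (1 / 2)"
proof -
  let ?a = smith_symbol
  have a0: "0 \<le> ?a k" for k by (simp add: smith_symbol_def)
  have mono: "?a k \<le> ?a j" if "\<bar>k\<bar> \<le> \<bar>j\<bar>" for j k
  proof -
    have "\<bar>real_of_int k\<bar> \<le> \<bar>real_of_int j\<bar>" using that by linarith
    then have "(real_of_int k)\<^sup>2 \<le> (real_of_int j)\<^sup>2" by (simp only: abs_le_square_iff)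
    then show ?thesis by (simp add: smith_symbol_def)
  qed
  have lower: "\<bar>real_of_int k\<bar> \<le> ?a k" for k
  proof (cases "k = 0")
    case False
    let ?x = "\<bar>real_of_int k\<bar>"
    have x: "1 \<le> ?x" using False by linarith
    \<comment> \<open>The denominator 3 is fitted to the factor \<open>2 * pi\<close> of the symbol,
      which exceeds 3.\<close>
    have "(1 + ?x / 3)\<^sup>2 \<le> (real_of_int k)\<^sup>2 + 1"
    proof -
      have "?x * 1 \<le> ?x * ?x" using x by (intro mult_left_mono) auto
      moreover have "(1 + ?x / 3)\<^sup>2 = 1 + 2 * ?x / 3 + ?x * ?x / 9" by (simp add: power2_eq_square algebra_simps)
      moreover have "(real_of_int k)\<^sup>2 = ?x * ?x" by (simp add: power2_eq_square)
      ultimately show ?thesis using x by linarith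
    qed
    then have "1 + ?x / 3 \<le> sqrt ((real_of_int k)\<^sup>2 + 1)" by (rule real_le_rsqrt)
    then have "?x / 3 \<le> sqrt ((real_of_int k)\<^sup>2 + 1) - 1" by linarith
    from mult_mono[OF _ this, of 3 "2 * pi"] x pi_gt3 show ?thesis by (simp add: smith_symbol_def)
  qed (simp add: a0)
  \<comment> \<open>The loss of 1/2 comes from opposite signs: then only
    \<open>x * p \<ge> x * x\<close> is kept, and \<open>x - y\<close> can be as large as
    \<open>2 * x\<close>.\<close>
  have basic: "1 / 2 * (x * (x - y)) \<le> x * p - y * r" if "0 \<le> r" "r \<le> p" "x \<le> p" "\<bar>y\<bar> \<le> x" for x y p r :: real
  proof (cases "0 \<le> y")
    case True
    have "y * r \<le> y * p" using True that by (intro mult_left_mono) auto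
    moreover have "(x - y) * x \<le> (x - y) * p" using that by (intro mult_left_mono) auto
    moreover have "0 \<le> (x - y) * x" using that by auto
    ultimately show ?thesis by (simp add: algebra_simps)
  next
    case False
    then have "y * r \<le> 0" using that by (simp add: mult_nonpos_nonneg)
    moreover have "x * x \<le> x * p" using that by (intro mult_left_mono) auto
    moreover have "x * (x - y) \<le> x * (2 * x)" using that by (intro mult_left_mono) auto
    ultimately show ?thesis by (simp add: algebra_simps)
  qed
  have odd: "phase ?a (- k) = - phase ?a k" for k by (simp add: smith_symbol_def)
  have pos: "1 / 2 * (real_of_int j * (real_of_int j - real_of_int k)) \<le> phase ?a j - phase ?a k" if "\<bar>k\<bar> \<le> j" for j k
    using basic[OF a0 mono, of k j "of_int j" "of_int k"] lower[of j] that by auto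
  have main: "1 / 2 * real_of_int (max \<bar>j\<bar> \<bar>k\<bar> * \<bar>j - k\<bar>) \<le> \<bar>phase ?a j - phase ?a k\<bar>" if "\<bar>k\<bar> \<le> \<bar>j\<bar>" for j k
  proof (cases "0 \<le> j")
    case True
    then have "real_of_int (max \<bar>j\<bar> \<bar>k\<bar> * \<bar>j - k\<bar>) = real_of_int j * (real_of_int j - real_of_int k)"
      using that by (simp add: max_def)
    then show ?thesis using pos[of k j] that True by linarith
  next
    case False
    then have "real_of_int (max \<bar>j\<bar> \<bar>k\<bar> * \<bar>j - k\<bar>) = real_of_int (- j) * (real_of_int (- j) - real_of_int (- k))"
      using that by (simp add: max_def)
    then have "1 / 2 * real_of_int (max \<bar>j\<bar> \<bar>k\<bar> * \<bar>j - k\<bar>) \<le> phase ?a (- j) - phase ?a (- k)"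
      using pos[of "- k" "- j"] that False by simp
    then show ?thesis unfolding odd by linarith
  qed
  have "1 / 2 * real_of_int (max \<bar>j\<bar> \<bar>k\<bar> * \<bar>j - k\<bar>) \<le> \<bar>phase ?a j - phase ?a k\<bar>" for j k
    using main[of k j] main[of j k] by (cases "\<bar>k\<bar> \<le> \<bar>j\<bar>") (auto simp: max.commute abs_minus_commute)
  then show ?thesis by (simp add: gap_condition_def)
qed

lemma flow_single_0: "flow (phase a) t (single 0 z) = single 0 z"
  by (rule ell2_eqI) (simp add: entry_flow entry_single)

lemma to_ell2_mean:
  assumes "v \<in> Hs s"
  shows "dist_of (\<lambda>_. fourier v 0) \<in> Hs s" "to_ell2 s (dist_of (\<lambda>_. fourier v 0)) = single 0 (entry (to_ell2 s v) 0)"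
  using to_ell2_const[of "fourier v 0" s] assms by (auto simp: entry_to_ell2)

context control_weight
begin

text \<open>Pulled back to time 0, reaching \<open>u1\<close> means that the control integral equals
  \<open>y\<close>. Equal means give \<open>y\<close> a vanishing entry 0, so the diagonal can be
  inverted on it.\<close>

theorem exact_controllability:
  assumes gap: "gap_condition (phase a) c" and T: "0 < T"
  shows "\<exists>\<nu>>0. \<forall>u0\<in>Hs s. \<forall>u1\<in>Hs s. fourier u0 0 = fourier u1 0 \<longrightarrow>
    (\<exists>h\<in>L2_Hs s T.
      (\<exists>u. mild_solution a s {0..T} u0 (\<lambda>t. G_op g (h t)) u \<and>
         (\<forall>w. mild_solution a s {0..T} u0 (\<lambda>t. G_op g (h t)) w \<longrightarrow> (\<forall>t\<in>{0..T}. w t = u t)) \<and>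
         u T = u1) \<and>
      L2_Hs_norm s T h \<le> \<nu> * (Hs_norm s u0 + Hs_norm s u1))"
proof -
  let ?U = "flow (phase a)"
  obtain q Q where q: "biorthogonal_family T (phase a) T UNIV q Q" using biorthogonal_family_exists[OF gap T] by blast
  obtain C where C: "0 \<le> C" "\<And>y. entry y 0 = 0 \<Longrightarrow> \<exists>x. mult_ell2 (\<lambda>k. complex_of_real (gdiag k)) x = y \<and> norm x \<le> C * norm y"
    using ex_gdiag_preimage by blast
  have q_cont: "continuous_on S (q j)" for S j
    using q continuous_on_subset[of UNIV "q j" S] by (auto simp: biorthogonal_family_def)
  have q_le: "cmod (q j t) \<le> Q" for j t using q by (auto simp: biorthogonal_family_def)
  have Q0: "0 \<le> Q" using order_trans[OF norm_ge_zero q_le] .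
  \<comment> \<open>\<open>Q\<close> bounds the time functions, \<open>C\<close> the inverse of the
    diagonal, \<open>sqrt T\<close> comes from integrating over the interval, and 1 is added for
    positivity.\<close>
  define \<nu> where "\<nu> = sqrt T * (Q * C) + 1"
  have \<nu>: "0 < \<nu>" using T Q0 C by (simp add: \<nu>_def add_nonneg_pos)
  have "\<exists>h\<in>L2_Hs s T.
      (\<exists>u. mild_solution a s {0..T} u0 (\<lambda>t. G_op g (h t)) u \<and>
         (\<forall>w. mild_solution a s {0..T} u0 (\<lambda>t. G_op g (h t)) w \<longrightarrow> (\<forall>t\<in>{0..T}. w t = u t)) \<and>
         u T = u1) \<and>
      L2_Hs_norm s T h \<le> \<nu> * (Hs_norm s u0 + Hs_norm s u1)"
    if u0: "u0 \<in> Hs s" and u1: "u1 \<in> Hs s" and mean: "fourier u0 0 = fourier u1 0" for u0 u1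
  proof -
    define y where "y = ?U (- T) (to_ell2 s u1) - to_ell2 s u0"
    have "entry y 0 = 0" using mean by (simp add: y_def entry_flow entry_to_ell2 u0 u1)
    then obtain x where x: "mult_ell2 (\<lambda>k. complex_of_real (gdiag k)) x = y" "norm x \<le> C * norm y" using C(2) by blast
    have "norm y \<le> Hs_norm s u0 + Hs_norm s u1"
      using norm_triangle_ineq4[of "?U (- T) (to_ell2 s u1)" "to_ell2 s u0"] by (simp add: y_def norm_flow Hs_norm_eq u0 u1)
    then have x_le: "norm x \<le> C * (Hs_norm s u0 + Hs_norm s u1)"
      using x(2) mult_left_mono[of "norm y" _ C] C(1) by (meson order_trans)
    define H where "H = (\<lambda>\<tau>. mult_ell2 (\<lambda>j. q j \<tau>) x)"
    define h where "h = (\<lambda>\<tau>. of_ell2 s (H \<tau>))"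
    have h: "h \<tau> \<in> Hs s" "to_ell2 s (h \<tau>) = H \<tau>" for \<tau> by (simp_all add: h_def of_ell2)
    have H_cont: "continuous_on S H" for S
      unfolding H_def by (intro continuous_mult_ell2[where C = Q] q_cont q_le continuous_on_const)
    have H_le: "norm (H \<tau>) \<le> Q * norm x" for \<tau>
      unfolding H_def by (rule norm_mult_ell2_le) (rule q_le)
    have h_norm: "(Hs_norm s (h \<tau>))\<^sup>2 = (norm (H \<tau>))\<^sup>2" for \<tau> by (simp add: Hs_norm_eq h)
    have int: "integrable (lebesgue_on {0..T}) (\<lambda>\<tau>. (norm (H \<tau>))\<^sup>2)"
      by (intro continuous_imp_integrable_real continuous_intros H_cont)
    have hL2: "h \<in> L2_Hs s T"
      using strongly_measurable_Hs_continuous[of T h s H] h H_cont T int by (simp add: L2_Hs_def h_norm)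
    have "L2_Hs_norm s T h \<le> \<nu> * (Hs_norm s u0 + Hs_norm s u1)"
    proof -
      have "integral\<^sup>L (lebesgue_on {0..T}) (\<lambda>\<tau>. (norm (H \<tau>))\<^sup>2) \<le> integral\<^sup>L (lebesgue_on {0..T}) (\<lambda>\<tau>. (Q * norm x)\<^sup>2)"
        by (intro Bochner_Integration.integral_mono int continuous_imp_integrable_real continuous_intros power_mono H_le) auto
      also have "\<dots> = T * (Q * norm x)\<^sup>2" using T by (simp add: measure_restrict_space)
      finally have "L2_Hs_norm s T h \<le> sqrt (T * (Q * norm x)\<^sup>2)"
        unfolding L2_Hs_norm_def h_norm by (rule real_sqrt_le_mono)
      also have "\<dots> = sqrt T * (Q * norm x)" using Q0 by (simp add: real_sqrt_mult)
      also have "\<dots> \<le> sqrt T * (Q * (C * (Hs_norm s u0 + Hs_norm s u1)))"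
        using T by (intro mult_left_mono x_le Q0) auto
      also have "\<dots> \<le> \<nu> * (Hs_norm s u0 + Hs_norm s u1)"
        by (simp add: \<nu>_def distrib_right mult.assoc Hs_norm_eq u0 u1)
      finally show ?thesis .
    qed
    define f where "f = (\<lambda>\<tau>. G_op g (h \<tau>))"
    have f: "f \<tau> \<in> Hs s" "to_ell2 s (f \<tau>) = Gs s (H \<tau>)" for \<tau> using to_ell2_G_op[OF h(1)] by (simp_all add: f_def h)
    have "continuous_Hs s {0..T} f"
      unfolding continuous_Hs_iff using f by (simp add: bounded_linear.continuous_on[OF bounded_linear_Gs H_cont])
    note iff = mild_solution_iff[OF disjI1[OF refl] u0 this, of a]
    define u where "u = (\<lambda>t. of_ell2 s (?U t (to_ell2 s u0 + integral {0..t} (\<lambda>\<tau>. ?U (- \<tau>) (to_ell2 s (f \<tau>))))))"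
    have u: "u t \<in> Hs s" "to_ell2 s (u t) = ?U t (to_ell2 s u0 + integral {0..t} (\<lambda>\<tau>. ?U (- \<tau>) (to_ell2 s (f \<tau>))))" for t
      by (simp_all add: u_def of_ell2)
    have "mild_solution a s {0..T} u0 f u" unfolding iff using u by blast
    moreover have "w t = u t" if "mild_solution a s {0..T} u0 f w" "t \<in> {0..T}" for w t
      using that u[of t] unfolding iff by (intro to_ell2_inject[of _ s]) auto
    moreover have "u T = u1"
    proof (rule to_ell2_inject[OF u(1) u1])
      have "integral {0..T} (\<lambda>\<tau>. ?U (- \<tau>) (to_ell2 s (f \<tau>))) = y"
        using integral_control[OF q, of s x] T x(1) by (simp add: f H_def)
      then show "to_ell2 s (u T) = to_ell2 s u1" unfolding u(2) by (simp add: y_def flow_flow)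
    qed
    ultimately show ?thesis
      using hL2 \<open>L2_Hs_norm s T h \<le> _\<close> unfolding f_def by (intro bexI[of _ h] conjI exI[of _ u]) blast+
  qed
  then show ?thesis using \<nu> by blast
qed

theorem exponential_stabilization:
  assumes gap: "gap_condition (phase a) c"
  shows "\<exists>\<alpha>>0. \<forall>s. \<exists>M>0. \<forall>u0\<in>Hs s.
    \<exists>u. mild_solution a s {0..} u0 (\<lambda>t. - G_op g (G_adj g (u t))) u \<and>
      (\<forall>w. mild_solution a s {0..} u0 (\<lambda>t. - G_op g (G_adj g (w t))) w \<longrightarrow> (\<forall>t\<ge>0. w t = u t)) \<and>
      (\<forall>t\<ge>0. Hs_norm s (u t - dist_of (\<lambda>_. fourier u0 0))
         \<le> M * exp (- \<alpha> * t) * Hs_norm s (u0 - dist_of (\<lambda>_. fourier u0 0)))"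
proof -
  obtain \<alpha> where \<alpha>: "0 < \<alpha>" "\<And>s. decays (phase a) s \<alpha>" using ex_decay_rate[OF gap] by blast
  have "\<exists>M>0. \<forall>u0\<in>Hs s.
    \<exists>u. mild_solution a s {0..} u0 (\<lambda>t. - G_op g (G_adj g (u t))) u \<and>
      (\<forall>w. mild_solution a s {0..} u0 (\<lambda>t. - G_op g (G_adj g (w t))) w \<longrightarrow> (\<forall>t\<ge>0. w t = u t)) \<and>
      (\<forall>t\<ge>0. Hs_norm s (u t - dist_of (\<lambda>_. fourier u0 0))
         \<le> M * exp (- \<alpha> * t) * Hs_norm s (u0 - dist_of (\<lambda>_. fourier u0 0)))" for s
  proof -
    obtain M where M: "0 \<le> M" "\<And>v t. solves (phase a) (GG s) v \<Longrightarrow> entry (v 0) 0 = 0 \<Longrightarrow> 0 \<le> t \<Longrightarrow>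
        norm (v t) \<le> M * exp (- \<alpha> * t) * norm (v 0)"
      using \<alpha>(2)[of s] unfolding decays_def by blast
    have K: "- G_op g (G_adj g v) \<in> Hs s \<and> to_ell2 s (- G_op g (G_adj g v)) = - GG s (to_ell2 s v)" if "v \<in> Hs s" for v
      using to_ell2_G_op[OF that] to_ell2_G_op[of "G_op g v" s] by (simp add: G_adj_eq_G_op GG_def Hs_minus)
    have "\<exists>u. mild_solution a s {0..} u0 (\<lambda>t. - G_op g (G_adj g (u t))) u \<and>
      (\<forall>w. mild_solution a s {0..} u0 (\<lambda>t. - G_op g (G_adj g (w t))) w \<longrightarrow> (\<forall>t\<ge>0. w t = u t)) \<and>
      (\<forall>t\<ge>0. Hs_norm s (u t - dist_of (\<lambda>_. fourier u0 0))
         \<le> (M + 1) * exp (- \<alpha> * t) * Hs_norm s (u0 - dist_of (\<lambda>_. fourier u0 0)))" if u0: "u0 \<in> Hs s" for u0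
    proof -
      obtain u v where u: "mild_solution a s {0..} u0 (\<lambda>t. - G_op g (G_adj g (u t))) u"
        "\<forall>w. mild_solution a s {0..} u0 (\<lambda>t. - G_op g (G_adj g (w t))) w \<longrightarrow> (\<forall>t\<ge>0. w t = u t)"
        and v: "solves (phase a) (GG s) v" "v 0 = to_ell2 s u0"
        and uv: "\<And>t. 0 \<le> t \<Longrightarrow> u t \<in> Hs s \<and> to_ell2 s (u t) = flow (phase a) t (v t)"
        using mild_solution_feedback[of "GG s" s "\<lambda>v. - G_op g (G_adj g v)" u0 a, OF bounded_linear_GG K u0] by blast
      \<comment> \<open>The constant mode is stationary under flow and feedback; subtracting it
        leaves a solution without mean, to which the decay applies.\<close>
      define e where "e = single 0 (entry (to_ell2 s u0) 0)"
      have "solves (phase a) (GG s) (\<lambda>_. e)"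
        unfolding solves_def by (simp add: e_def flow_single_0 GG_def Gs_single_0 flow_minus linear_0[OF flow_linear]
            linear_0[OF bounded_linear.linear[OF bounded_linear_Gs]])
      then have ve: "solves (phase a) (GG s) (\<lambda>t. v t - e)" by (rule solves_diff[OF bounded_linear_GG v(1)])
      have "Hs_norm s (u t - dist_of (\<lambda>_. fourier u0 0))
         \<le> (M + 1) * exp (- \<alpha> * t) * Hs_norm s (u0 - dist_of (\<lambda>_. fourier u0 0))" if t: "0 \<le> t" for t
      proof -
        have "Hs_norm s (u t - dist_of (\<lambda>_. fourier u0 0)) = norm (flow (phase a) t (v t) - e)"
          using uv[OF t] to_ell2_mean[OF u0] by (simp add: Hs_norm_diff e_def)
        also have "\<dots> = norm (flow (phase a) t (v t - e))" by (simp add: flow_diff e_def flow_single_0)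
        also have "\<dots> = norm (v t - e)" by (rule norm_flow)
        also have "\<dots> \<le> M * exp (- \<alpha> * t) * norm (v 0 - e)"
          using M(2)[OF ve _ t] v(2) by (simp add: e_def entry_single)
        also have "\<dots> \<le> (M + 1) * exp (- \<alpha> * t) * norm (v 0 - e)" by (intro mult_right_mono) auto
        also have "norm (v 0 - e) = Hs_norm s (u0 - dist_of (\<lambda>_. fourier u0 0))"
          using u0 to_ell2_mean[OF u0] v(2) by (simp add: Hs_norm_diff e_def)
        finally show ?thesis .
      qed
      then show ?thesis using u by blast
    qed
    \<comment> \<open>\<open>M\<close> may be 0, whereas a positive constant is required.\<close>
    then show ?thesis using M(1) by (intro exI[of _ "M + 1"]) auto
  qed
  then show ?thesis using \<alpha>(1) by blast
qed

end

text \<open>The feedback may be any bounded operator, so damping every nonconstant mode at the rate \<open>r\<close> suffices.\<close>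

theorem stabilization_any_rate:
  assumes r: "0 < r"
  shows "\<exists>K. bounded_linear_Hs s K \<and>
    (\<forall>u0\<in>Hs s.
      \<exists>u. mild_solution a s {0..} u0 (\<lambda>t. K (u t)) u \<and>
        (\<forall>w. mild_solution a s {0..} u0 (\<lambda>t. K (w t)) w \<longrightarrow> (\<forall>t\<ge>0. w t = u t)) \<and>
        (\<forall>t\<ge>0. Hs_norm s (u t - dist_of (\<lambda>_. fourier u0 0))
           \<le> exp (- r * t) * Hs_norm s (u0 - dist_of (\<lambda>_. fourier u0 0))))"
proof -
  define K where "K = (\<lambda>v. (- r) *\<^sub>R (v - dist_of (\<lambda>_. fourier v 0)))"
  define B where "B = (\<lambda>x. r *\<^sub>R (x - single 0 (entry x 0)))"
  have K: "K v \<in> Hs s \<and> to_ell2 s (K v) = - B (to_ell2 s v)" if "v \<in> Hs s" for v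
    using Hs_diff[OF that to_ell2_mean(1)[OF that]] that by (simp add: K_def B_def Hs_scaleR Hs_minus to_ell2_mean)
  have "norm (x - single 0 (entry x 0)) \<le> 1 * norm x" for x
    by (rule norm_ell2_mono) (auto simp: entry_single)
  then have B_le: "norm (B x) \<le> r * norm x" for x using r by (simp add: B_def)
  have B: "bounded_linear B"
  proof (rule bounded_linear_intro)
    show "norm (B x) \<le> norm x * r" for x using B_le by (simp add: mult.commute)
  qed (auto simp: B_def entry_single algebra_simps intro!: ell2_eqI)
  have fc: "fourier (dist_of (\<lambda>_. c)) k = (if k = 0 then c else 0)" for c k
  proof -
    have "wt 0 k * fourier (dist_of (\<lambda>_. c)) k = (if k = 0 then wt 0 0 * c else 0)"
      using entry_to_ell2[of "dist_of (\<lambda>_. c)" 0 k] to_ell2_const[of c 0] by (simp add: entry_single)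
    then show ?thesis by (simp split: if_splits)
  qed
  have fK: "fourier (K v) k = (- r) *\<^sub>R (if k = 0 then 0 else fourier v k)" for v k
    by (simp only: K_def fourier_scaleR fourier_diff fc) simp
  have "bounded_linear_Hs s K"
    unfolding bounded_linear_Hs_def
  proof (intro conjI ballI allI exI)
    show "K v \<in> Hs s" if "v \<in> Hs s" for v using K[OF that] ..
    show "K (v + w) = K v + K w" for v w by (rule fourier_inject) (simp add: fK fourier_add algebra_simps)
    show "K (scaleC_pdist z v) = scaleC_pdist z (K v)" for z v by (rule fourier_inject) (simp add: fK fourier_scaleC)
    show "Hs_norm s (K v) \<le> r * Hs_norm s v" if "v \<in> Hs s" for v
      using K[OF that] B_le that by (simp add: Hs_norm_eq)
  qed
  moreover have "\<exists>u. mild_solution a s {0..} u0 (\<lambda>t. K (u t)) u \<and>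
        (\<forall>w. mild_solution a s {0..} u0 (\<lambda>t. K (w t)) w \<longrightarrow> (\<forall>t\<ge>0. w t = u t)) \<and>
        (\<forall>t\<ge>0. Hs_norm s (u t - dist_of (\<lambda>_. fourier u0 0))
           \<le> exp (- r * t) * Hs_norm s (u0 - dist_of (\<lambda>_. fourier u0 0)))" if u0: "u0 \<in> Hs s" for u0
  proof -
    let ?U = "flow (phase a)"
    obtain u v where u: "mild_solution a s {0..} u0 (\<lambda>t. K (u t)) u"
      "\<forall>w. mild_solution a s {0..} u0 (\<lambda>t. K (w t)) w \<longrightarrow> (\<forall>t\<ge>0. w t = u t)"
      and v: "solves (phase a) B v" "v 0 = to_ell2 s u0"
      and uv: "\<And>t. 0 \<le> t \<Longrightarrow> u t \<in> Hs s \<and> to_ell2 s (u t) = ?U t (v t)"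
      using mild_solution_feedback[of B s K u0 a, OF B K u0] by blast
    define e where "e = single 0 (entry (to_ell2 s u0) 0)"
    define x where "x = to_ell2 s u0 - e"
    \<comment> \<open>The explicit solution: the mean is kept, every other mode is damped by the
      same factor. Uniqueness identifies it with \<open>v\<close>.\<close>
    define w where "w = (\<lambda>t. e + exp (- r * t) *\<^sub>R x)"
    have Bw: "- ?U (- t) (B (?U t (w t))) = (- r * exp (- r * t)) *\<^sub>R x" for t
      by (rule ell2_eqI) (auto simp: B_def entry_flow w_def e_def x_def entry_single cis_mult simp flip: mult.assoc)
    have "(w has_vector_derivative - ?U (- t) (B (?U t (w t)))) (at t within {0..})" for t
    proof -
      have "((\<lambda>t. exp (- r * t)) has_real_derivative - r * exp (- r * t)) (at t within {0..})"
        by (auto intro!: derivative_eq_intros)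
      then have "((\<lambda>t. e + exp (- r * t) *\<^sub>R x) has_vector_derivative (0 + (exp (- r * t) *\<^sub>R 0 + (- r * exp (- r * t)) *\<^sub>R x))) (at t within {0..})"
        by (intro has_vector_derivative_add has_vector_derivative_const has_vector_derivative_scaleR)
      then show ?thesis unfolding Bw by (simp add: w_def)
    qed
    then have "solves (phase a) B w" by (simp add: solves_def)
    moreover have "w 0 = v 0" by (simp add: w_def x_def v(2))
    ultimately have vw: "v t = w t" if "0 \<le> t" for t using solves_unique[OF B v(1) _ _ that, of w] by simp
    have "Hs_norm s (u t - dist_of (\<lambda>_. fourier u0 0)) \<le> exp (- r * t) * Hs_norm s (u0 - dist_of (\<lambda>_. fourier u0 0))"
      if t: "0 \<le> t" for t
    proof -
      have "Hs_norm s (u t - dist_of (\<lambda>_. fourier u0 0)) = norm (?U t (v t) - e)"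
        using uv[OF t] to_ell2_mean[OF u0] by (simp add: Hs_norm_diff e_def)
      also have "?U t (v t) - e = ?U t (exp (- r * t) *\<^sub>R x)"
        unfolding vw[OF t] w_def by (simp add: flow_add e_def flow_single_0)
      also have "norm \<dots> = exp (- r * t) * norm x" by (simp add: norm_flow)
      also have "norm x = Hs_norm s (u0 - dist_of (\<lambda>_. fourier u0 0))"
        using u0 to_ell2_mean[OF u0] by (simp add: Hs_norm_diff e_def x_def)
      finally show ?thesis by simp
    qed
    then show ?thesis using u by blast
  qed
  ultimately show ?thesis by blast
qed

theorem mainTheorem5:
  fixes g :: "real \<Rightarrow> real"
  assumes g_smooth: "(\<lambda>x. complex_of_real (g x)) \<in> test_functions"
    and g_nonneg: "\<And>x. g x \<ge> 0"
    and g_integral: "(g has_integral 1) {0..2 * pi}"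
    and g_support: "\<exists>a b. a < b \<and> {x. g x > 0} = (\<Union>n::int. {a + 2 * pi * n <..< b + 2 * pi * n})"
  shows
    "(\<forall>s::real. \<forall>T>0. \<exists>\<nu>>0. \<forall>u0\<in>Hs s. \<forall>u1\<in>Hs s. fourier u0 0 = fourier u1 0 \<longrightarrow>
        (\<exists>h\<in>L2_Hs s T.
          (\<exists>u. mild_solution smith_symbol s {0..T} u0 (\<lambda>t. G_op g (h t)) u \<and>
             (\<forall>w. mild_solution smith_symbol s {0..T} u0 (\<lambda>t. G_op g (h t)) w \<longrightarrow> (\<forall>t\<in>{0..T}. w t = u t)) \<and>
             u T = u1) \<and>
          L2_Hs_norm s T h \<le> \<nu> * (Hs_norm s u0 + Hs_norm s u1)))
     \<and>
     (\<exists>\<alpha>>0. \<forall>s::real. \<exists>M>0. \<forall>u0\<in>Hs s.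
        \<exists>u. mild_solution smith_symbol s {0..} u0 (\<lambda>t. - G_op g (G_adj g (u t))) u \<and>
          (\<forall>w. mild_solution smith_symbol s {0..} u0 (\<lambda>t. - G_op g (G_adj g (w t))) w \<longrightarrow> (\<forall>t\<ge>0. w t = u t)) \<and>
          (\<forall>t\<ge>0. Hs_norm s (u t - dist_of (\<lambda>_. fourier u0 0))
             \<le> M * exp (- \<alpha> * t) * Hs_norm s (u0 - dist_of (\<lambda>_. fourier u0 0))))
     \<and>
     (\<forall>s::real. \<forall>r>0. \<exists>M>0. \<exists>K. bounded_linear_Hs s K \<and>
        (\<forall>u0\<in>Hs s.
          \<exists>u. mild_solution smith_symbol s {0..} u0 (\<lambda>t. K (u t)) u \<and>
            (\<forall>w. mild_solution smith_symbol s {0..} u0 (\<lambda>t. K (w t)) w \<longrightarrow> (\<forall>t\<ge>0. w t = u t)) \<and>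
            (\<forall>t\<ge>0. Hs_norm s (u t - dist_of (\<lambda>_. fourier u0 0))
               \<le> M * exp (- r * t) * Hs_norm s (u0 - dist_of (\<lambda>_. fourier u0 0)))))"
proof -
  interpret control_weight g by unfold_locales (fact g_smooth g_nonneg g_integral)+
  show ?thesis (is "?P \<and> ?Q \<and> ?R")
  proof (intro conjI)
    show ?P
      using exact_controllability[OF gap_condition_smith] by (intro allI impI) assumption
    show ?Q
      by (rule exponential_stabilization[OF gap_condition_smith])
    \<comment> \<open>The constant is 1: the flow is isometric and the part without mean is exactly
      scaled by \<open>exp (- r * t)\<close>.\<close>
    show ?R
      using stabilization_any_rate[where a = smith_symbol] by (intro allI impI exI[of _ "1::real"] conjI) simp_all
  qed
qed

end
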